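(* Let $\psi\in C_0^\infty(\mathbb{R})$ be supported in $B_1=[-1,1]$, let $\phi:[-1,1]\to\mathbb{R}$ be real-valued with the regularity indicated in each item below, and assume that $\phi(0)=\phi'(0)=0$ and that $\frac1{10}\le \phi''(x)\le 10$ for all $|x|\le 1$. For $\lambda>0$ put $I(\lambda)=\int_{\mathbb{R}} e^{i\lambda\phi(x)}\psi(x)\,dx$ and define $R(\lambda)$ by $$I(\lambda)=(2\pi)^{1/2}\lambda^{-1/2}\frac{\psi(0)e^{i\pi/4}}{[\phi''(0)]^{1/2}}+R(\lambda).$$ Then: (1) (for $\phi\in C^3$) For every $p\in[1,\infty)$ there exists a constant $C$ independent of $\phi,\psi,\lambda$ such that $$|R(\lambda)|\le C\lambda^{-1+\frac1{2p}}\left(\|\phi'''\|_{L^p(B_1)}\|\psi\|_{L^\infty(B_1)}+\|\psi'\|_{L^\infty(B_1)}\right).$$ (2) (for $\phi\in C^4$) $|R(\lambda)|\le \lambda^{-3/2}\,C\big(S_{[2,4]}(\phi),S_{[0,2]}(\psi)\big)$, where $C(\cdot,\cdot)$ is a finite-valued nonnegative function of two real variables that does not depend on $\phi,\psi,\lambda$. (3) (for $\phi\in C^\infty$) Assume further that $|\psi^{(k)}(x)|\le C_k$ and $|\phi^{(k)}(x)|\le C_k$ for all $|x|<1$ and all $k\in\mathbb{N}$, for some constants $C_k$. Then for every $K\in\mathbb{N}$ one has $$R(\lambda)=(2\pi)^{1/2}\lambda^{-1/2}e^{i\pi/4}\sum_{k=1}^K\frac{a_k\lambda^{-k}}{k!}+\tilde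 R(\lambda),$$ where the $a_k$ are complex numbers not depending on $\lambda$ with $|a_k|\le C^k$, and $|\tilde R(\lambda)|\le C'_K\lambda^{-K-3/2}$, with constants $C,C'_K$ independent of $\phi$ and $\lambda$.
   Context: $\mathbb{N}=\{0,1,2,\dots\}$ and $B_1=\{x\in\mathbb{R}:|x|\le1\}$. For a function $f$ on $B_1$ and integers $0\le k\le j$: $S_k(f)=\sup_{x\in B_1}|f^{(k)}(x)|$ and $S_{[k,j]}(f)=\sum_{k\le l\le j}S_l(f)$. In (3), the constants $C,C'_K$ may depend on $K$ and on the given sequence of bounds $(C_k)$. *)

theory Defs
  imports "HOL-Analysis.Analysis" "HOL-Probability.Essential_Supremum"
begin

abbreviation B1 :: "real set"
  where "B1 \<equiv> {-1..1}"

text \<open>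
  The derivative of order \<open>k\<close> relative to \<open>S\<close>. For \<open>S = B1\<close> it is one-sided at the end points,
  so on \<open>B1\<close> it depends only on the restriction of \<open>f\<close> to \<open>B1\<close>; for \<open>S = UNIV\<close> it is the
  ordinary derivative. Values at points outside \<open>S\<close> carry no meaning.
\<close>
definition nth_deriv_on :: "real set \<Rightarrow> nat \<Rightarrow> (real \<Rightarrow> 'a::real_normed_vector) \<Rightarrow> real \<Rightarrow> 'a"
  where "nth_deriv_on S k = ((\<lambda>f x. vector_derivative f (at x within S)) ^^ k)"

definition Ck_on :: "real set \<Rightarrow> nat \<Rightarrow> (real \<Rightarrow> 'a::real_normed_vector) \<Rightarrow> bool"
  where "Ck_on S k f \<longleftrightarrow>
    (\<forall>j<k. \<forall>x\<in>S. nth_deriv_on S j f differentiable (at x within S)) \<and>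
    continuous_on S (nth_deriv_on S k f)"

definition Cinf_on :: "real set \<Rightarrow> (real \<Rightarrow> 'a::real_normed_vector) \<Rightarrow> bool"
  where "Cinf_on S f \<longleftrightarrow> (\<forall>k. Ck_on S k f)"

text \<open>Amplitudes are complex-valued; the support is the closure of the set where \<open>\<psi> \<noteq> 0\<close>.\<close>
definition amplitude :: "(real \<Rightarrow> complex) \<Rightarrow> bool"
  where "amplitude \<psi> \<longleftrightarrow> Cinf_on UNIV \<psi> \<and> closure {x. \<psi> x \<noteq> 0} \<subseteq> B1"

text \<open>
  The regularity of the phase is imposed separately. A phase is a function on \<open>B1\<close>: its values
  elsewhere are arbitrary.
\<close>
definition phase :: "(real \<Rightarrow> real) \<Rightarrow> bool"
  where "phase \<phi> \<longleftrightarrow> \<phi> 0 = 0 \<and> nth_deriv_on B1 1 \<phi> 0 = 0 \<and>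
    (\<forall>x\<in>B1. 1/10 \<le> nth_deriv_on B1 2 \<phi> x \<and> nth_deriv_on B1 2 \<phi> x \<le> 10)"

text \<open>
  For an amplitude the integrand vanishes outside \<open>B1\<close>, so the values of \<open>\<phi>\<close> there are irrelevant.
\<close>
definition osc_integral :: "(real \<Rightarrow> real) \<Rightarrow> (real \<Rightarrow> complex) \<Rightarrow> real \<Rightarrow> complex"
  where "osc_integral \<phi> \<psi> lam = (LBINT x. exp (\<i> * of_real (lam * \<phi> x)) * \<psi> x)"

definition remainder :: "(real \<Rightarrow> real) \<Rightarrow> (real \<Rightarrow> complex) \<Rightarrow> real \<Rightarrow> complex"
  where "remainder \<phi> \<psi> lam = osc_integral \<phi> \<psi> lam -
    of_real (sqrt (2 * pi) * lam powr (-1/2)) *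
      (\<psi> 0 * exp (\<i> * of_real pi / 4) / of_real (sqrt (nth_deriv_on B1 2 \<phi> 0)))"

definition Lp_norm :: "real \<Rightarrow> (real \<Rightarrow> 'a::real_normed_vector) \<Rightarrow> real"
  where "Lp_norm p f = (LINT x|lebesgue_on B1. norm (f x) powr p) powr (1/p)"

definition Linf_norm :: "(real \<Rightarrow> 'a::real_normed_vector) \<Rightarrow> real"
  where "Linf_norm f = real_of_ereal (esssup (lebesgue_on B1) (\<lambda>x. ereal (norm (f x))))"

definition sup_deriv :: "nat \<Rightarrow> (real \<Rightarrow> 'a::real_normed_vector) \<Rightarrow> real"
  where "sup_deriv k f = (SUP x\<in>B1. norm (nth_deriv_on B1 k f x))"

definition sup_derivs :: "nat \<Rightarrow> nat \<Rightarrow> (real \<Rightarrow> 'a::real_normed_vector) \<Rightarrow> real"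
  where "sup_derivs k j f = (\<Sum>l=k..j. sup_deriv l f)"

end

theory Submission
  imports Defs
begin

text \<open>
  The Morse coordinate \<open>Y\<close> with \<open>\<phi> = Y\<^sup>2 / 2\<close> turns the integral into
  \<open>\<integral> exp (i \<lambda> y\<^sup>2 / 2) g y dy\<close> over the line, where \<open>g \<circ> Y = \<psi> / Y'\<close> is extended by zero.
  Subtracting \<open>g 0\<close>, whose contribution is the Fresnel integral, and integrating by parts replaces
  \<open>g\<close> by \<open>T g = ((g - g 0) / y)'\<close> and gains a factor \<open>i / \<lambda>\<close>; hence \<open>a\<^sub>k = k! i\<^sup>k (T\<^sup>k g) 0\<close>.
  Although \<open>T g\<close> has no compact support, the boundary terms at \<open>\<plusminus>L\<close> are \<open>O (1 / L)\<close>, and the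
  integral left after the last step is \<open>O (1 / sqrt \<lambda>)\<close>, by splitting at \<open>|y| = 1 / sqrt \<lambda>\<close>.
  The \<open>L\<^sup>p\<close> estimate uses the same splitting together with
  \<open>\<integral>\<^bsub>|y| \<le> r\<^esub> |g'| \<le> A r\<^bsup>1 - 1/p\<^esup>\<close>, which follows from a bound of \<open>\<integral> |Y''|\<close> by \<open>\<integral> |\<phi>'''|\<close>.
\<close>

text \<open>The scarce resource is smoothness. Each \<open>T\<close> costs two derivatives, while
  \<open>g\<close> has only as many as \<open>\<phi>''\<close> and \<open>\<psi>\<close> have
  together. A phase in \<open>C^4\<close> gives \<open>g\<close> in \<open>C^2\<close>: exactly one
  step, after which \<open>T g\<close> is continuous but possibly not differentiable at
  \<open>0\<close>. This dictates the form of the van der Corput estimate, which asks that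
  \<open>y w'(y)\<close> be bounded instead of \<open>w'\<close>. A phase in \<open>C^3\<close>
  gives \<open>g\<close> in \<open>C^1\<close>, where \<open>T g\<close> does not exist, so the
  \<open>L^p\<close> estimate works on \<open>g - g 0\<close> itself. No convergence theory for
  improper integrals is developed. Compact support of \<open>g\<close> makes its symmetric integrals
  eventually constant, and every step transfers the existence of the limit from \<open>g\<close> to
  \<open>T g\<close>. In the \<open>L^p\<close> estimate the constant must depend on
  \<open>p\<close> alone, so all numbers are explicit there, coarse consequences of
  \<open>1/10 \<le> \<phi>'' \<le> 10\<close>. In the other two estimates constants are only shown
  to exist, by uniform boundedness over a family. As \<open>C\<close> may depend on \<open>K\<close>
  in the last one, \<open>|a\<^sub>k| \<le> C^k\<close> concerns finitely many \<open>k\<close> and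
  needs no growth control.\<close>

section \<open>Uniformly smooth families\<close>

text \<open>
  \<open>ucd S Z I m f\<close>: the family \<open>f i\<close>, \<open>i \<in> I\<close>, is \<open>C\<^sup>m\<close> on \<open>S\<close>, with bounds on the derivatives of order
  at most \<open>m\<close> that do not depend on \<open>i\<close>, and these derivatives all vanish on \<open>Z\<close>. The constants of
  the theorem are uniform because \<open>I\<close> will consist of all admissible pairs of phase and amplitude.
\<close>
primrec ucd :: "real set \<Rightarrow> real set \<Rightarrow> 'i set \<Rightarrow> nat \<Rightarrow> ('i \<Rightarrow> real \<Rightarrow> 'a::real_normed_vector) \<Rightarrow> bool"
  where
    "ucd S Z I 0 f \<longleftrightarrow> (\<forall>i\<in>I. continuous_on S (f i)) \<and> (\<forall>i\<in>I. \<forall>x\<in>Z. f i x = 0) \<and>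
       (\<exists>M. \<forall>i\<in>I. \<forall>x\<in>S. norm (f i x) \<le> M)"
  | "ucd S Z I (Suc m) f \<longleftrightarrow> (\<forall>i\<in>I. \<forall>x\<in>Z. f i x = 0) \<and>
       (\<exists>M. \<forall>i\<in>I. \<forall>x\<in>S. norm (f i x) \<le> M) \<and>
       (\<exists>f'. (\<forall>i\<in>I. \<forall>x\<in>S. (f i has_vector_derivative f' i x) (at x within S)) \<and> ucd S Z I m f')"

lemma ucd_bound:
  assumes "ucd S Z I m f"
  obtains M where "M \<ge> 0" "\<forall>i\<in>I. \<forall>x\<in>S. norm (f i x) \<le> M"
proof -
  obtain M where "\<forall>i\<in>I. \<forall>x\<in>S. norm (f i x) \<le> M"
    using assms by (cases m) auto
  then have "\<forall>i\<in>I. \<forall>x\<in>S. norm (f i x) \<le> max 0 M" by fastforce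
  then show ?thesis using that[of "max 0 M"] by simp
qed

lemma ucd_zero: "ucd S Z I m f \<Longrightarrow> i \<in> I \<Longrightarrow> x \<in> Z \<Longrightarrow> f i x = 0"
  by (cases m) auto

lemma ucd_continuous:
  assumes "ucd S Z I m f" "i \<in> I"
  shows "continuous_on S (f i)"
proof (cases m)
  case 0
  then show ?thesis using assms by simp
next
  case (Suc k)
  then obtain f' where "\<forall>x\<in>S. (f i has_vector_derivative f' i x) (at x within S)"
    using assms by auto
  then show ?thesis
    by (auto intro!: continuous_on_vector_derivative)
qed

lemma ucd_Suc_imp: "ucd S Z I (Suc m) f \<Longrightarrow> ucd S Z I m f"
proof (induction m arbitrary: f)
  case 0
  have "continuous_on S (f i)" if "i \<in> I" for i
    using ucd_continuous[OF 0 that] by blast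
  with 0 show ?case by auto
next
  case (Suc m)
  then obtain f' where "\<forall>i\<in>I. \<forall>x\<in>S. (f i has_vector_derivative f' i x) (at x within S)"
    "ucd S Z I (Suc m) f'" by auto
  moreover from this(2) have "ucd S Z I m f'" by (rule Suc.IH)
  ultimately show ?case using Suc.prems by auto
qed

lemma ucd_SucI:
  assumes "\<And>i x. i \<in> I \<Longrightarrow> x \<in> Z \<Longrightarrow> f i x = 0"
    and "\<And>i x. i \<in> I \<Longrightarrow> x \<in> S \<Longrightarrow> norm (f i x) \<le> M"
    and "\<And>i x. i \<in> I \<Longrightarrow> x \<in> S \<Longrightarrow> (f i has_vector_derivative f' i x) (at x within S)"
    and "ucd S Z I m f'"
  shows "ucd S Z I (Suc m) f"
  unfolding ucd.simps using assms by blast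

lemma ucd_cong:
  assumes "ucd S Z I m f" "\<And>i x. i \<in> I \<Longrightarrow> x \<in> S \<Longrightarrow> f i x = g i x" "Z \<subseteq> S"
  shows "ucd S Z I m g"
proof (cases m)
  case 0
  have "continuous_on S (g i)" if "i \<in> I" for i
    using ucd_continuous[OF assms(1) that] assms(2)[OF that]
    by (simp cong: continuous_on_cong)
  moreover have "\<forall>i\<in>I. \<forall>x\<in>Z. g i x = 0"
    using ucd_zero[OF assms(1)] assms(2,3) by fastforce
  moreover obtain M where "M \<ge> 0" "\<forall>i\<in>I. \<forall>x\<in>S. norm (f i x) \<le> M"
      by (rule ucd_bound[OF assms(1)])
  then have "\<forall>i\<in>I. \<forall>x\<in>S. norm (g i x) \<le> M"
    using assms(2) by auto
  ultimately show ?thesis using 0 by auto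
next
  case (Suc k)
  then obtain f' where f': "\<forall>i\<in>I. \<forall>x\<in>S. (f i has_vector_derivative f' i x) (at x within S)"
    "ucd S Z I k f'" using assms by auto
  have "(g i has_vector_derivative f' i x) (at x within S)" if "i \<in> I" "x \<in> S" for i x
    by (rule has_vector_derivative_transform[OF that(2) _ f'(1)[rule_format, OF that]])
      (simp add: assms(2) that)
  moreover obtain M where "M \<ge> 0" "\<forall>i\<in>I. \<forall>x\<in>S. norm (f i x) \<le> M"
      by (rule ucd_bound[OF assms(1)])
  then have "\<forall>i\<in>I. \<forall>x\<in>S. norm (g i x) \<le> M"
    using assms(2) by auto
  moreover have "\<forall>i\<in>I. \<forall>x\<in>Z. g i x = 0"
    using ucd_zero[OF assms(1)] assms(2,3) by fastforce
  ultimately show ?thesis using f' Suc by auto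
qed

lemma ucd_const:
  fixes c :: "'i \<Rightarrow> 'a::real_normed_vector"
  shows "(\<And>i. i \<in> I \<Longrightarrow> norm (c i) \<le> M) \<Longrightarrow> ucd S {} I m (\<lambda>i x. c i)"
proof (induction m arbitrary: c M)
  case (Suc m)
  have "ucd S {} I m (\<lambda>i x. 0 :: 'a)" by (rule Suc.IH[of _ 0]) auto
  with Suc.prems show ?case
    by (auto intro!: exI[of _ "\<lambda>i x. 0"])
qed auto

lemma ucd_add:
  assumes "ucd S Z I m f" "ucd S Z I m g"
  shows "ucd S Z I m (\<lambda>i x. f i x + g i x)"
  using assms
proof (induction m arbitrary: f g)
  case 0
  obtain M where "M \<ge> 0" "\<forall>i\<in>I. \<forall>x\<in>S. norm (f i x) \<le> M"
      by (rule ucd_bound[OF 0(1)])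
  moreover obtain N where "N \<ge> 0" "\<forall>i\<in>I. \<forall>x\<in>S. norm (g i x) \<le> N"
      by (rule ucd_bound[OF 0(2)])
  ultimately have "\<forall>i\<in>I. \<forall>x\<in>S. norm (f i x + g i x) \<le> M + N" by (auto intro!: norm_triangle_mono)
  then show ?case using 0 by (auto intro: continuous_intros)
next
  case (Suc m)
  obtain M where "M \<ge> 0" "\<forall>i\<in>I. \<forall>x\<in>S. norm (f i x) \<le> M"
      by (rule ucd_bound[OF Suc(2)])
  moreover obtain N where "N \<ge> 0" "\<forall>i\<in>I. \<forall>x\<in>S. norm (g i x) \<le> N"
      by (rule ucd_bound[OF Suc(3)])
  ultimately have MN: "\<forall>i\<in>I. \<forall>x\<in>S. norm (f i x + g i x) \<le> M + N" by (auto intro!: norm_triangle_mono)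
  obtain f' g' where
    "\<forall>i\<in>I. \<forall>x\<in>S. (f i has_vector_derivative f' i x) (at x within S)" "ucd S Z I m f'"
    "\<forall>i\<in>I. \<forall>x\<in>S. (g i has_vector_derivative g' i x) (at x within S)" "ucd S Z I m g'"
    using Suc.prems by auto
  then show ?case using MN Suc
    by (auto intro!: exI[of _ "\<lambda>i x. f' i x + g' i x"] has_vector_derivative_add)
qed

text \<open>By the Leibniz rule every derivative is a sum of products with one derivative of each
  factor, so it vanishes wherever either family is flat. In this way the flatness of the amplitude
  at the end points survives multiplication by factors that do not vanish there.\<close>

lemma ucd_bilinear:
  assumes B: "bounded_bilinear B" and "ucd S Z I m f" "ucd S Z' I m g"
  shows "ucd S (Z \<union> Z') I m (\<lambda>i x. B (f i x) (g i x))"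
  using assms(2,3)
proof (induction m arbitrary: f g)
  case 0
  then show ?case
  proof -
    obtain K where K: "K > 0" "\<And>a b. norm (B a b) \<le> norm a * norm b * K"
      using bounded_bilinear.pos_bounded[OF B] by blast
    obtain M where M: "M \<ge> 0" "\<forall>i\<in>I. \<forall>x\<in>S. norm (f i x) \<le> M"
      by (rule ucd_bound[OF 0(1)])
    obtain N where N: "N \<ge> 0" "\<forall>i\<in>I. \<forall>x\<in>S. norm (g i x) \<le> N"
      by (rule ucd_bound[OF 0(2)])
    have "norm (B (f i x) (g i x)) \<le> M * N * K" if "i \<in> I" "x \<in> S" for i x
      by (rule order_trans[OF K(2)]) (use K M N that in \<open>auto intro!: mult_mono\<close>)
    then show ?thesis using 0
      by (auto intro!: bounded_bilinear.continuous_on[OF B] simp: bounded_bilinear.zero_left[OF B] bounded_bilinear.zero_right[OF B])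
  qed
next
  case (Suc m)
  obtain K where K: "K > 0" "\<And>a b. norm (B a b) \<le> norm a * norm b * K"
    using bounded_bilinear.pos_bounded[OF B] by blast
  obtain M where M: "M \<ge> 0" "\<forall>i\<in>I. \<forall>x\<in>S. norm (f i x) \<le> M"
      by (rule ucd_bound[OF Suc(2)])
  obtain N where N: "N \<ge> 0" "\<forall>i\<in>I. \<forall>x\<in>S. norm (g i x) \<le> N"
      by (rule ucd_bound[OF Suc(3)])
  have MN: "norm (B (f i x) (g i x)) \<le> M * N * K" if "i \<in> I" "x \<in> S" for i x
    by (rule order_trans[OF K(2)]) (use K M N that in \<open>auto intro!: mult_mono\<close>)
  obtain f' g' where D:
    "\<forall>i\<in>I. \<forall>x\<in>S. (f i has_vector_derivative f' i x) (at x within S)" "ucd S Z I m f'"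
    "\<forall>i\<in>I. \<forall>x\<in>S. (g i has_vector_derivative g' i x) (at x within S)" "ucd S Z' I m g'"
    using Suc.prems by auto
  have "ucd S (Z \<union> Z') I m (\<lambda>i x. B (f i x) (g' i x) + B (f' i x) (g i x))"
    by (rule ucd_add[OF Suc.IH[OF ucd_Suc_imp[OF Suc.prems(1)] D(4)] Suc.IH[OF D(2) ucd_Suc_imp[OF Suc.prems(2)]]])
  moreover have "\<forall>i\<in>I. \<forall>x\<in>S. ((\<lambda>x. B (f i x) (g i x)) has_vector_derivative
      B (f i x) (g' i x) + B (f' i x) (g i x)) (at x within S)"
    using D bounded_bilinear.has_vector_derivative[OF B] by blast
  moreover have "\<forall>i\<in>I. \<forall>x\<in>Z \<union> Z'. B (f i x) (g i x) = 0"
    using ucd_zero[OF Suc(2)] ucd_zero[OF Suc(3)]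
    by (auto simp: bounded_bilinear.zero_left[OF B] bounded_bilinear.zero_right[OF B])
  ultimately show ?case by (intro ucd_SucI[OF _ MN]) auto
qed

lemmas ucd_scaleR = ucd_bilinear[OF bounded_bilinear_scaleR]
lemmas ucd_mult = ucd_bilinear[OF bounded_bilinear_mult]

text \<open>The derivative \<open>- f' / f^2\<close> contains \<open>inverse f\<close> only
  undifferentiated, so the induction hypothesis one order lower suffices. A lower bound
  \<open>c\<close> common to all indices keeps the bounds uniform.\<close>

lemma ucd_inverse:
  fixes f :: "'i \<Rightarrow> real \<Rightarrow> real"
  assumes "c > 0" "\<And>i x. i \<in> I \<Longrightarrow> x \<in> S \<Longrightarrow> c \<le> f i x" "ucd S {} I m f"
  shows "ucd S {} I m (\<lambda>i x. inverse (f i x))"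
  using assms(3)
proof (induction m)
  case 0
  have b: "norm (inverse (f i x)) \<le> inverse c" if "i \<in> I" "x \<in> S" for i x
    using assms(1) assms(2)[OF that] by (auto simp: field_simps)
  have "continuous_on S (\<lambda>x. inverse (f i x))" if "i \<in> I" for i
    using ucd_continuous[OF 0 that] assms(1,2) that
    by (intro continuous_intros) (auto, force)
  with b show ?case by auto
next
  case (Suc m)
  have b: "norm (inverse (f i x)) \<le> inverse c" if "i \<in> I" "x \<in> S" for i x
    using assms(1) assms(2)[OF that] by (auto simp: field_simps)
  obtain f' where D:
    "\<forall>i\<in>I. \<forall>x\<in>S. (f i has_vector_derivative f' i x) (at x within S)" "ucd S {} I m f'"
    using Suc.prems by auto
  have IH: "ucd S {} I m (\<lambda>i x. inverse (f i x))" by (rule Suc.IH[OF ucd_Suc_imp[OF Suc.prems]])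
  have u: "ucd S {} I m (\<lambda>i x. (- 1) * (f' i x * (inverse (f i x) * inverse (f i x))))"
    using ucd_mult[OF ucd_const[of I "\<lambda>_. -1" 1] ucd_mult[OF D(2) ucd_mult[OF IH IH]]] by simp
  have "((\<lambda>x. inverse (f i x)) has_vector_derivative
      (- 1) * (f' i x * (inverse (f i x) * inverse (f i x)))) (at x within S)" if "i \<in> I" "x \<in> S" for i x
  proof -
    have "f i x \<noteq> 0" using assms(1,2) that by fastforce
    then show ?thesis using D(1) that
      unfolding has_real_derivative_iff_has_vector_derivative[symmetric]
      by (auto intro!: derivative_eq_intros)
  qed
  then show ?case by (intro ucd_SucI[OF _ b _ u]) auto
qed

text \<open>The same bootstrapping with \<open>f' / (2 * sqrt f)\<close>: the induction hypothesis
  for \<open>sqrt f\<close>, which is at least \<open>sqrt c\<close>, is fed into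
  \<open>ucd_inverse\<close>.\<close>

lemma ucd_sqrt:
  fixes f :: "'i \<Rightarrow> real \<Rightarrow> real"
  assumes "c > 0" "\<And>i x. i \<in> I \<Longrightarrow> x \<in> S \<Longrightarrow> c \<le> f i x" "ucd S {} I m f"
  shows "ucd S {} I m (\<lambda>i x. sqrt (f i x))"
  using assms(3)
proof (induction m)
  case 0
  obtain M where M: "M \<ge> 0" "\<forall>i\<in>I. \<forall>x\<in>S. norm (f i x) \<le> M"
      by (rule ucd_bound[OF 0])
  have "norm (sqrt (f i x)) \<le> sqrt M" if "i \<in> I" "x \<in> S" for i x
    using M(2)[rule_format, OF that] assms(1) assms(2)[OF that] by (simp add: order_trans)
  with 0 show ?case by (auto intro!: continuous_intros)
next
  case (Suc m)
  obtain M where M: "M \<ge> 0" "\<forall>i\<in>I. \<forall>x\<in>S. norm (f i x) \<le> M"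
      by (rule ucd_bound[OF Suc.prems])
  have b: "norm (sqrt (f i x)) \<le> sqrt M" if "i \<in> I" "x \<in> S" for i x
    using M(2)[rule_format, OF that] assms(1) assms(2)[OF that] by (simp add: order_trans)
  obtain f' where D:
    "\<forall>i\<in>I. \<forall>x\<in>S. (f i has_vector_derivative f' i x) (at x within S)" "ucd S {} I m f'"
    using Suc.prems by auto
  have IH: "ucd S {} I m (\<lambda>i x. sqrt (f i x))" by (rule Suc.IH[OF ucd_Suc_imp[OF Suc.prems]])
  have "ucd S {} I m (\<lambda>i x. inverse (sqrt (f i x)))"
    by (rule ucd_inverse[of "sqrt c"]) (use assms IH in auto)
  then have u: "ucd S {} I m (\<lambda>i x. (1/2) * (f' i x * inverse (sqrt (f i x))))"
    using ucd_mult[OF ucd_const[of I "\<lambda>_. 1/2" 1] ucd_mult[OF D(2)]] by fastforce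
  have "((\<lambda>x. sqrt (f i x)) has_vector_derivative
      (1/2) * (f' i x * inverse (sqrt (f i x)))) (at x within S)" if "i \<in> I" "x \<in> S" for i x
  proof -
    have "f i x > 0" using assms(1) assms(2)[OF that] by linarith
    then show ?thesis using D(1) that
      unfolding has_real_derivative_iff_has_vector_derivative[symmetric]
      by (auto intro!: derivative_eq_intros simp: field_simps)
  qed
  then show ?case by (intro ucd_SucI[OF _ b _ u]) auto
qed

text \<open>The weight \<open>s ^ j\<close> makes these averages closed under differentiation: the
  derivative of the \<open>j\<close>-average of \<open>f\<close> is the
  \<open>(j + 1)\<close>-average of \<open>f'\<close>. For \<open>j = 0\<close> and a derivative
  \<open>f'\<close> the average is the difference quotient \<open>(f x - f 0) / x\<close>, continued
  smoothly through \<open>0\<close>.\<close>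

definition ray_average :: "nat \<Rightarrow> (real \<Rightarrow> 'a::euclidean_space) \<Rightarrow> real \<Rightarrow> 'a"
  where "ray_average j f x = integral {0..1} (\<lambda>s. s ^ j *\<^sub>R f (s * x))"

text \<open>Convexity keeps \<open>s * x\<close> in \<open>S\<close>, and
  \<open>s ^ j \<le> 1\<close> lets every bound on \<open>f\<close> pass to the average.
  Differentiation under the integral raises the weight, so the induction runs over all
  \<open>j\<close> at once.\<close>

lemma ucd_ray_average:
  fixes f :: "'i \<Rightarrow> real \<Rightarrow> 'a::euclidean_space"
  assumes S: "convex S" "0 \<in> S" and "ucd S {} I m f"
  shows "ucd S {} I m (\<lambda>i. ray_average j (f i))"
  using assms(3)
proof (induction m arbitrary: f j)
  have scale: "s * x \<in> S" if "x \<in> S" "0 \<le> s" "s \<le> 1" for s x :: real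
    using convexD[OF S(1) that(1) S(2), of s "1 - s"] that by simp
  have int: "(\<lambda>s. s ^ j *\<^sub>R g (s * x)) integrable_on {0..1}" if "continuous_on S g" "x \<in> S"
    for g :: "real \<Rightarrow> 'a" and x j
    by (intro integrable_continuous_real continuous_intros continuous_on_compose2[OF that(1)])
      (use scale that in auto)
  have cont: "continuous_on (S \<times> {0..1}) (\<lambda>(x, s). s ^ j *\<^sub>R g (s * x))" if "continuous_on S g"
    for g :: "real \<Rightarrow> 'a" and j
    unfolding split_beta
    by (intro continuous_intros continuous_on_compose2[OF that]) (use scale that in auto)
  have bd: "norm (ray_average j g x) \<le> M" if "continuous_on S g" "x \<in> S" "M \<ge> 0" "\<And>y. y \<in> S \<Longrightarrow> norm (g y) \<le> M"
    for g :: "real \<Rightarrow> 'a" and j M x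
  proof -
    have "norm (s ^ j *\<^sub>R g (s * x)) \<le> M" if s: "s \<in> {0..1}" for s
    proof -
      have "s ^ j * norm (g (s * x)) \<le> 1 * M"
        using s \<open>x \<in> S\<close> \<open>M \<ge> 0\<close> scale that(1) by (intro mult_mono) (auto intro!: power_le_one \<open>\<And>y. y \<in> S \<Longrightarrow> norm (g y) \<le> M\<close>)
      then show ?thesis using s by simp
    qed
    then have "norm (ray_average j g x) \<le> integral {0..1} (\<lambda>s::real. M)"
      unfolding ray_average_def by (intro integral_norm_bound_integral int that) auto
    then show ?thesis by simp
  qed
  have ubd: "\<exists>M. \<forall>i\<in>I. \<forall>x\<in>S. norm (ray_average j (f i) x) \<le> M" if u: "ucd S {} I m f" for f :: "'i \<Rightarrow> real \<Rightarrow> 'a" and m j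
  proof -
    obtain M where "M \<ge> 0" "\<forall>i\<in>I. \<forall>x\<in>S. norm (f i x) \<le> M"
      by (rule ucd_bound[OF u])
    then have "\<forall>i\<in>I. \<forall>x\<in>S. norm (ray_average j (f i) x) \<le> M"
      using bd ucd_continuous[OF u] by blast
    then show ?thesis ..
  qed
  {
    case 0
    have "continuous_on S (ray_average j (f i))" if "i \<in> I" for i
      unfolding ray_average_def
      using integral_continuous_on_param[of S 0 1 "\<lambda>x s. s ^ j *\<^sub>R f i (s * x)"]
        cont[OF ucd_continuous[OF 0 that]] by simp
    with ubd[OF 0] show ?case by simp
  next
    case (Suc m)
    obtain f' where D:
      "\<forall>i\<in>I. \<forall>x\<in>S. (f i has_vector_derivative f' i x) (at x within S)" "ucd S {} I m f'"
      using Suc.prems by auto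
    have "(ray_average j (f i) has_vector_derivative ray_average (Suc j) (f' i) x) (at x within S)"
      if i: "i \<in> I" and x: "x \<in> S" for i x
    proof -
      have d: "((\<lambda>x. s ^ j *\<^sub>R f i (s * x)) has_vector_derivative s ^ Suc j *\<^sub>R f' i (s * x)) (at x within S)"
        if x: "x \<in> S" and s: "s \<in> {0..1}" for x s
      proof -
        have "((\<lambda>x. s * x) has_vector_derivative s) (at x within S)"
          by (auto intro!: derivative_eq_intros)
        moreover have "(f i has_vector_derivative f' i (s * x)) (at (s * x) within (\<lambda>x. s * x) ` S)"
          by (rule has_vector_derivative_within_subset[of _ _ _ S]) (use D i x s scale in auto)
        ultimately have "((f i \<circ> (\<lambda>x. s * x)) has_vector_derivative s *\<^sub>R f' i (s * x)) (at x within S)"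
          by (rule vector_diff_chain_within)
        then have "((\<lambda>x. s ^ j *\<^sub>R (f i \<circ> (\<lambda>x. s * x)) x) has_vector_derivative s ^ j *\<^sub>R (s *\<^sub>R f' i (s * x))) (at x within S)"
          by (rule bounded_linear.has_vector_derivative[OF bounded_linear_scaleR_right])
        then show ?thesis by (simp add: o_def mult.commute)
      qed
      have "((\<lambda>x. integral (cbox 0 1) (\<lambda>s. s ^ j *\<^sub>R f i (s * x))) has_vector_derivative
          integral (cbox 0 1) (\<lambda>s. s ^ Suc j *\<^sub>R f' i (s * x))) (at x within S)"
        by (rule leibniz_rule_vector_derivative)
          (use d int cont[OF ucd_continuous[OF D(2) i], of "Suc j"] ucd_continuous[OF Suc.prems i] x S in auto)
      then show ?thesis by (simp add: ray_average_def[abs_def])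
    qed
    moreover have "ucd S {} I m (\<lambda>i. ray_average (Suc j) (f' i))" by (rule Suc.IH[OF D(2)])
    moreover obtain M where "\<forall>i\<in>I. \<forall>x\<in>S. norm (ray_average j (f i) x) \<le> M"
      using ubd[OF Suc.prems] by blast
    ultimately show ?case
      by (intro ucd_SucI[where M = M and f' = "\<lambda>i. ray_average (Suc j) (f' i)"]) auto
  }
qed

text \<open>Hadamard's lemma: the fundamental theorem of calculus for \<open>f (s * x)\<close> as a
  function of \<open>s\<close> in the unit interval.\<close>

lemma ray_average_0_deriv:
  fixes f :: "real \<Rightarrow> 'a::euclidean_space"
  assumes S: "convex S" "0 \<in> S" and x: "x \<in> S"
    and D: "\<And>x. x \<in> S \<Longrightarrow> (f has_vector_derivative f' x) (at x within S)"
  shows "x *\<^sub>R ray_average 0 f' x = f x - f 0"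
proof -
  have scale: "s * x \<in> S" if "0 \<le> s" "s \<le> 1" for s :: real
    using convexD[OF S(1) x S(2), of s "1 - s"] that by simp
  have "((f \<circ> (\<lambda>s. s * x)) has_vector_derivative x *\<^sub>R f' (s * x)) (at s within {0..1})" if "s \<in> {0..1}" for s
  proof (rule vector_diff_chain_within)
    show "((\<lambda>s. s * x) has_vector_derivative x) (at s within {0..1})"
      by (auto intro!: derivative_eq_intros)
    show "(f has_vector_derivative f' (s * x)) (at (s * x) within (\<lambda>s. s * x) ` {0..1})"
      by (rule has_vector_derivative_within_subset[of _ _ _ S]) (use D scale that in auto)
  qed
  then have "((\<lambda>s. x *\<^sub>R f' (s * x)) has_integral ((f \<circ> (\<lambda>s. s * x)) 1 - (f \<circ> (\<lambda>s. s * x)) 0)) {0..1}"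
    by (rule fundamental_theorem_of_calculus[OF zero_le_one])
  then have "integral {0..1} (\<lambda>s. x *\<^sub>R f' (s * x)) = f x - f 0"
    by (drule_tac integral_unique) (simp only: o_def mult_1_left mult_zero_left)
  then show ?thesis by (simp add: ray_average_def)
qed

declare ucd.simps(2) [simp del]

section \<open>Oscillatory integrals with quadratic phase\<close>

definition osc :: "real \<Rightarrow> real \<Rightarrow> complex"
  where "osc lam y = cis (lam * y\<^sup>2 / 2)"

lemma norm_osc [simp]: "norm (osc lam y) = 1"
  by (simp add: osc_def)

lemma osc_minus [simp]: "osc lam (- y) = osc lam y"
  by (simp add: osc_def)

lemma continuous_on_osc [continuous_intros]: "continuous_on S (osc lam)"
  unfolding osc_def by (intro continuous_intros) auto

lemma has_vector_derivative_cis: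
  assumes "(f has_real_derivative f') (at x within S)"
  shows "((\<lambda>x. cis (f x)) has_vector_derivative (\<i> * of_real f') * cis (f x)) (at x within S)"
proof -
  have "((\<lambda>x. of_real (cos (f x)) + \<i> * of_real (sin (f x))) has_vector_derivative
      of_real (- (f' * sin (f x))) + \<i> * of_real (f' * cos (f x))) (at x within S)"
    by (intro has_vector_derivative_add has_vector_derivative_mult_right has_vector_derivative_of_real)
      (auto intro!: derivative_eq_intros assms)
  moreover have "cis t = of_real (cos t) + \<i> * of_real (sin t)" for t
    by (simp add: cis.ctr complex_eq_iff)
  moreover have "of_real (- (f' * sin (f x))) + \<i> * of_real (f' * cos (f x)) = (\<i> * of_real f') * cis (f x)"
    by (simp add: complex_eq_iff)
  ultimately show ?thesis by simp
qed

lemma osc_derivative: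
  "(osc lam has_vector_derivative (\<i> * of_real (lam * y)) * osc lam y) (at y within S)"
  unfolding osc_def
  by (rule has_vector_derivative_cis) (auto intro!: derivative_eq_intros)

lemma integral_even_odd:
  fixes f :: "real \<Rightarrow> 'a::euclidean_space"
  assumes "continuous_on {-L..L} f" "L \<ge> 0"
  shows "integral {-L..L} f = integral {0..L} f + integral {0..L} (\<lambda>y. f (- y))"
proof -
  have "integral {-L..0} f + integral {0..L} f = integral {-L..L} f"
    by (rule Henstock_Kurzweil_Integration.integral_combine)
      (use assms in \<open>auto intro: integrable_continuous_real\<close>)
  moreover have "integral {0..L} (\<lambda>y. f (- y)) = integral {-L..0} f"
    using Henstock_Kurzweil_Integration.integral_reflect_real[of 0 "- L" f] by simp
  ultimately show ?thesis by (simp add: add.commute)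
qed

text \<open>Integration by parts without integrating \<open>w'\<close>: the primitive minus the
  boundary term has a derivative of norm at most \<open>Phi' / lam\<close>, so the mean value
  inequality bounds its increment by that of \<open>Phi\<close>. Thus \<open>w'\<close> need only
  exist on the open interval, and each application reduces to choosing a majorant
  \<open>Phi\<close>.\<close>

lemma osc_integration_by_parts_bound:
  assumes "0 < lam" "0 < d" "d < L" and w: "continuous_on {d..L} w" and Phi: "continuous_on {d..L} Phi"
    and w': "\<And>y. d < y \<Longrightarrow> y < L \<Longrightarrow> (w has_vector_derivative w' y) (at y)"
    and Phi': "\<And>y. d < y \<Longrightarrow> y < L \<Longrightarrow> (Phi has_real_derivative Phi' y) (at y)"
    and le: "\<And>y. d < y \<Longrightarrow> y < L \<Longrightarrow> norm (w' y) / y + norm (w y) / y\<^sup>2 \<le> Phi' y"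
  shows "norm (integral {d..L} (\<lambda>y. osc lam y * w y)) \<le>
    (norm (w L) / L + norm (w d) / d + Phi L - Phi d) / lam"
proof -
  \<comment> \<open>Since \<open>osc\<close> has derivative \<open>i * lam * y * osc\<close>, this
    is the boundary term \<open>osc * w / (i * lam * y)\<close>.\<close>
  define u where "u y = (1 / (lam * y)) *\<^sub>R (- \<i> * (osc lam y * w y))" for y
  define D where "D y = integral {d..y} (\<lambda>y. osc lam y * w y) - u y" for y
  have contw: "continuous_on {d..L} (\<lambda>y. osc lam y * w y)"
    by (intro continuous_intros w)
  have contD: "continuous_on {d..L} D"
    unfolding D_def u_def using assms
    by (intro continuous_intros indefinite_integral_continuous_1 integrable_continuous_real w) auto
  have D': "(D has_vector_derivative
      - ((1 / (lam * y)) *\<^sub>R (- \<i> * (osc lam y * w' y)) + (- 1 / (lam * y\<^sup>2)) *\<^sub>R (- \<i> * (osc lam y * w y)))) (at y)"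
    if y: "d < y" "y < L" for y
  proof -
    have "((\<lambda>u. integral {d..u} (\<lambda>y. osc lam y * w y)) has_vector_derivative osc lam y * w y) (at y within {d..L})"
      by (rule integral_has_vector_derivative[OF contw]) (use y in auto)
    then have 1: "((\<lambda>u. integral {d..u} (\<lambda>y. osc lam y * w y)) has_vector_derivative osc lam y * w y) (at y)"
      using y by (simp add: at_within_Icc_at)
    have 2: "(u has_vector_derivative
        (1 / (lam * y)) *\<^sub>R (- \<i> * (osc lam y * w' y + (\<i> * of_real (lam * y)) * osc lam y * w y))
        + (- 1 / (lam * y\<^sup>2)) *\<^sub>R (- \<i> * (osc lam y * w y))) (at y)"
      unfolding u_def
      by (intro has_vector_derivative_scaleR has_vector_derivative_mult_right
          has_vector_derivative_mult osc_derivative w' y)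
        (use y assms in \<open>auto intro!: derivative_eq_intros simp: field_simps power2_eq_square\<close>)
    have "(1 / (lam * y)) *\<^sub>R (- \<i> * (osc lam y * w' y + (\<i> * of_real (lam * y)) * osc lam y * w y))
      = (1 / (lam * y)) *\<^sub>R (- \<i> * (osc lam y * w' y)) + osc lam y * w y"
      using y assms by (simp add: scaleR_conv_of_real field_simps)
    with has_vector_derivative_diff[OF 1 2] show ?thesis
      unfolding D_def by (simp add: algebra_simps)
  qed
  have bd: "norm (- ((1 / (lam * y)) *\<^sub>R (- \<i> * (osc lam y * w' y)) + (- 1 / (lam * y\<^sup>2)) *\<^sub>R (- \<i> * (osc lam y * w y))))
      \<le> Phi' y / lam" if y: "d < y" "y < L" for y
  proof -
    have "norm (- ((1 / (lam * y)) *\<^sub>R (- \<i> * (osc lam y * w' y)) + (- 1 / (lam * y\<^sup>2)) *\<^sub>R (- \<i> * (osc lam y * w y))))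
      \<le> norm ((1 / (lam * y)) *\<^sub>R (- \<i> * (osc lam y * w' y))) + norm ((- 1 / (lam * y\<^sup>2)) *\<^sub>R (- \<i> * (osc lam y * w y)))"
      unfolding norm_minus_cancel by (rule norm_triangle_ineq)
    also have "\<dots> = (norm (w' y) / y + norm (w y) / y\<^sup>2) / lam"
      using y assms by (simp add: norm_mult field_simps)
    also have "\<dots> \<le> Phi' y / lam"
      using le[OF y] assms by (intro divide_right_mono) auto
    finally show ?thesis .
  qed
  have "norm (D L - D d) \<le> Phi L / lam - Phi d / lam"
    by (rule differentiable_bound_general[OF \<open>d < L\<close> contD _ D' _ bd])
      (use assms in \<open>auto intro!: continuous_intros derivative_eq_intros simp: has_real_derivative_iff_has_vector_derivative[symmetric]\<close>)
  moreover have "integral {d..L} (\<lambda>y. osc lam y * w y) = (D L - D d) + (u L - u d)"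
    by (simp add: D_def)
  moreover have "norm (u L) = norm (w L) / L / lam" "norm (u d) = norm (w d) / d / lam"
    using assms by (auto simp: u_def norm_mult)
  moreover have "norm ((D L - D d) + (u L - u d)) \<le> norm (D L - D d) + (norm (u L) + norm (u d))"
    by (meson add_left_mono norm_triangle_ineq norm_triangle_ineq4 order_trans)
  ultimately show ?thesis
    by (simp add: add_divide_distrib diff_divide_distrib)
qed

section \<open>Van der Corput estimates on a half-line\<close>

lemma norm_integral_osc_le:
  assumes "continuous_on {a..b} w" "a \<le> b" "\<And>y. y \<in> {a..b} \<Longrightarrow> norm (w y) \<le> A"
  shows "norm (integral {a..b} (\<lambda>y. osc lam y * w y)) \<le> A * (b - a)"
proof -
  have "norm (integral {a..b} (\<lambda>y. osc lam y * w y)) \<le> integral {a..b} (\<lambda>y. A)"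
    by (intro integral_norm_bound_integral integrable_continuous_real continuous_intros assms)
      (use assms in \<open>auto simp: norm_mult\<close>)
  then show ?thesis using assms by (simp add: mult.commute)
qed

lemma osc_integral_half_split:
  assumes "continuous_on {0..L} w" "0 < d" "d < L"
  shows "integral {0..L} (\<lambda>y. osc lam y * w y) =
    integral {0..d} (\<lambda>y. osc lam y * w y) + integral {d..L} (\<lambda>y. osc lam y * w y)"
  by (rule Henstock_Kurzweil_Integration.integral_combine[symmetric])
    (use assms in \<open>auto intro!: integrable_continuous_real continuous_intros\<close>)

text \<open>Below the scale \<open>d = lam powr (-1/2)\<close> there is no useful oscillation and
  the trivial bound \<open>A * d\<close> is taken; above it one integration by parts wins. As only
  \<open>y * w'\<close> is bounded, \<open>w'\<close> may blow up like \<open>1 / y\<close> at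
  \<open>0\<close>.\<close>

lemma van_der_Corput_half:
  assumes lam: "0 < lam" and L: "0 \<le> L" and w: "continuous_on {0..L} w"
    and w': "\<And>y. 0 < y \<Longrightarrow> y < L \<Longrightarrow> (w has_vector_derivative w' y) (at y)"
    and A: "\<And>y. y \<in> {0..L} \<Longrightarrow> norm (w y) \<le> A"
    and B: "\<And>y. 0 < y \<Longrightarrow> y < L \<Longrightarrow> y * norm (w' y) \<le> B" and B0: "0 \<le> B"
  shows "norm (integral {0..L} (\<lambda>y. osc lam y * w y)) \<le> (4 * A + B) * lam powr (-1/2)"
proof -
  define d where "d = lam powr (-1/2)"
  have d: "d > 0" "d * d = 1 / lam"
    using lam by (auto simp: d_def powr_add[symmetric] powr_minus field_simps)
  have A0: "A \<ge> 0" using A[of 0] L norm_ge_zero[of "w 0"] by (auto simp del: norm_ge_zero)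
  show ?thesis
  proof (cases "L \<le> d")
    case True
    have "norm (integral {0..L} (\<lambda>y. osc lam y * w y)) \<le> A * (L - 0)"
      by (rule norm_integral_osc_le) (use w L A in auto)
    also have "\<dots> \<le> (4 * A + B) * d"
      using True A0 B0 L by (intro mult_mono) auto
    finally show ?thesis by (simp add: d_def)
  next
    case False
    then have dL: "d < L" by simp
    have 1: "norm (integral {0..d} (\<lambda>y. osc lam y * w y)) \<le> A * (d - 0)"
      by (rule norm_integral_osc_le) (use w d dL A in \<open>auto intro: continuous_on_subset\<close>)
    \<comment> \<open>The majorant \<open>- (A + B) / y\<close> costs at most
      \<open>(A + B) / d\<close>, the two boundary terms at most \<open>2 * A / d\<close>; division
      by \<open>lam\<close> turns \<open>1 / d\<close> into \<open>d\<close>.\<close>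
    have 2: "norm (integral {d..L} (\<lambda>y. osc lam y * w y)) \<le>
        (norm (w L) / L + norm (w d) / d + (- (A + B) / L) - (- (A + B) / d)) / lam"
    proof (rule osc_integration_by_parts_bound[OF lam d(1) dL, where Phi' = "\<lambda>y. (A + B) / y\<^sup>2"])
      show "continuous_on {d..L} w" using w d dL by (auto intro: continuous_on_subset)
      show "continuous_on {d..L} (\<lambda>y. - (A + B) / y)" using d by (intro continuous_intros) auto
      fix y assume y: "d < y" "y < L"
      show "(w has_vector_derivative w' y) (at y)" by (rule w') (use y d in auto)
      show "((\<lambda>y. - (A + B) / y) has_real_derivative (A + B) / y\<^sup>2) (at y)"
        using y d by (auto intro!: derivative_eq_intros simp: power2_eq_square)
      have "norm (w' y) / y \<le> B / y\<^sup>2"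
        using B[of y] y d by (simp add: field_simps power2_eq_square)
      moreover have "norm (w y) / y\<^sup>2 \<le> A / y\<^sup>2"
        using A[of y] y d by (intro divide_right_mono) auto
      ultimately show "norm (w' y) / y + norm (w y) / y\<^sup>2 \<le> (A + B) / y\<^sup>2"
        by (simp add: add_divide_distrib)
    qed
    have "norm (w L) / L \<le> A / d" using A[of L] A0 d dL by (intro frac_le) auto
    moreover have "norm (w d) / d \<le> A / d" using A[of d] d dL by (intro divide_right_mono) auto
    moreover have "0 \<le> (A + B) / L" using A0 B0 L by auto
    ultimately have "norm (w L) / L + norm (w d) / d + (- (A + B) / L) - (- (A + B) / d) \<le> (3 * A + B) / d"
      by (simp add: add_divide_distrib diff_divide_distrib)
    then have "(norm (w L) / L + norm (w d) / d + (- (A + B) / L) - (- (A + B) / d)) / lam \<le> (3 * A + B) / d / lam"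
      using lam by (intro divide_right_mono) auto
    also have "\<dots> = (3 * A + B) * d"
      using d lam by (simp add: field_simps)
    finally have "norm (integral {0..L} (\<lambda>y. osc lam y * w y)) \<le> A * d + (3 * A + B) * d"
      unfolding osc_integral_half_split[OF w d(1) dL]
      using 1 by (intro order_trans[OF norm_triangle_ineq] add_mono order_trans[OF 2]) auto
    then show ?thesis by (simp add: d_def algebra_simps)
  qed
qed

text \<open>The same splitting, with control of \<open>g'\<close> only in the mean. Everything is
  expressed through \<open>M r\<close>, the integral of \<open>norm g'\<close> up to
  \<open>r\<close>: it dominates \<open>g - g 0\<close> pointwise and grows at most like
  \<open>r powr (1 - 1/p)\<close>. Both pieces then have size \<open>d powr (2 - 1/p)\<close>, the
  claimed power of \<open>lam\<close>.\<close>

lemma van_der_Corput_half_Lp: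
  assumes lam: "0 < lam" and L: "0 \<le> L" and p: "1 \<le> p"
    and g: "\<And>y. y \<in> {0..L} \<Longrightarrow> (g has_vector_derivative g' y) (at y within {0..L})"
    and g': "continuous_on {0..L} g'" and A0: "0 \<le> A"
    and A: "\<And>r. 0 < r \<Longrightarrow> r \<le> L \<Longrightarrow> integral {0..r} (\<lambda>y. norm (g' y)) \<le> A * r powr (1 - 1/p)"
  shows "norm (integral {0..L} (\<lambda>y. osc lam y * (g y - g 0))) \<le> (4 + 2 * p) * A * lam powr (-1 + 1 / (2 * p))"
proof -
  define d where "d = lam powr (-1/2)"
  define w where "w y = g y - g 0" for y
  define M where "M r = integral {0..r} (\<lambda>y. norm (g' y))" for r
  have d0: "d > 0" using lam by (simp add: d_def)
  have e: "d powr (1 - 1/p) * d = lam powr (-1 + 1 / (2 * p))"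
  proof -
    have "d powr (1 - 1/p) * d = d powr (1 - 1/p) * d powr 1" using d0 by simp
    also have "\<dots> = d powr (2 - 1/p)" by (subst powr_add[symmetric]) simp
    also have "\<dots> = lam powr ((-1/2) * (2 - 1/p))" by (simp only: d_def powr_powr)
    also have "(-1/2) * (2 - 1/p) = -1 + 1 / (2 * p)" using p by (simp add: field_simps)
    finally show ?thesis .
  qed
  have e2: "d powr (- 1/p) / lam = d powr (1 - 1/p) * d"
  proof -
    have "d powr 2 = lam powr (-1)" unfolding d_def powr_powr by simp
    then have "1 / lam = d powr 2" using lam by (simp add: powr_minus_divide)
    then have "d powr (- 1/p) / lam = d powr (-1/p) * d powr 2" by (metis mult.commute mult_1 times_divide_eq_left)
    also have "\<dots> = d powr (1 - 1/p) * d powr 1" by (simp only: powr_add[symmetric]) simp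
    finally show ?thesis using d0 by simp
  qed
  have contg: "continuous_on {0..L} g"
    by (rule continuous_on_vector_derivative[OF g])
  then have contw: "continuous_on {0..L} w" unfolding w_def by (intro continuous_intros)
  have wM: "norm (w y) \<le> M y" if "y \<in> {0..L}" for y
  proof -
    have "(g' has_integral w y) {0..y}" unfolding w_def
      by (rule fundamental_theorem_of_calculus)
        (use that in \<open>auto intro!: has_vector_derivative_within_subset[OF g]\<close>)
    moreover have "norm (integral {0..y} g') \<le> M y" unfolding M_def
      by (rule integral_norm_bound_integral)
        (use that g' in \<open>auto intro!: integrable_continuous_real continuous_intros intro: continuous_on_subset\<close>)
    ultimately show ?thesis by (simp add: integral_unique)
  qed
  have MA: "M y \<le> A * y powr (1 - 1/p)" if "0 < y" "y \<le> L" for y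
    unfolding M_def by (rule A) (use that in auto)
  \<comment> \<open>No range condition on \<open>y\<close> is needed: the integral of a
    non-integrable function is \<open>0\<close> by convention.\<close>
  have M0: "M y \<ge> 0" for y unfolding M_def
    by (cases "(\<lambda>y. norm (g' y)) integrable_on {0..y}") (auto intro!: integral_nonneg simp: not_integrable_integral)
  have wA: "norm (w y) \<le> A * z powr (1 - 1/p)" if "y \<in> {0..L}" "y \<le> z" "0 < z" for y z
  proof (cases "y = 0")
    case True
    then show ?thesis using A0 by (simp add: w_def)
  next
    case False
    then have "0 < y" "y \<le> L" using that by auto
    then have "norm (w y) \<le> A * y powr (1 - 1/p)" by (rule order_trans[OF wM[OF that(1)] MA])
    also have "\<dots> \<le> A * z powr (1 - 1/p)"
      using that A0 p by (intro mult_left_mono powr_mono2) (auto simp: field_simps)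
    finally show ?thesis .
  qed
  have e3: "y powr (1 - 1/p) / y = y powr (- 1/p)" if "y > 0" for y
    using powr_diff[of y "1 - 1/p" 1] that by simp
  have e4: "y powr (1 - 1/p) / y\<^sup>2 = y powr (- 1/p - 1)" if "y > 0" for y
  proof -
    have "1 - 1/p - 2 = - 1/p - 1" by simp
    with powr_diff[of y "1 - 1/p" 2] have "y powr (- 1/p - 1) = y powr (1 - 1/p) / y powr 2" by metis
    then show ?thesis using that by simp
  qed
  have "norm (integral {0..L} (\<lambda>y. osc lam y * w y)) \<le> (4 + 2 * p) * (A * (d powr (1 - 1/p) * d))"
  proof (cases "L \<le> d")
    case True
    have "norm (integral {0..L} (\<lambda>y. osc lam y * w y)) \<le> (A * d powr (1 - 1/p)) * (L - 0)"
      by (rule norm_integral_osc_le) (use contw L wA True d0 in auto)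
    also have "\<dots> \<le> (A * d powr (1 - 1/p)) * d"
      using True A0 L by (intro mult_left_mono) auto
    also have "\<dots> \<le> (4 + 2 * p) * (A * (d powr (1 - 1/p) * d))"
      using A0 p d0 mult_right_mono[of 1 "4 + 2 * p" "A * (d powr (1 - 1/p) * d)"] by simp
    finally show ?thesis .
  next
    case False
    then have dL: "d < L" by simp
    \<comment> \<open>The derivative of \<open>M y / y\<close> supplies
      \<open>norm (g' y) / y\<close> but also the unwanted \<open>- M y / y^2\<close>. The second
      term has derivative \<open>2 * A * y powr (-1/p - 1)\<close>, at least
      \<open>2 * M y / y^2\<close>, which repairs this and leaves \<open>M y / y^2\<close> to
      dominate \<open>norm (w y) / y^2\<close>. Its primitive brings in the factor
      \<open>p\<close>.\<close>
    let ?Phi = "\<lambda>y. M y / y - 2 * A * p * y powr (-1/p)"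
    have 1: "norm (integral {0..d} (\<lambda>y. osc lam y * w y)) \<le> (A * d powr (1 - 1/p)) * (d - 0)"
      by (rule norm_integral_osc_le)
        (use contw dL wA d0 in \<open>auto intro: continuous_on_subset\<close>)
    have 2: "norm (integral {d..L} (\<lambda>y. osc lam y * w y)) \<le>
        (norm (w L) / L + norm (w d) / d + ?Phi L - ?Phi d) / lam"
    proof (rule osc_integration_by_parts_bound[OF lam d0 dL, where w' = g'
          and Phi' = "\<lambda>y. (norm (g' y) * y - M y) / y\<^sup>2 + 2 * A * y powr (-1/p - 1)"])
      show "continuous_on {d..L} w" using contw d0 dL by (auto intro: continuous_on_subset)
      have "continuous_on {0..L} M" unfolding M_def
        by (intro indefinite_integral_continuous_1 integrable_continuous_real continuous_intros g')
      then have "continuous_on {d..L} M" using d0 by (auto intro: continuous_on_subset)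
      then show "continuous_on {d..L} ?Phi" using d0 by (intro continuous_intros) auto
      fix y assume y: "d < y" "y < L"
      have "(g has_vector_derivative g' y) (at y within {0..L})" by (rule g) (use y d0 in auto)
      then have "(g has_vector_derivative g' y) (at y)" using y d0 by (simp add: at_within_Icc_at)
      then show "(w has_vector_derivative g' y) (at y)"
        unfolding w_def using has_vector_derivative_diff[OF _ has_vector_derivative_const] by fastforce
      have "(M has_real_derivative norm (g' y)) (at y within {0..L})"
        unfolding M_def has_real_derivative_iff_has_vector_derivative
        by (rule integral_has_vector_derivative) (use y d0 g' in \<open>auto intro!: continuous_intros\<close>)
      then have "(M has_real_derivative norm (g' y)) (at y)" using y d0 by (simp add: at_within_Icc_at)
      then show "(?Phi has_real_derivative (norm (g' y) * y - M y) / y\<^sup>2 + 2 * A * y powr (-1/p - 1)) (at y)"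
        using y d0 p by (auto intro!: derivative_eq_intros simp: power2_eq_square)
      have "2 * M y / y\<^sup>2 \<le> 2 * (A * y powr (1 - 1/p)) / y\<^sup>2"
        using MA[of y] y d0 by (intro divide_right_mono) auto
      also have "\<dots> = 2 * A * (y powr (1 - 1/p) / y\<^sup>2)" by simp
      also have "\<dots> = 2 * A * y powr (-1/p - 1)"
        by (subst e4) (use y d0 in auto)
      finally have "2 * M y / y\<^sup>2 \<le> 2 * A * y powr (-1/p - 1)" .
      moreover have "norm (w y) / y\<^sup>2 \<le> M y / y\<^sup>2"
        using wM[of y] y d0 by (intro divide_right_mono) auto
      ultimately show "norm (g' y) / y + norm (w y) / y\<^sup>2 \<le> (norm (g' y) * y - M y) / y\<^sup>2 + 2 * A * y powr (-1/p - 1)"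
        using y d0 by (simp add: diff_divide_distrib power2_eq_square)
    qed
    have dL': "L powr (-1/p) \<le> d powr (-1/p)"
      using dL d0 p by (intro powr_mono2') auto
    then have dL'': "A * L powr (-1/p) \<le> A * d powr (-1/p)" using A0 by (rule mult_left_mono)
    have "norm (w L) / L \<le> A * (L powr (1 - 1/p) / L)"
      using wA[of L L] dL d0 by (simp add: divide_right_mono)
    then have "norm (w L) / L \<le> A * d powr (-1/p)" using dL'' e3[of L] dL d0 by simp
    moreover have "norm (w d) / d \<le> A * (d powr (1 - 1/p) / d)"
      using wA[of d d] dL d0 by (simp add: divide_right_mono)
    then have "norm (w d) / d \<le> A * d powr (-1/p)" using e3[of d] d0 by simp
    moreover have "M L / L \<le> A * (L powr (1 - 1/p) / L)"
      using MA[of L] dL d0 by (simp add: divide_right_mono)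
    then have "M L / L \<le> A * d powr (-1/p)" using dL'' e3[of L] dL d0 by simp
    moreover have "M d / d \<ge> 0" using M0 d0 by simp
    moreover have "2 * A * p * L powr (-1/p) \<ge> 0" using A0 p by simp
    \<comment> \<open>The \<open>3\<close> counts the boundary terms at \<open>L\<close> and
      \<open>d\<close> and the value \<open>M L / L\<close>; the term \<open>2 * p\<close> comes
      from the power in \<open>?Phi d\<close>. The trivial piece below \<open>d\<close> later raises
      \<open>3\<close> to \<open>4\<close>.\<close>
    ultimately have "norm (w L) / L + norm (w d) / d + ?Phi L - ?Phi d
        \<le> 3 * (A * d powr (-1/p)) + 2 * A * p * d powr (-1/p)"
      by linarith
    also have "\<dots> = (3 + 2 * p) * A * d powr (-1/p)" by (simp add: algebra_simps)
    finally have "(norm (w L) / L + norm (w d) / d + ?Phi L - ?Phi d) / lam \<le> (3 + 2 * p) * A * d powr (-1/p) / lam"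
      using lam by (intro divide_right_mono) auto
    also have "\<dots> = (3 + 2 * p) * (A * (d powr (1 - 1/p) * d))"
      unfolding e2[symmetric] by simp
    finally have "norm (integral {0..L} (\<lambda>y. osc lam y * w y)) \<le>
        A * (d powr (1 - 1/p) * d) + (3 + 2 * p) * (A * (d powr (1 - 1/p) * d))"
      unfolding osc_integral_half_split[OF contw d0 dL]
      using 1 by (intro order_trans[OF norm_triangle_ineq] add_mono order_trans[OF 2]) (auto simp: mult.assoc)
    then show ?thesis by (simp add: algebra_simps)
  qed
  then show ?thesis unfolding e w_def by (simp add: mult.assoc)
qed

section \<open>The Fresnel integral\<close>

lemma osc_integral_derivative:
  assumes "0 \<le> t" "t \<le> T"
  shows "((\<lambda>t. integral {0..t} (osc lam)) has_vector_derivative osc lam t) (at t within {0..T})"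
  by (rule integral_has_vector_derivative) (use assms in \<open>auto intro: continuous_intros\<close>)

lemma has_integral_inverse_one_plus_square:
  "((\<lambda>u. inverse (1 + u\<^sup>2)) has_integral (pi / 4)) {0..1::real}"
proof -
  have "((\<lambda>u. inverse (1 + u\<^sup>2)) has_integral (arctan 1 - arctan 0)) {0..1::real}"
    by (rule fundamental_theorem_of_calculus)
      (auto intro!: derivative_eq_intros simp: has_real_derivative_iff_has_vector_derivative[symmetric])
  then show ?thesis by (simp add: arctan_one)
qed

text \<open>
  The square of \<open>\<integral>\<^sub>0\<^sup>t exp (i \<lambda> s\<^sup>2 / 2) ds\<close> plus a multiple of \<open>fresnel_aux\<close> has derivative zero, and
  \<open>fresnel_aux\<close> tends to zero; \<open>fresnel_Im_nonneg\<close> selects the square root.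
\<close>
definition fresnel_aux :: "real \<Rightarrow> real \<Rightarrow> complex"
  where "fresnel_aux lam t = integral {0..1} (\<lambda>u. inverse (1 + u\<^sup>2) *\<^sub>R cis (lam * t\<^sup>2 * (1 + u\<^sup>2) / 2))"

text \<open>Differentiating the phase produces the factor \<open>1 + u^2\<close>, which cancels the
  denominator. The remaining exponential splits into \<open>osc lam t * osc lam (u * t)\<close>, and
  \<open>t\<close> times the average of \<open>osc lam (u * t)\<close> over \<open>u\<close> is the
  integral of \<open>osc lam\<close> up to \<open>t\<close>.\<close>

lemma fresnel_aux_derivative:
  assumes "0 \<le> t" "t \<le> T"
  shows "(fresnel_aux lam has_vector_derivative (\<i> * of_real lam) * (osc lam t * integral {0..t} (osc lam))) (at t within {0..T})"
proof -
  let ?f = "\<lambda>t u. inverse (1 + u\<^sup>2) *\<^sub>R cis (lam * t\<^sup>2 * (1 + u\<^sup>2) / 2)"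
  let ?f' = "\<lambda>t u. (\<i> * of_real (lam * t)) * cis (lam * t\<^sup>2 * (1 + u\<^sup>2) / 2)"
  have nz: "1 + u\<^sup>2 \<noteq> 0" for u :: real
    using zero_le_power2[of u] by linarith
  have d: "((\<lambda>x. ?f x u) has_vector_derivative ?f' x u) (at x within {0..T})" for x u
  proof -
    have "((\<lambda>x. cis (lam * x\<^sup>2 * (1 + u\<^sup>2) / 2)) has_vector_derivative
        (\<i> * of_real (lam * x * (1 + u\<^sup>2))) * cis (lam * x\<^sup>2 * (1 + u\<^sup>2) / 2)) (at x within {0..T})"
      by (rule has_vector_derivative_cis) (auto intro!: derivative_eq_intros)
    then have "((\<lambda>x. ?f x u) has_vector_derivative
        inverse (1 + u\<^sup>2) *\<^sub>R ((\<i> * of_real (lam * x * (1 + u\<^sup>2))) * cis (lam * x\<^sup>2 * (1 + u\<^sup>2) / 2))) (at x within {0..T})"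
      by (rule bounded_linear.has_vector_derivative[OF bounded_linear_scaleR_right])
    moreover have "inverse (1 + u\<^sup>2) *\<^sub>R ((\<i> * of_real (lam * x * (1 + u\<^sup>2))) * cis (lam * x\<^sup>2 * (1 + u\<^sup>2) / 2)) = ?f' x u"
    proof -
      have "inverse (1 + u\<^sup>2) * (lam * x * (1 + u\<^sup>2)) = lam * x" using nz[of u] by (simp add: field_simps)
      then have "of_real (inverse (1 + u\<^sup>2)) * of_real (lam * x * (1 + u\<^sup>2)) = (of_real (lam * x) :: complex)"
        by (simp only: of_real_mult[symmetric])
      then show ?thesis
        by (simp only: scaleR_conv_of_real mult.assoc mult.left_commute[of _ \<i>])
          (simp only: mult.assoc[symmetric])
    qed
    ultimately show ?thesis by simp
  qed
  have "((\<lambda>x. integral (cbox 0 1) (?f x)) has_vector_derivative integral (cbox 0 1) (?f' t)) (at t within {0..T})"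
  proof (rule leibniz_rule_vector_derivative)
    show "continuous_on ({0..T} \<times> cbox 0 1) (\<lambda>(x, u). ?f' x u)"
      unfolding split_beta by (intro continuous_intros) auto
    show "?f x integrable_on cbox 0 1" for x
      using nz by (intro integrable_continuous continuous_intros) auto
  qed (use assms d in auto)
  moreover have "integral (cbox 0 1) (?f' t) = (\<i> * of_real lam) * (osc lam t * integral {0..t} (osc lam))"
  proof -
    have *: "?f' t u = (\<i> * of_real lam * osc lam t) * (t *\<^sub>R osc lam (u * t))" for u
    proof -
      have "lam * t\<^sup>2 * (1 + u\<^sup>2) / 2 = lam * t\<^sup>2 / 2 + lam * (u * t)\<^sup>2 / 2"
        by (simp add: field_simps power2_eq_square)
      then have "cis (lam * t\<^sup>2 * (1 + u\<^sup>2) / 2) = osc lam t * osc lam (u * t)"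
        by (simp only: osc_def cis_mult)
      then show ?thesis by (simp add: scaleR_conv_of_real)
    qed
    have "t *\<^sub>R ray_average 0 (osc lam) t = integral {0..t} (osc lam) - integral {0..0} (osc lam)"
      by (rule ray_average_0_deriv[of "{0..T}"])
        (use assms osc_integral_derivative in auto)
    then have "integral {0..1} (\<lambda>u. t *\<^sub>R osc lam (u * t)) = integral {0..t} (osc lam)"
      by (simp add: ray_average_def)
    moreover have "?f' t = (\<lambda>u. (\<i> * of_real lam * osc lam t) * (t *\<^sub>R osc lam (u * t)))"
      using * by (rule ext)
    ultimately show ?thesis
      by (simp only: interval_cbox[symmetric] integral_mult_right mult.assoc)
  qed
  ultimately show ?thesis unfolding fresnel_aux_def[abs_def] interval_cbox by (simp only:)
qed

lemma fresnel_square: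
  assumes "lam > 0" "t \<ge> 0"
  shows "(integral {0..t} (osc lam))\<^sup>2 = (2 * \<i> / of_real lam) * (of_real (pi / 4) - fresnel_aux lam t)"
proof -
  define F where "F t = integral {0..t} (osc lam) * integral {0..t} (osc lam) + (2 * \<i> / of_real lam) * fresnel_aux lam t" for t
  have "(F has_vector_derivative 0) (at x within {0..t})" if "x \<in> {0..t}" for x
  proof -
    have "(F has_vector_derivative (integral {0..x} (osc lam) * osc lam x + osc lam x * integral {0..x} (osc lam)) +
        (2 * \<i> / of_real lam) * ((\<i> * of_real lam) * (osc lam x * integral {0..x} (osc lam)))) (at x within {0..t})"
      unfolding F_def
      by (intro has_vector_derivative_add has_vector_derivative_mult has_vector_derivative_mult_right
          osc_integral_derivative fresnel_aux_derivative) (use that in auto)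
    moreover have "(integral {0..x} (osc lam) * osc lam x + osc lam x * integral {0..x} (osc lam)) +
        (2 * \<i> / of_real lam) * ((\<i> * of_real lam) * (osc lam x * integral {0..x} (osc lam))) = 0"
      using assms by (simp add: field_simps)
    ultimately show ?thesis by simp
  qed
  then have "((\<lambda>_. 0) has_integral (F t - F 0)) {0..t}"
    by (rule fundamental_theorem_of_calculus[OF assms(2)])
  then have "F t = F 0" by simp
  moreover have "fresnel_aux lam 0 = of_real (pi / 4)"
  proof -
    have "((\<lambda>u. of_real (inverse (1 + u\<^sup>2)) :: complex) has_integral of_real (pi / 4)) {0..1}"
      using has_integral_linear[OF has_integral_inverse_one_plus_square bounded_linear_of_real] by (simp only: o_def)
    moreover have "inverse (1 + u\<^sup>2) *\<^sub>R cis (lam * 0\<^sup>2 * (1 + u\<^sup>2) / 2) = of_real (inverse (1 + u\<^sup>2))" for u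
      by (simp add: scaleR_conv_of_real)
    ultimately show ?thesis by (simp only: fresnel_aux_def integral_unique)
  qed
  ultimately show ?thesis by (simp add: F_def power2_eq_square algebra_simps)
qed

text \<open>Up to the unimodular factor \<open>osc lam t\<close> this is an oscillatory integral in
  \<open>u\<close> with parameter \<open>lam * t^2\<close> and weight \<open>1 / (1 + u^2)\<close>.
  Van der Corput with \<open>A = 1\<close> and \<open>B = 2\<close> yields
  \<open>4 + 2 = 6\<close>.\<close>

lemma fresnel_aux_bound:
  assumes lam: "lam > 0" and t: "t > 0"
  shows "norm (fresnel_aux lam t) \<le> 6 * (lam * t\<^sup>2) powr (-1/2)"
proof -
  let ?w = "\<lambda>u::real. of_real (inverse (1 + u\<^sup>2)) :: complex"
  let ?w' = "\<lambda>u::real. of_real (- (2 * u) / (1 + u\<^sup>2)\<^sup>2) :: complex"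
  have pos: "1 + u\<^sup>2 > 0" for u :: real by (simp add: add_pos_nonneg)
  have "fresnel_aux lam t = integral {0..1} (\<lambda>u. osc lam t * (osc (lam * t\<^sup>2) u * ?w u))"
    unfolding fresnel_aux_def
  proof (rule integral_cong)
    fix u :: real
    have "lam * t\<^sup>2 * (1 + u\<^sup>2) / 2 = lam * t\<^sup>2 / 2 + lam * t\<^sup>2 * u\<^sup>2 / 2" by (simp add: field_simps)
    then have "cis (lam * t\<^sup>2 * (1 + u\<^sup>2) / 2) = osc lam t * osc (lam * t\<^sup>2) u"
      by (simp only: osc_def cis_mult)
    then show "inverse (1 + u\<^sup>2) *\<^sub>R cis (lam * t\<^sup>2 * (1 + u\<^sup>2) / 2) = osc lam t * (osc (lam * t\<^sup>2) u * ?w u)"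
      by (simp only: scaleR_conv_of_real) (simp only: ac_simps)
  qed
  then have "norm (fresnel_aux lam t) = norm (integral {0..1} (\<lambda>u. osc (lam * t\<^sup>2) u * ?w u))"
    by (simp only: integral_mult_right norm_mult norm_osc mult_1)
  also have "\<dots> \<le> (4 * 1 + 2) * (lam * t\<^sup>2) powr (-1/2)"
  proof (rule van_der_Corput_half[where w' = ?w'])
    show "continuous_on {0..1} ?w" using pos by (intro continuous_intros) (simp add: less_imp_neq[symmetric])
    show "norm (?w y) \<le> 1" for y
      using pos[of y] by (simp del: of_real_inverse of_real_add of_real_power add: inverse_le_1_iff)
    show "(?w has_vector_derivative ?w' y) (at y)" for y
      using pos[of y]
      by (intro has_vector_derivative_of_real)
        (auto intro!: derivative_eq_intros simp: power2_eq_square field_simps)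
    fix y :: real assume y: "0 < y" "y < 1"
    have "y * (2 * y) \<le> 2 * 1" using y by (simp add: mult_le_one)
    also have "\<dots> \<le> 2 * (1 + y\<^sup>2)\<^sup>2" by (intro mult_left_mono) (auto simp: one_le_power)
    finally have "y * \<bar>- (2 * y) / (1 + y\<^sup>2)\<^sup>2\<bar> \<le> 2"
      using y pos[of y] by (simp add: field_simps)
    then show "y * norm (?w' y) \<le> 2" by (simp only: norm_of_real)
  qed (use lam t in auto)
  finally show ?thesis by simp
qed

text \<open>One integration by parts with the primitive \<open>1 - cos\<close> instead of
  \<open>- cos\<close> makes both terms nonnegative: \<open>sin (lam * s^2 / 2)\<close> is the
  derivative of \<open>(1 - cos (lam * s^2 / 2)) / (lam * s)\<close> plus
  \<open>(1 - cos (lam * s^2 / 2)) / (lam * s^2)\<close>. Hence \<open>W\<close> increases. The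
  singularity at \<open>0\<close> is avoided by starting at \<open>e\<close> and letting
  \<open>e\<close> tend to \<open>0\<close>.\<close>

lemma fresnel_Im_nonneg:
  assumes lam: "lam > 0" and t: "t \<ge> 0"
  shows "Im (integral {0..t} (osc lam)) \<ge> 0"
proof -
  have int: "Im (integral {0..t} (osc lam)) = integral {0..t} (\<lambda>s. sin (lam * s\<^sup>2 / 2))"
  proof -
    have "(osc lam has_integral integral {0..t} (osc lam)) {0..t}"
      by (intro integrable_integral integrable_continuous_real continuous_intros)
    from has_integral_linear[OF this bounded_linear_Im] show ?thesis
      by (simp add: o_def osc_def integral_unique)
  qed
  have le: "integral {0..t} (\<lambda>s. sin (lam * s\<^sup>2 / 2)) \<ge> integral {0..e} (\<lambda>s. sin (lam * s\<^sup>2 / 2)) - lam * e"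
    if e: "0 < e" "e < t" "e < 1" for e
  proof -
    let ?J = "\<lambda>s. integral {0..s} (\<lambda>s. sin (lam * s\<^sup>2 / 2))"
    define W where "W s = ?J s - (1 - cos (lam * s\<^sup>2 / 2)) / (lam * s)" for s
    have W': "(W has_real_derivative (1 - cos (lam * s\<^sup>2 / 2)) / (lam * s\<^sup>2)) (at s)" if s: "e < s" "s < t" for s
    proof -
      have "(?J has_real_derivative sin (lam * s\<^sup>2 / 2)) (at s within {0..t})"
        unfolding has_real_derivative_iff_has_vector_derivative
        by (rule integral_has_vector_derivative) (use s e in \<open>auto intro!: continuous_intros\<close>)
      then have "(?J has_real_derivative sin (lam * s\<^sup>2 / 2)) (at s)"
        using s e by (simp add: at_within_Icc_at)
      then show ?thesis unfolding W_def
        using s e lam by (auto intro!: derivative_eq_intros simp: field_simps power2_eq_square)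
    qed
    have "continuous_on {e..t} W"
      unfolding W_def using e lam
      by (intro continuous_intros continuous_on_subset[OF indefinite_integral_continuous_1[of _ 0 t]] integrable_continuous_real)
        auto
    moreover have "\<exists>y. (W has_real_derivative y) (at x) \<and> 0 \<le> y" if "e < x" "x < t" for x
      using W'[OF that] lam by (intro exI[of _ "(1 - cos (lam * x\<^sup>2 / 2)) / (lam * x\<^sup>2)"]) auto
    ultimately have "W e \<le> W t"
      using e by (intro DERIV_nonneg_imp_increasing_open[of e t W]) auto
    moreover have "(1 - cos (lam * t\<^sup>2 / 2)) / (lam * t) \<ge> 0" using lam e by simp
    \<comment> \<open>Any bound tending to \<open>0\<close> with \<open>e\<close> would do;
      \<open>1 - cos x \<le> x^2 / 2\<close> gives a multiple of \<open>e^3\<close>, and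
      \<open>e < 1\<close> weakens it to a linear one.\<close>
    moreover have "(1 - cos (lam * e\<^sup>2 / 2)) / (lam * e) \<le> lam * e"
    proof -
      have "1 - cos (lam * e\<^sup>2 / 2) \<le> (lam * e\<^sup>2 / 2)\<^sup>2 / 2"
      proof -
        have "cos (2 * (lam * e\<^sup>2 / 4)) = 1 - 2 * (sin (lam * e\<^sup>2 / 4))\<^sup>2" by (rule cos_double_sin)
        moreover have "(sin (lam * e\<^sup>2 / 4))\<^sup>2 \<le> (lam * e\<^sup>2 / 4)\<^sup>2"
          using abs_sin_x_le_abs_x by (simp only: abs_le_square_iff)
        moreover have "2 * (lam * e\<^sup>2 / 4) = lam * e\<^sup>2 / 2" by simp
        ultimately show ?thesis by (simp add: power_divide)
      qed
      also have "\<dots> \<le> (lam * e) * (lam * e)"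
      proof -
        have "e\<^sup>2 * e\<^sup>2 \<le> e\<^sup>2 * 1" using e by (intro mult_left_mono) (auto simp: power_le_one)
        then have "lam * lam * (e\<^sup>2 * e\<^sup>2) \<le> lam * lam * e\<^sup>2" using lam by (simp add: mult_left_mono)
        then show ?thesis using lam e by (simp add: power2_eq_square field_simps)
      qed
      finally show ?thesis using lam e by (simp add: field_simps)
    qed
    ultimately show ?thesis by (simp add: W_def)
  qed
  show ?thesis
  proof (cases "t = 0")
    case False
    let ?J = "\<lambda>s. integral {0..s} (\<lambda>s. sin (lam * s\<^sup>2 / 2))"
    have "continuous_on {0..t} ?J"
      by (intro indefinite_integral_continuous_1 integrable_continuous_real continuous_intros) auto
    then have "(?J \<longlongrightarrow> ?J 0) (at 0 within {0..t})"
      using t unfolding continuous_on_def by (metis atLeastAtMost_iff order_refl)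
    then have "(?J \<longlongrightarrow> ?J 0) (at_right 0)"
      using t False by (simp add: at_within_Icc_at_right)
    then have "((\<lambda>e. ?J e - lam * e) \<longlongrightarrow> ?J 0 - lam * 0) (at_right 0)"
      by (intro tendsto_intros)
    moreover have "eventually (\<lambda>e. ?J e - lam * e \<le> ?J t) (at_right 0)"
      using eventually_at_right_real[of 0 "min t 1"] t False
      by (auto elim!: eventually_mono intro!: le)
    ultimately have "?J 0 - lam * 0 \<le> ?J t"
      by (intro tendsto_upperbound) auto
    then show ?thesis by (simp add: int)
  qed simp
qed

text \<open>From \<open>(E - w) * (E + w) = E^2 - w^2\<close> tending to \<open>0\<close>,
  convergence \<open>E\<close> to \<open>w\<close> follows once \<open>E + w\<close> stays away from
  \<open>0\<close>. Its imaginary part is at least \<open>Im w > 0\<close>, because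
  \<open>Im E\<close> is nonnegative.\<close>

lemma fresnel_half:
  assumes lam: "lam > 0"
  shows "((\<lambda>t. integral {0..t} (osc lam)) \<longlongrightarrow> of_real (sqrt (pi / (2 * lam))) * exp (\<i> * of_real pi / 4)) at_top"
proof -
  define w where "w = of_real (sqrt (pi / (2 * lam))) * exp (\<i> * of_real pi / 4)"
  define E where "E t = integral {0..t} (osc lam)" for t
  have e4: "exp (\<i> * of_real pi / 4) = cis (pi / 4)" by (simp add: cis_conv_exp)
  have w2: "w\<^sup>2 = (2 * \<i> / of_real lam) * of_real (pi / 4)"
  proof -
    have "(cis (pi / 4))\<^sup>2 = \<i>" by (simp add: power2_eq_square cis_mult)
    moreover have "(of_real (sqrt (pi / (2 * lam))))\<^sup>2 = (of_real (pi / (2 * lam)) :: complex)"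
      using lam by (simp add: of_real_power[symmetric] del: of_real_power)
    ultimately show ?thesis using lam unfolding w_def e4 power_mult_distrib by (simp add: field_simps)
  qed
  have Imw: "Im w > 0" unfolding w_def e4 using lam by (simp add: sin_gt_zero)
  have bd: "norm (E t - w) \<le> (2 / lam * (6 * (lam * t\<^sup>2) powr (-1/2))) / Im w" if "t > 0" for t
  proof -
    have "(E t - w) * (E t + w) = (E t)\<^sup>2 - w\<^sup>2" by (simp add: power2_eq_square algebra_simps)
    also have "\<dots> = - ((2 * \<i> / of_real lam) * fresnel_aux lam t)"
      using fresnel_square[OF lam, of t] that by (simp add: w2 E_def algebra_simps)
    finally have "norm (E t - w) * norm (E t + w) = norm ((2 * \<i> / of_real lam) * fresnel_aux lam t)"
      by (metis norm_minus_cancel norm_mult)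
    also have "\<dots> \<le> 2 / lam * (6 * (lam * t\<^sup>2) powr (-1/2))"
      using fresnel_aux_bound[OF lam that] lam by (simp add: norm_mult norm_divide divide_right_mono)
    finally have 1: "norm (E t - w) * norm (E t + w) \<le> 2 / lam * (6 * (lam * t\<^sup>2) powr (-1/2))" .
    have "Im w \<le> Im (E t + w)" using fresnel_Im_nonneg[OF lam, of t] that by (simp add: E_def)
    also have "\<dots> \<le> norm (E t + w)" using abs_Im_le_cmod[of "E t + w"] by linarith
    finally have "norm (E t - w) * Im w \<le> norm (E t - w) * norm (E t + w)" by (intro mult_left_mono) auto
    with 1 have "norm (E t - w) * Im w \<le> 2 / lam * (6 * (lam * t\<^sup>2) powr (-1/2))" by linarith
    then show ?thesis using Imw by (simp only: pos_le_divide_eq)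
  qed
  have "((\<lambda>t. (2 / lam * (6 * (lam * t\<^sup>2) powr (-1/2))) / Im w) \<longlongrightarrow> (2 / lam * (6 * 0)) / Im w) at_top"
  proof (intro tendsto_intros)
    have "filterlim (\<lambda>t::real. lam * t\<^sup>2) at_top at_top"
      using lam by (intro filterlim_tendsto_pos_mult_at_top[OF tendsto_const] filterlim_pow_at_top filterlim_ident) auto
    then show "((\<lambda>t. (lam * t\<^sup>2) powr (-1/2)) \<longlongrightarrow> 0) at_top"
      by (intro tendsto_neg_powr) auto
  qed (use Imw in auto)
  then have "((\<lambda>t. E t - w) \<longlongrightarrow> 0) at_top"
    using bd by (intro Lim_null_comparison[of "\<lambda>t. E t - w"] eventually_mono[OF eventually_gt_at_top[of 0]]) auto
  then have "(E \<longlongrightarrow> w) at_top" by (simp add: LIM_zero_iff)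
  then show ?thesis unfolding E_def w_def .
qed

text \<open>The value of the Fresnel integral over the whole line; the prefactor of both the leading
  term and the expansion in the theorem.\<close>

definition gauss_const :: "real \<Rightarrow> complex"
  where "gauss_const lam = of_real (sqrt (2 * pi) * lam powr (-1/2)) * exp (\<i> * of_real pi / 4)"

lemma fresnel:
  assumes lam: "lam > 0"
  shows "((\<lambda>L. integral {-L..L} (osc lam)) \<longlongrightarrow> gauss_const lam) at_top"
proof -
  have "2 * sqrt (pi / (2 * lam)) = sqrt (2 * pi) * lam powr (-1/2)"
  proof -
    have "sqrt 4 * sqrt (pi / (2 * lam)) = sqrt (2 * pi / lam)" by (simp only: real_sqrt_mult[symmetric]) simp
    also have "\<dots> = sqrt (2 * pi) * lam powr (-1/2)"
      using lam by (simp add: real_sqrt_divide powr_minus powr_half_sqrt field_simps)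
    finally show ?thesis by simp
  qed
  then have c: "of_real (sqrt (pi / (2 * lam))) * exp (\<i> * of_real pi / 4) + of_real (sqrt (pi / (2 * lam))) * exp (\<i> * of_real pi / 4) = gauss_const lam"
    unfolding gauss_const_def by (metis (no_types, lifting) mult.assoc mult_2 of_real_mult of_real_numeral)
  have "((\<lambda>L. integral {0..L} (osc lam) + integral {0..L} (osc lam)) \<longlongrightarrow> gauss_const lam) at_top"
    unfolding c[symmetric] by (intro tendsto_intros fresnel_half lam)
  moreover have "eventually (\<lambda>L. integral {0..L} (osc lam) + integral {0..L} (osc lam) = integral {-L..L} (osc lam)) at_top"
    using eventually_ge_at_top[of 0]
    by eventually_elim (simp add: integral_even_odd continuous_on_osc)
  ultimately show ?thesis by (rule Lim_transform_eventually)
qed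

section \<open>Expansion on the line\<close>

text \<open>\<open>ucd\<close> only asserts that derivatives exist. Defining an operator that can be
  iterated requires a derivative chosen as a function of \<open>f\<close>.\<close>

definition vderiv :: "(real \<Rightarrow> 'a::real_normed_vector) \<Rightarrow> real \<Rightarrow> 'a"
  where "vderiv f x = vector_derivative f (at x)"

lemma ucd_UNIV_D:
  assumes "ucd UNIV {} I (Suc m) f"
  shows "\<And>i x. i \<in> I \<Longrightarrow> (f i has_vector_derivative vderiv (f i) x) (at x)"
    and "ucd UNIV {} I m (\<lambda>i. vderiv (f i))"
proof -
  obtain f' where f': "\<forall>i\<in>I. \<forall>x. (f i has_vector_derivative f' i x) (at x)" "ucd UNIV {} I m f'"
    using assms by (auto simp: ucd.simps(2))
  then have eq: "vderiv (f i) x = f' i x" if "i \<in> I" for i x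
    using that by (auto simp: vderiv_def intro: vector_derivative_at)
  then show "\<And>i x. i \<in> I \<Longrightarrow> (f i has_vector_derivative vderiv (f i) x) (at x)"
    using f' by auto
  show "ucd UNIV {} I m (\<lambda>i. vderiv (f i))"
    by (rule ucd_cong[OF f'(2)]) (auto simp: eq)
qed

text \<open>The quotient \<open>(g y - g 0) / y\<close>, written as an average of \<open>g'\<close>
  so that \<open>y = 0\<close> is no exception and only one derivative is lost.\<close>

definition divided_difference :: "(real \<Rightarrow> complex) \<Rightarrow> real \<Rightarrow> complex"
  where "divided_difference g = ray_average 0 (vderiv g)"

text \<open>The operator \<open>T\<close> of the overview. Of the two derivatives it costs, one goes
  into the quotient and one into the outer differentiation.\<close>

definition phase_step :: "(real \<Rightarrow> complex) \<Rightarrow> real \<Rightarrow> complex"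
  where "phase_step g = vderiv (divided_difference g)"

lemma ucd_divided_difference:
  "ucd UNIV {} I (Suc m) g \<Longrightarrow> ucd UNIV {} I m (\<lambda>i. divided_difference (g i))"
  unfolding divided_difference_def by (intro ucd_ray_average ucd_UNIV_D) auto

lemma ucd_phase_step:
  "ucd UNIV {} I (Suc (Suc m)) g \<Longrightarrow> ucd UNIV {} I m (\<lambda>i. phase_step (g i))"
  unfolding phase_step_def by (intro ucd_UNIV_D ucd_divided_difference)

lemma divided_difference_eq:
  assumes "ucd UNIV {} I (Suc m) g" "i \<in> I"
  shows "y *\<^sub>R divided_difference (g i) y = g i y - g i 0"
  unfolding divided_difference_def
  by (rule ray_average_0_deriv[of UNIV]) (use ucd_UNIV_D(1)[OF assms] in auto)

text \<open>The fundamental theorem is applied to \<open>osc * f\<close>, with \<open>f\<close> the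
  divided difference. The derivative of \<open>osc\<close> brings down \<open>i * lam * y\<close>,
  and \<open>y * f = g - g 0\<close> recovers the original integrand. Evenness of \<open>osc\<close>
  merges the two boundary values.\<close>

lemma phase_step_integral:
  assumes g: "ucd UNIV {} I (Suc (Suc m)) g" and i: "i \<in> I" and lam: "lam > 0" and L: "L \<ge> 0"
  shows "integral {-L..L} (\<lambda>y. osc lam y * g i y) =
    g i 0 * integral {-L..L} (osc lam)
    - \<i> / of_real lam * (osc lam L * (divided_difference (g i) L - divided_difference (g i) (- L)))
    + \<i> / of_real lam * integral {-L..L} (\<lambda>y. osc lam y * phase_step (g i) y)"
proof -
  let ?f = "divided_difference (g i)"
  have f': "(?f has_vector_derivative phase_step (g i) y) (at y)" for y
    unfolding phase_step_def using ucd_UNIV_D(1)[OF ucd_divided_difference[OF g] i] .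
  have cT: "continuous_on S (phase_step (g i))" for S
    using ucd_continuous[OF ucd_phase_step[OF g] i] continuous_on_subset by blast
  have cf: "continuous_on S ?f" for S
    using ucd_continuous[OF ucd_divided_difference[OF g] i] continuous_on_subset by blast
  have cg: "continuous_on S (g i)" for S
    using ucd_continuous[OF g i] continuous_on_subset by blast
  have "((\<lambda>y. osc lam y * phase_step (g i) y + ((\<i> * of_real (lam * y)) * osc lam y) * ?f y) has_integral
      (osc lam L * ?f L - osc lam (- L) * ?f (- L))) {-L..L}"
    by (rule fundamental_theorem_of_calculus)
      (use L in \<open>auto intro!: has_vector_derivative_mult osc_derivative has_vector_derivative_at_within[OF f'] simp del: of_real_mult\<close>)
  moreover have "osc lam y * phase_step (g i) y + ((\<i> * of_real (lam * y)) * osc lam y) * ?f y =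
      osc lam y * phase_step (g i) y + (\<i> * of_real lam) * (osc lam y * g i y - g i 0 * osc lam y)" for y
  proof -
    have "of_real y * ?f y = g i y - g i 0"
      using divided_difference_eq[OF g i, of y] by (simp only: scaleR_conv_of_real)
    moreover have "((\<i> * of_real (lam * y)) * osc lam y) * ?f y = (\<i> * of_real lam) * (osc lam y * (of_real y * ?f y))"
      by simp
    ultimately show ?thesis by (simp only: right_diff_distrib mult.commute)
  qed
  ultimately have e1: "integral {-L..L} (\<lambda>y. osc lam y * phase_step (g i) y + (\<i> * of_real lam) * (osc lam y * g i y - g i 0 * osc lam y))
      = osc lam L * ?f L - osc lam (- L) * ?f (- L)"
    by (simp only: integral_unique)
  have e2: "integral {-L..L} (\<lambda>y. osc lam y * phase_step (g i) y + (\<i> * of_real lam) * (osc lam y * g i y - g i 0 * osc lam y))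
      = integral {-L..L} (\<lambda>y. osc lam y * phase_step (g i) y) + (\<i> * of_real lam) *
          (integral {-L..L} (\<lambda>y. osc lam y * g i y) - g i 0 * integral {-L..L} (osc lam))"
  proof -
    have int: "(\<lambda>y. osc lam y * phase_step (g i) y) integrable_on {-L..L}"
      "(\<lambda>y. osc lam y * g i y) integrable_on {-L..L}" "(\<lambda>y. g i 0 * osc lam y) integrable_on {-L..L}"
      by (intro integrable_continuous_real continuous_intros cT cg)+
    have "integral {-L..L} (\<lambda>y. osc lam y * g i y - g i 0 * osc lam y) =
        integral {-L..L} (\<lambda>y. osc lam y * g i y) - g i 0 * integral {-L..L} (osc lam)"
      by (simp add: Henstock_Kurzweil_Integration.integral_diff[OF int(2,3)])
    moreover have "integral {-L..L} (\<lambda>y. osc lam y * phase_step (g i) y + (\<i> * of_real lam) * (osc lam y * g i y - g i 0 * osc lam y))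
      = integral {-L..L} (\<lambda>y. osc lam y * phase_step (g i) y) +
        integral {-L..L} (\<lambda>y. (\<i> * of_real lam) * (osc lam y * g i y - g i 0 * osc lam y))"
      by (intro Henstock_Kurzweil_Integration.integral_add int integrable_continuous_real continuous_intros cg)
    ultimately show ?thesis by (simp only: integral_mult_right)
  qed
  have "(\<i> * of_real lam) * (integral {-L..L} (\<lambda>y. osc lam y * g i y) - g i 0 * integral {-L..L} (osc lam))
     = osc lam L * (?f L - ?f (- L)) - integral {-L..L} (\<lambda>y. osc lam y * phase_step (g i) y)"
    using trans[OF sym[OF e2] e1] by (simp only: osc_minus right_diff_distrib[symmetric] eq_diff_eq add.commute)
  then have "integral {-L..L} (\<lambda>y. osc lam y * g i y) - g i 0 * integral {-L..L} (osc lam) =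
    (osc lam L * (?f L - ?f (- L)) - integral {-L..L} (\<lambda>y. osc lam y * phase_step (g i) y)) / (\<i> * of_real lam)"
    using lam by (subst nonzero_eq_divide_eq) (auto simp only: mult.commute, auto)
  also have "\<dots> = - \<i> / of_real lam * (osc lam L * (?f L - ?f (- L))) + \<i> / of_real lam * integral {-L..L} (\<lambda>y. osc lam y * phase_step (g i) y)"
    by (simp add: divide_inverse mult.commute right_diff_distrib)
  finally show ?thesis by (simp add: algebra_simps)
qed

text \<open>The finite identity is solved for the integral of \<open>T g\<close> (this is
  \<open>?H\<close>). All other terms converge, so the limit \<open>J'\<close> exists as a
  consequence and nothing about the decay of \<open>T g\<close> has to be known.\<close>

lemma phase_step_limit:
  assumes g: "ucd UNIV {} I (Suc (Suc m)) g" and i: "i \<in> I" and lam: "lam > 0"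
    and J: "((\<lambda>L. integral {-L..L} (\<lambda>y. osc lam y * g i y)) \<longlongrightarrow> J) at_top"
  obtains J' where "((\<lambda>L. integral {-L..L} (\<lambda>y. osc lam y * phase_step (g i) y)) \<longlongrightarrow> J') at_top"
    and "J = g i 0 * gauss_const lam + \<i> / of_real lam * J'"
proof -
  let ?f = "divided_difference (g i)"
  obtain M where M: "M \<ge> 0" "\<forall>i\<in>I. \<forall>x\<in>UNIV. norm (g i x) \<le> M"
    by (rule ucd_bound[OF g])
  have f: "norm (?f y) \<le> 2 * M / \<bar>y\<bar>" if "y \<noteq> 0" for y
  proof -
    have "\<bar>y\<bar> * norm (?f y) = norm (g i y - g i 0)"
      using divided_difference_eq[OF g i, of y] by (metis norm_scaleR)
    also have "\<dots> \<le> M + M" using M i by (intro order_trans[OF norm_triangle_ineq4] add_mono) auto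
    finally show ?thesis using that by (simp add: field_simps)
  qed
  have lim0: "((\<lambda>L. osc lam L * (?f L - ?f (- L))) \<longlongrightarrow> 0) at_top"
  proof (rule Lim_null_comparison)
    show "eventually (\<lambda>L. norm (osc lam L * (?f L - ?f (- L))) \<le> 4 * M / L) at_top"
      using eventually_gt_at_top[of 0]
    proof eventually_elim
      case (elim L)
      have "norm (?f L - ?f (- L)) \<le> 2 * M / \<bar>L\<bar> + 2 * M / \<bar>- L\<bar>"
        using elim by (intro order_trans[OF norm_triangle_ineq4] add_mono f) auto
      then show ?case using elim by (simp add: norm_mult)
    qed
    show "((\<lambda>L. 4 * M / L) \<longlongrightarrow> 0) at_top"
      by (intro tendsto_divide_0[OF tendsto_const] filterlim_at_top_imp_at_infinity filterlim_ident)
  qed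
  let ?G = "\<lambda>L. integral {-L..L} (\<lambda>y. osc lam y * g i y)"
  let ?T = "\<lambda>L. integral {-L..L} (\<lambda>y. osc lam y * phase_step (g i) y)"
  let ?H = "\<lambda>L. (of_real lam / \<i>) * (?G L - g i 0 * integral {-L..L} (osc lam)
      + \<i> / of_real lam * (osc lam L * (?f L - ?f (- L))))"
  have "(?H \<longlongrightarrow> (of_real lam / \<i>) * (J - g i 0 * gauss_const lam + \<i> / of_real lam * 0)) at_top"
    by (intro tendsto_intros J lim0 fresnel lam) auto
  moreover have "eventually (\<lambda>L. ?H L = ?T L) at_top"
    using eventually_ge_at_top[of 0]
  proof eventually_elim
    case (elim L)
    show ?case using phase_step_integral[OF g i lam elim] lam by (simp add: field_simps)
  qed
  ultimately have T: "(?T \<longlongrightarrow> (of_real lam / \<i>) * (J - g i 0 * gauss_const lam + \<i> / of_real lam * 0)) at_top"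
    by (rule Lim_transform_eventually)
  show ?thesis
    by (rule that[OF T]) (use lam in \<open>simp add: field_simps\<close>)
qed

section \<open>The bound that ends the iteration, and the expansion\<close>

lemma van_der_Corput_full:
  assumes lam: "0 < lam" and L: "0 \<le> L" and w: "continuous_on UNIV w"
    and w': "\<And>y. y \<noteq> 0 \<Longrightarrow> (w has_vector_derivative w' y) (at y)"
    and A: "\<And>y. norm (w y) \<le> A" and B: "\<And>y. y \<noteq> 0 \<Longrightarrow> \<bar>y\<bar> * norm (w' y) \<le> B"
  shows "norm (integral {-L..L} (\<lambda>y. osc lam y * w y)) \<le> 2 * (4 * A + B) * lam powr (-1/2)"
proof -
  have B0: "0 \<le> B" using order_trans[OF _ B[of 1]] by simp
  have "norm (integral {0..L} (\<lambda>y. osc lam y * w y)) \<le> (4 * A + B) * lam powr (-1/2)"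
  proof (rule van_der_Corput_half[OF lam L, where w' = w'])
    fix y :: real assume "0 < y"
    then show "(w has_vector_derivative w' y) (at y)" "y * norm (w' y) \<le> B"
      using w'[of y] B[of y] by auto
  qed (use A B0 w in \<open>auto intro: continuous_on_subset\<close>)
  moreover have "norm (integral {0..L} (\<lambda>y. osc lam y * w (- y))) \<le> (4 * A + B) * lam powr (-1/2)"
  proof (rule van_der_Corput_half[OF lam L, where w' = "\<lambda>y. - w' (- y)"])
    show "continuous_on {0..L} (\<lambda>y. w (- y))"
      by (intro continuous_on_compose2[OF w] continuous_intros) auto
    fix y :: real assume "0 < y"
    then have "((w \<circ> uminus) has_vector_derivative (- 1) *\<^sub>R w' (- y)) (at y)"
      by (intro vector_diff_chain_at w') (auto intro!: derivative_eq_intros)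
    then show "((\<lambda>y. w (- y)) has_vector_derivative - w' (- y)) (at y)" by (simp add: o_def)
    show "y * norm (- w' (- y)) \<le> B" using B[of "- y"] \<open>0 < y\<close> by simp
  qed (use A B0 in auto)
  moreover have "integral {-L..L} (\<lambda>y. osc lam y * w y) =
      integral {0..L} (\<lambda>y. osc lam y * w y) + integral {0..L} (\<lambda>y. osc lam y * w (- y))"
    by (subst integral_even_odd)
      (use L w in \<open>auto intro!: continuous_intros intro: continuous_on_subset\<close>)
  ultimately show ?thesis
    using norm_triangle_ineq[of "integral {0..L} (\<lambda>y. osc lam y * w y)" "integral {0..L} (\<lambda>y. osc lam y * w (- y))"]
    by (simp add: algebra_simps)
qed

text \<open>With two derivatives of \<open>g\<close> available, \<open>T g\<close> is merely
  continuous at \<open>0\<close>. Away from \<open>0\<close>, differentiating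
  \<open>y * f = g - g 0\<close> twice gives \<open>y * T g = g' - f\<close> and then
  \<open>y * (T g)' = g'' - 2 * T g\<close>. The right side is bounded by \<open>B + 2 * A\<close>,
  precisely what the van der Corput estimate asks for.\<close>

lemma phase_step_bound:
  assumes g: "ucd UNIV {} I (Suc (Suc 0)) g"
  obtains C where "C \<ge> 0" and "\<And>i lam L. i \<in> I \<Longrightarrow> lam > 0 \<Longrightarrow> L \<ge> 0 \<Longrightarrow>
    norm (integral {-L..L} (\<lambda>y. osc lam y * phase_step (g i) y)) \<le> C * lam powr (-1/2)"
proof -
  obtain A where A: "A \<ge> 0" "\<forall>i\<in>I. \<forall>x\<in>UNIV. norm (phase_step (g i) x) \<le> A"
    by (rule ucd_bound[OF ucd_phase_step[OF g]])
  obtain B where B: "B \<ge> 0" "\<forall>i\<in>I. \<forall>x\<in>UNIV. norm (vderiv (vderiv (g i)) x) \<le> B"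
    by (rule ucd_bound[OF ucd_UNIV_D(2)[OF ucd_UNIV_D(2)[OF g]]])
  show ?thesis
  proof (rule that[of "2 * (4 * A + (B + 2 * A))"])
    fix i lam L assume i: "i \<in> I" and lam: "lam > (0::real)" and L: "L \<ge> (0::real)"
    let ?f = "divided_difference (g i)" and ?g1 = "vderiv (g i)" and ?g2 = "vderiv (vderiv (g i))"
    have f': "(?f has_vector_derivative phase_step (g i) y) (at y)" for y
      unfolding phase_step_def using ucd_UNIV_D(1)[OF ucd_divided_difference[OF g] i] .
    have g1: "(g i has_vector_derivative ?g1 y) (at y)" for y by (rule ucd_UNIV_D(1)[OF g i])
    have g2: "(?g1 has_vector_derivative ?g2 y) (at y)" for y by (rule ucd_UNIV_D(1)[OF ucd_UNIV_D(2)[OF g] i])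
    have eq: "phase_step (g i) y = (1 / y) *\<^sub>R (?g1 y - ?f y)" if "y \<noteq> 0" for y
    proof -
      have "((\<lambda>y. y *\<^sub>R ?f y) has_vector_derivative (y *\<^sub>R phase_step (g i) y + 1 *\<^sub>R ?f y)) (at y)"
        by (intro has_vector_derivative_scaleR f' DERIV_ident)
      moreover have "((\<lambda>y. y *\<^sub>R ?f y) has_vector_derivative ?g1 y - 0) (at y)"
        unfolding divided_difference_eq[OF g i]
        by (intro has_vector_derivative_diff has_vector_derivative_const g1)
      ultimately have "y *\<^sub>R phase_step (g i) y + 1 *\<^sub>R ?f y = ?g1 y - 0"
        by (rule vector_derivative_unique_at)
      then have "y *\<^sub>R phase_step (g i) y = ?g1 y - ?f y" by (simp add: algebra_simps)
      then have "(1 / y) *\<^sub>R (y *\<^sub>R phase_step (g i) y) = (1 / y) *\<^sub>R (?g1 y - ?f y)" by simp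
      then show ?thesis using that by simp
    qed
    have D: "(phase_step (g i) has_vector_derivative (1 / y) *\<^sub>R (?g2 y - 2 *\<^sub>R phase_step (g i) y)) (at y)"
      if y: "y \<noteq> 0" for y
    proof -
      have "((\<lambda>y. (1 / y) *\<^sub>R (?g1 y - ?f y)) has_vector_derivative
          (1 / y) *\<^sub>R (?g2 y - phase_step (g i) y) + (- 1 / y\<^sup>2) *\<^sub>R (?g1 y - ?f y)) (at y)"
        by (intro has_vector_derivative_scaleR has_vector_derivative_diff g2 f')
          (use y in \<open>auto intro!: derivative_eq_intros simp: power2_eq_square\<close>)
      moreover have "(- 1 / y\<^sup>2) *\<^sub>R (?g1 y - ?f y) = (1 / y) *\<^sub>R (- phase_step (g i) y)"
        unfolding eq[OF y] by (simp add: power2_eq_square)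
      ultimately have "((\<lambda>y. (1 / y) *\<^sub>R (?g1 y - ?f y)) has_vector_derivative
          (1 / y) *\<^sub>R (?g2 y - 2 *\<^sub>R phase_step (g i) y)) (at y)"
        by (simp only: scaleR_add_right[symmetric] scaleR_2) (simp add: algebra_simps)
      then show ?thesis
        by (rule has_vector_derivative_transform_within_open[where S = "- {0}"]) (use y eq in auto)
    qed
    show "norm (integral {-L..L} (\<lambda>y. osc lam y * phase_step (g i) y)) \<le>
        2 * (4 * A + (B + 2 * A)) * lam powr (-1/2)"
    proof (rule van_der_Corput_full[OF lam L _ D])
      show "continuous_on UNIV (phase_step (g i))"
        by (rule ucd_continuous[OF ucd_phase_step[OF g] i])
      fix y :: real assume y: "y \<noteq> 0"
      have "\<bar>y\<bar> * norm ((1 / y) *\<^sub>R (?g2 y - 2 *\<^sub>R phase_step (g i) y)) = norm (?g2 y - 2 *\<^sub>R phase_step (g i) y)"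
        using y by simp
      also have "\<dots> \<le> B + 2 * A"
        using A B i by (intro order_trans[OF norm_triangle_ineq4] add_mono) auto
      finally show "\<bar>y\<bar> * norm ((1 / y) *\<^sub>R (?g2 y - 2 *\<^sub>R phase_step (g i) y)) \<le> B + 2 * A" .
    qed (use A i in auto)
  qed (use A B in auto)
qed

lemma ucd_phase_step_iterate:
  "ucd UNIV {} I (2 * k + m) g \<Longrightarrow> ucd UNIV {} I m (\<lambda>i. (phase_step ^^ k) (g i))"
proof (induction k arbitrary: m)
  case (Suc k)
  then have "ucd UNIV {} I (Suc (Suc m)) (\<lambda>i. (phase_step ^^ k) (g i))" by simp
  from ucd_phase_step[OF this] show ?case by simp
qed simp

text \<open>The induction peels off the first term and applies the hypothesis to the family
  \<open>T g\<close>; the factor \<open>i / lam\<close> has modulus \<open>1 / lam\<close>, so the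
  same \<open>C\<close> serves all \<open>K\<close> steps. Of the \<open>2 * K + 2\<close>
  derivatives, two are spent on each of the \<open>K\<close> steps and two on the final bound, which
  contributes \<open>1 / lam\<close> from one more step and \<open>lam powr (-1/2)\<close> from van
  der Corput.\<close>

lemma stationary_phase_expansion:
  assumes "ucd UNIV {} I (2 * K + 2) g"
  shows "\<exists>C\<ge>0. \<forall>i\<in>I. \<forall>lam>0. \<forall>J.
    ((\<lambda>L. integral {-L..L} (\<lambda>y. osc lam y * g i y)) \<longlongrightarrow> J) at_top \<longrightarrow>
    norm (J - gauss_const lam * (\<Sum>k\<le>K. (\<i> / of_real lam) ^ k * (phase_step ^^ k) (g i) 0))
      \<le> C * lam powr (- real K - 3/2)"
  using assms
proof (induction K arbitrary: g)
  case 0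
  then have g: "ucd UNIV {} I (Suc (Suc 0)) g" by (simp add: numeral_2_eq_2)
  obtain C where C: "C \<ge> 0" "\<And>i lam L. i \<in> I \<Longrightarrow> lam > 0 \<Longrightarrow> L \<ge> 0 \<Longrightarrow>
    norm (integral {-L..L} (\<lambda>y. osc lam y * phase_step (g i) y)) \<le> C * lam powr (-1/2)"
    by (rule phase_step_bound[OF g]) blast
  show ?case
  proof (intro exI[of _ C] conjI C(1) ballI allI impI)
    fix i lam J
    assume i: "i \<in> I" and lam: "(0::real) < lam"
      and J: "((\<lambda>L. integral {-L..L} (\<lambda>y. osc lam y * g i y)) \<longlongrightarrow> J) at_top"
    obtain J' where J': "((\<lambda>L. integral {-L..L} (\<lambda>y. osc lam y * phase_step (g i) y)) \<longlongrightarrow> J') at_top"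
      "J = g i 0 * gauss_const lam + \<i> / of_real lam * J'"
      by (rule phase_step_limit[OF g i lam J])
    have "norm J' \<le> C * lam powr (-1/2)"
    proof (rule Lim_norm_ubound[OF _ J'(1)])
      show "eventually (\<lambda>L. norm (integral {-L..L} (\<lambda>y. osc lam y * phase_step (g i) y)) \<le> C * lam powr (-1/2)) at_top"
        using eventually_ge_at_top[of 0] by eventually_elim (rule C(2)[OF i lam])
    qed simp
    then have "norm J' / lam \<le> C * (lam powr (-1/2) / lam)"
      using lam by (simp add: divide_right_mono)
    also have "lam powr (-1/2) / lam = lam powr (- real 0 - 3/2)"
      using powr_diff[of lam "-1/2" 1] lam by simp
    finally show "norm (J - gauss_const lam * (\<Sum>k\<le>0. (\<i> / of_real lam) ^ k * (phase_step ^^ k) (g i) 0))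
      \<le> C * lam powr (- real 0 - 3/2)"
      using lam by (simp add: J'(2) norm_mult norm_divide)
  qed
next
  case (Suc K)
  have g: "ucd UNIV {} I (Suc (Suc (2 * K + 2))) g" using Suc.prems by simp
  obtain C where C: "C \<ge> 0" "\<forall>i\<in>I. \<forall>lam>0. \<forall>J.
    ((\<lambda>L. integral {-L..L} (\<lambda>y. osc lam y * phase_step (g i) y)) \<longlongrightarrow> J) at_top \<longrightarrow>
    norm (J - gauss_const lam * (\<Sum>k\<le>K. (\<i> / of_real lam) ^ k * (phase_step ^^ k) (phase_step (g i)) 0))
      \<le> C * lam powr (- real K - 3/2)"
    using Suc.IH[OF ucd_phase_step[OF g]] by blast
  show ?case
  proof (intro exI[of _ C] conjI C(1) ballI allI impI)
    fix i lam J
    assume i: "i \<in> I" and lam: "(0::real) < lam"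
      and J: "((\<lambda>L. integral {-L..L} (\<lambda>y. osc lam y * g i y)) \<longlongrightarrow> J) at_top"
    obtain J' where J': "((\<lambda>L. integral {-L..L} (\<lambda>y. osc lam y * phase_step (g i) y)) \<longlongrightarrow> J') at_top"
      "J = g i 0 * gauss_const lam + \<i> / of_real lam * J'"
      by (rule phase_step_limit[OF g i lam J])
    let ?S = "\<Sum>k\<le>K. (\<i> / of_real lam) ^ k * (phase_step ^^ k) (phase_step (g i)) 0"
    have "norm (J' - gauss_const lam * ?S) \<le> C * lam powr (- real K - 3/2)"
      using C(2) i lam J'(1) by blast
    then have "norm (J' - gauss_const lam * ?S) / lam \<le> C * (lam powr (- real K - 3/2) / lam)"
      using lam by (simp add: divide_right_mono)
    also have "lam powr (- real K - 3/2) / lam = lam powr (- real K - 3/2 - 1)"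
      using powr_diff[of lam "- real K - 3/2" 1] lam by simp
    also have "- real K - 3/2 - 1 = - real (Suc K) - 3/2" by simp
    finally have 1: "norm (\<i> / of_real lam * (J' - gauss_const lam * ?S)) \<le> C * lam powr (- real (Suc K) - 3/2)"
      using lam by (simp add: norm_mult norm_divide)
    have "(\<Sum>k\<le>Suc K. (\<i> / of_real lam) ^ k * (phase_step ^^ k) (g i) 0) = g i 0 + \<i> / of_real lam * ?S"
      unfolding sum.atMost_Suc_shift sum_distrib_left
      by (simp add: funpow_swap1 mult.assoc del: funpow.simps) (simp add: funpow_swap1)
    then have "J - gauss_const lam * (\<Sum>k\<le>Suc K. (\<i> / of_real lam) ^ k * (phase_step ^^ k) (g i) 0)
       = \<i> / of_real lam * (J' - gauss_const lam * ?S)"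
      by (simp add: J'(2) algebra_simps)
    with 1 show "norm (J - gauss_const lam * (\<Sum>k\<le>Suc K. (\<i> / of_real lam) ^ k * (phase_step ^^ k) (g i) 0))
      \<le> C * lam powr (- real (Suc K) - 3/2)"
      by simp
  qed
qed

text \<open>Here \<open>g\<close> is only \<open>C^1\<close>, so \<open>g - g 0\<close> is estimated
  directly on each half-line, without applying \<open>T\<close>. The family has a single member
  because the quantitative information is carried by \<open>A\<close>.\<close>

lemma first_order_Lp_bound:
  assumes lam: "lam > 0" and p: "1 \<le> p" and g: "ucd UNIV {} {()} (Suc 0) (\<lambda>_. g)"
    and A0: "0 \<le> A"
    and A: "\<And>r. 0 < r \<Longrightarrow> integral {-r..r} (\<lambda>y. norm (vderiv g y)) \<le> A * r powr (1 - 1/p)"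
    and J: "((\<lambda>L. integral {-L..L} (\<lambda>y. osc lam y * g y)) \<longlongrightarrow> J) at_top"
  shows "norm (J - gauss_const lam * g 0) \<le> 2 * (4 + 2 * p) * A * lam powr (-1 + 1 / (2 * p))"
proof -
  let ?c = "(4 + 2 * p) * A * lam powr (-1 + 1 / (2 * p))"
  have g1: "(g has_vector_derivative vderiv g y) (at y)" for y using ucd_UNIV_D(1)[OF g] by simp
  have c1: "continuous_on S (vderiv g)" for S
    using ucd_continuous[OF ucd_UNIV_D(2)[OF g]] continuous_on_subset by blast
  have cg: "continuous_on S g" for S
    using ucd_continuous[OF g] continuous_on_subset by blast
  have halves: "integral {0..r} (\<lambda>y. norm (vderiv g y)) \<le> A * r powr (1 - 1/p) \<and>
      integral {0..r} (\<lambda>y. norm (- vderiv g (- y))) \<le> A * r powr (1 - 1/p)" if r: "r > 0" for r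
  proof -
    have "integral {-r..r} (\<lambda>y. norm (vderiv g y)) =
        integral {0..r} (\<lambda>y. norm (vderiv g y)) + integral {0..r} (\<lambda>y. norm (vderiv g (- y)))"
      by (rule integral_even_odd) (use r in \<open>auto intro!: continuous_intros c1\<close>)
    moreover have "integral {0..r} (\<lambda>y. norm (vderiv g y)) \<ge> 0" "integral {0..r} (\<lambda>y. norm (vderiv g (- y))) \<ge> 0"
      by (auto intro!: integral_nonneg integrable_continuous_real continuous_intros c1 continuous_on_compose2[OF c1[of UNIV]])
    ultimately show ?thesis using A[OF r] by simp
  qed
  have bd: "norm (integral {-L..L} (\<lambda>y. osc lam y * g y) - g 0 * integral {-L..L} (osc lam)) \<le> 2 * ?c"
    if L: "L \<ge> 0" for L
  proof -
    have "norm (integral {0..L} (\<lambda>y. osc lam y * (g y - g 0))) \<le> ?c"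
      by (rule van_der_Corput_half_Lp[OF lam L p _ c1 A0])
        (use g1 halves in \<open>auto intro: has_vector_derivative_at_within\<close>)
    moreover have "norm (integral {0..L} (\<lambda>y. osc lam y * (g (- y) - g (- 0)))) \<le> ?c"
    proof (rule van_der_Corput_half_Lp[OF lam L p _ _ A0, where g = "\<lambda>y. g (- y)" and g' = "\<lambda>y. - vderiv g (- y)"])
      show "continuous_on {0..L} (\<lambda>y. - vderiv g (- y))"
        by (intro continuous_intros continuous_on_compose2[OF c1[of UNIV]]) auto
      have "((g \<circ> uminus) has_vector_derivative (- 1) *\<^sub>R vderiv g (- y)) (at y)" for y
        by (intro vector_diff_chain_at g1) (auto intro!: derivative_eq_intros)
      then show "((\<lambda>y. g (- y)) has_vector_derivative - vderiv g (- y)) (at y within {0..L})" for y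
        by (auto simp: o_def intro: has_vector_derivative_at_within)
    qed (use halves in auto)
    moreover have "integral {-L..L} (\<lambda>y. osc lam y * (g y - g 0)) =
      integral {0..L} (\<lambda>y. osc lam y * (g y - g 0)) + integral {0..L} (\<lambda>y. osc lam y * (g (- y) - g 0))"
      by (subst integral_even_odd) (use L in \<open>auto intro!: continuous_intros cg\<close>)
    moreover have "integral {-L..L} (\<lambda>y. osc lam y * (g y - g 0)) =
        integral {-L..L} (\<lambda>y. osc lam y * g y) - g 0 * integral {-L..L} (osc lam)"
    proof -
      have "integral {-L..L} (\<lambda>y. osc lam y * (g y - g 0)) = integral {-L..L} (\<lambda>y. osc lam y * g y - g 0 * osc lam y)"
        by (simp add: algebra_simps)
      also have "\<dots> = integral {-L..L} (\<lambda>y. osc lam y * g y) - integral {-L..L} (\<lambda>y. g 0 * osc lam y)"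
        by (intro Henstock_Kurzweil_Integration.integral_diff integrable_continuous_real continuous_intros cg)
      finally show ?thesis by simp
    qed
    ultimately show ?thesis
      using norm_triangle_ineq[of "integral {0..L} (\<lambda>y. osc lam y * (g y - g 0))" "integral {0..L} (\<lambda>y. osc lam y * (g (- y) - g 0))"]
      by simp
  qed
  have "norm (J - g 0 * gauss_const lam) \<le> 2 * ?c"
  proof (rule Lim_norm_ubound)
    show "((\<lambda>L. integral {-L..L} (\<lambda>y. osc lam y * g y) - g 0 * integral {-L..L} (osc lam)) \<longlongrightarrow> J - g 0 * gauss_const lam) at_top"
      by (intro tendsto_intros J fresnel lam)
    show "eventually (\<lambda>L. norm (integral {-L..L} (\<lambda>y. osc lam y * g y) - g 0 * integral {-L..L} (osc lam)) \<le> 2 * ?c) at_top"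
      using eventually_ge_at_top[of 0] by eventually_elim (rule bd)
  qed simp
  then show ?thesis by (simp only: mult.commute[of "g 0"] mult.assoc)
qed

section \<open>The Morse coordinate\<close>

lemma scale_B1: "x \<in> B1 \<Longrightarrow> s \<in> {0..1} \<Longrightarrow> s * x \<in> B1"
proof -
  assume "x \<in> B1" "s \<in> {0..1}"
  then have "\<bar>s * x\<bar> \<le> 1" unfolding abs_mult by (intro mult_le_one) auto
  then show ?thesis by (auto simp: abs_le_iff)
qed

lemma ray_average_bounds:
  fixes f :: "real \<Rightarrow> real"
  assumes f: "continuous_on B1 f" and x: "x \<in> B1" and ab: "\<And>x. x \<in> B1 \<Longrightarrow> a \<le> f x \<and> f x \<le> b"
  shows "a / (real j + 1) \<le> ray_average j f x \<and> ray_average j f x \<le> b / (real j + 1)"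
proof -
  have scale: "s * x \<in> B1" if "s \<in> {0..1}" for s :: real
    by (rule scale_B1[OF x that])
  have c: "((\<lambda>s. s ^ j *\<^sub>R c) has_integral c / (real j + 1)) {0..1}" for c :: real
  proof -
    have "((\<lambda>s. s ^ j *\<^sub>R c) has_integral (1 ^ Suc j * c / real (Suc j) - 0 ^ Suc j * c / real (Suc j))) {0..1}"
      by (rule fundamental_theorem_of_calculus)
        (auto intro!: derivative_eq_intros simp: has_real_derivative_iff_has_vector_derivative[symmetric] simp del: of_nat_Suc power_Suc)
    then show ?thesis by (simp add: add.commute)
  qed
  have int: "(\<lambda>s. s ^ j *\<^sub>R f (s * x)) integrable_on {0..1}"
    by (intro integrable_continuous_real continuous_intros continuous_on_compose2[OF f]) (use scale in auto)
  have "integral {0..1} (\<lambda>s. s ^ j *\<^sub>R a) \<le> ray_average j f x"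
    unfolding ray_average_def
    by (intro integral_le int) (use c ab scale in \<open>auto intro!: mult_left_mono\<close>)
  moreover have "ray_average j f x \<le> integral {0..1} (\<lambda>s. s ^ j *\<^sub>R b)"
    unfolding ray_average_def
    by (intro integral_le int) (use c ab scale in \<open>auto intro!: mult_left_mono\<close>)
  ultimately show ?thesis by (simp only: integral_unique[OF c])
qed

text \<open>
  Morse coordinate of the phase: \<open>\<phi> = Y\<^sup>2 / 2\<close> with \<open>Y x = x * sqrt (2 * q x)\<close> and
  \<open>q x = \<phi> x / x\<^sup>2\<close>, where \<open>q\<close> is written as an iterated average of \<open>\<phi>''\<close> so that no
  regularity is lost at \<open>0\<close>.
\<close>
lemma phase_coordinate:
  fixes phi phi1 phi2 :: "'i \<Rightarrow> real \<Rightarrow> real"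
  assumes m: "m \<ge> 1"
    and d1: "\<And>i x. i \<in> I \<Longrightarrow> x \<in> B1 \<Longrightarrow> (phi i has_vector_derivative phi1 i x) (at x within B1)"
    and d2: "\<And>i x. i \<in> I \<Longrightarrow> x \<in> B1 \<Longrightarrow> (phi1 i has_vector_derivative phi2 i x) (at x within B1)"
    and u: "ucd B1 {} I m phi2"
    and z: "\<And>i. i \<in> I \<Longrightarrow> phi i 0 = 0" "\<And>i. i \<in> I \<Longrightarrow> phi1 i 0 = 0"
    and b: "\<And>i x. i \<in> I \<Longrightarrow> x \<in> B1 \<Longrightarrow> 1/10 \<le> phi2 i x \<and> phi2 i x \<le> 10"
  obtains Y Y1 where "\<And>k. ucd B1 {} I k phi2 \<Longrightarrow> ucd B1 {} I k Y1"
    and "\<And>i x. i \<in> I \<Longrightarrow> x \<in> B1 \<Longrightarrow> (Y i has_vector_derivative Y1 i x) (at x within B1)"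
    and "\<And>i x. i \<in> I \<Longrightarrow> x \<in> B1 \<Longrightarrow> (Y i x)\<^sup>2 = 2 * phi i x"
    and "\<And>i x. i \<in> I \<Longrightarrow> x \<in> B1 \<Longrightarrow> 1/100 \<le> Y1 i x \<and> Y1 i x \<le> 100"
    and "\<And>i. i \<in> I \<Longrightarrow> Y i 0 = 0"
    and "\<And>i. i \<in> I \<Longrightarrow> Y1 i 0 = sqrt (phi2 i 0)"
    and "\<And>i x. i \<in> I \<Longrightarrow> x \<in> B1 \<Longrightarrow> \<bar>x\<bar> \<le> 4 * \<bar>Y i x\<bar>"
    and "\<And>i x. i \<in> I \<Longrightarrow> x \<in> B1 \<Longrightarrow> \<bar>Y i x\<bar> \<le> 4 * \<bar>x\<bar>"
proof -
  define A where "A i = ray_average 0 (phi2 i)" for i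
  define Q where "Q i = ray_average 1 (A i)" for i
  define H where "H i x = sqrt (2 * Q i x)" for i x
  have S: "convex B1" "0 \<in> B1" by auto
  have uA: "ucd B1 {} I k A" if "ucd B1 {} I k phi2" for k
    unfolding A_def[abs_def] by (rule ucd_ray_average[OF S that])
  have uQ: "ucd B1 {} I k Q" if "ucd B1 {} I k phi2" for k
    unfolding Q_def[abs_def] by (rule ucd_ray_average[OF S uA[OF that]])
  have bA: "1/10 \<le> A i x \<and> A i x \<le> 10" if "i \<in> I" "x \<in> B1" for i x
    using ray_average_bounds[OF ucd_continuous[OF u that(1)] that(2) b[OF that(1)], of 0] by (simp add: A_def)
  have bQ: "1/20 \<le> Q i x \<and> Q i x \<le> 5" if "i \<in> I" "x \<in> B1" for i x
    using ray_average_bounds[OF ucd_continuous[OF uA[OF u] that(1)] that(2) bA[OF that(1)], of 1] by (simp add: Q_def)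
  have uH: "ucd B1 {} I k H" if k: "ucd B1 {} I k phi2" for k
    unfolding H_def[abs_def]
  proof (rule ucd_sqrt[of "1/10"])
    show "ucd B1 {} I k (\<lambda>i x. 2 * Q i x)"
      using ucd_mult[OF ucd_const[of I "\<lambda>_. 2" 2] uQ[OF k]] by simp
    show "1/10 \<le> 2 * Q i x" if "i \<in> I" "x \<in> B1" for i x using bQ[OF that] by simp
  qed simp
  \<comment> \<open>\<open>2 * Q\<close> lies between \<open>1/10\<close> and \<open>10\<close>, the
    weight \<open>s\<close> in \<open>Q\<close> having integral \<open>1/2\<close>; moreover
    \<open>1/16 \<le> 1/10\<close> and \<open>10 \<le> 16\<close>.\<close>
  have bH: "1/4 \<le> H i x \<and> H i x \<le> 4" if "i \<in> I" "x \<in> B1" for i x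
  proof -
    have "sqrt ((1/4)\<^sup>2) \<le> H i x" unfolding H_def
      using bQ[OF that] by (intro real_sqrt_le_mono) (simp add: power2_eq_square)
    moreover have "H i x \<le> sqrt (4\<^sup>2)" unfolding H_def
      using bQ[OF that] by (intro real_sqrt_le_mono) simp
    ultimately show ?thesis by simp
  qed
  have xA: "x * A i x = phi1 i x" if "i \<in> I" "x \<in> B1" for i x
    using ray_average_0_deriv[OF S that(2) d2[OF that(1)]] z(2)[OF that(1)] by (simp add: A_def)
  have xQ: "x\<^sup>2 * Q i x = phi i x" if "i \<in> I" "x \<in> B1" for i x
  proof -
    have scale: "s * x \<in> B1" if "s \<in> {0..1}" for s :: real
      by (rule scale_B1[OF \<open>x \<in> B1\<close> that])
    have "x * ray_average 0 (phi1 i) x = phi i x"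
      using ray_average_0_deriv[OF S that(2) d1[OF that(1)]] z(1)[OF that(1)] by simp
    moreover have "ray_average 0 (phi1 i) x = integral {0..1} (\<lambda>s. x * (s * A i (s * x)))"
      unfolding ray_average_def
    proof (rule integral_cong)
      fix s :: real assume "s \<in> {0..1}"
      then show "s ^ 0 *\<^sub>R phi1 i (s * x) = x * (s * A i (s * x))"
        using xA[OF that(1) scale[of s]] by (simp add: ac_simps)
    qed
    moreover have "integral {0..1} (\<lambda>s. x * (s * A i (s * x))) = x * Q i x"
      by (simp add: Q_def ray_average_def)
    ultimately show ?thesis by (simp only: power2_eq_square mult.assoc)
  qed
  define Y where "Y i x = x * H i x" for i x
  \<comment> \<open>From \<open>Y * Y' = phi'\<close> with \<open>phi' = x * A\<close> and
    \<open>Y = x * H\<close>, the factor \<open>x\<close> cancels. Written as \<open>A / H\<close>,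
    the derivative \<open>Y'\<close> is as smooth as \<open>phi''\<close>; the product rule form
    \<open>H + x * H'\<close> would appear to lose one order.\<close>
  define Y1 where "Y1 i x = A i x * inverse (H i x)" for i x
  have uY1: "ucd B1 {} I k Y1" if k: "ucd B1 {} I k phi2" for k
    unfolding Y1_def[abs_def]
  proof (rule ucd_mult[OF uA[OF k], where Z' = "{}", simplified])
    show "ucd B1 {} I k (\<lambda>i x. inverse (H i x))"
      by (rule ucd_inverse[of "1/4"]) (use bH uH[OF k] in auto)
  qed
  obtain m' where m': "m = Suc m'" using m by (cases m) auto
  obtain Q' where "\<forall>i\<in>I. \<forall>x\<in>B1. (Q i has_vector_derivative Q' i x) (at x within B1)"
    using uQ[OF u] unfolding m' ucd.simps(2) by blast
  then have Q': "(Q i has_vector_derivative Q' i x) (at x within B1)" if "i \<in> I" "x \<in> B1" for i x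
    using that by blast
  \<comment> \<open>Away from \<open>0\<close> this compares two expressions for the derivative of
    \<open>phi = x^2 * Q\<close>; at \<open>0\<close> it is the integral of \<open>s\<close> over
    the unit interval. Differentiating \<open>Q\<close> is what uses
    \<open>m \<ge> 1\<close>.\<close>
  have AQ: "A i x = 2 * Q i x + x * Q' i x" if i: "i \<in> I" and x: "x \<in> B1" for i x
  proof (cases "x = 0")
    case True
    have "Q i 0 = integral {0..1} (\<lambda>s. s ^ 1 *\<^sub>R A i 0)" by (simp add: Q_def ray_average_def)
    also have "\<dots> = A i 0 / 2"
      using ident_has_integral[of 0 "1::real"] by (simp add: integral_unique)
    finally show ?thesis using True by simp
  next
    case False
    have "((\<lambda>x. x\<^sup>2 * Q i x) has_vector_derivative x\<^sup>2 * Q' i x + (2 * x) * Q i x) (at x within B1)"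
      by (intro has_vector_derivative_mult Q' i x)
        (auto intro!: derivative_eq_intros simp: has_real_derivative_iff_has_vector_derivative[symmetric])
    then have "(phi i has_vector_derivative x\<^sup>2 * Q' i x + (2 * x) * Q i x) (at x within B1)"
      by (rule has_vector_derivative_transform[rotated 2]) (use xQ[OF i] x in auto)
    then have "x\<^sup>2 * Q' i x + (2 * x) * Q i x = phi1 i x"
      using vector_derivative_unique_within_closed_interval[of "-1" 1 x] d1[OF i x] x by fastforce
    also have "\<dots> = x * A i x" using xA[OF i x] by simp
    finally have "x * (x * Q' i x + 2 * Q i x) = x * A i x" by (simp add: power2_eq_square algebra_simps)
    then show ?thesis using False by simp
  qed
  show ?thesis
  proof (rule that[of Y1 Y])
    fix i x assume i: "i \<in> I" and x: "x \<in> B1"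
    have H0: "H i x > 0" and Q0: "Q i x > 0" using bH[OF i x] bQ[OF i x] by auto
    have H2: "H i x * H i x = 2 * Q i x" unfolding H_def using Q0 by simp
    have "(H i has_real_derivative inverse (H i x) * Q' i x) (at x within B1)"
      unfolding H_def using Q'[OF i x] Q0
      by (auto intro!: derivative_eq_intros simp: has_real_derivative_iff_has_vector_derivative[symmetric] field_simps)
    then have "(Y i has_real_derivative x * (inverse (H i x) * Q' i x) + H i x) (at x within B1)"
      unfolding Y_def by (auto intro!: derivative_eq_intros)
    moreover have "x * (inverse (H i x) * Q' i x) + H i x = Y1 i x"
      unfolding Y1_def AQ[OF i x] H2[symmetric] using H0 by (simp add: field_simps)
    ultimately show "(Y i has_vector_derivative Y1 i x) (at x within B1)"
      by (simp add: has_real_derivative_iff_has_vector_derivative)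
    show "(Y i x)\<^sup>2 = 2 * phi i x"
      unfolding Y_def xQ[OF i x, symmetric] power_mult_distrib using H2 by (simp add: power2_eq_square)
    have "(1/10) * inverse 4 \<le> A i x * inverse (H i x)"
      using bA[OF i x] bH[OF i x] by (intro mult_mono le_imp_inverse_le) auto
    moreover have "A i x * inverse (H i x) \<le> 10 * inverse (1/4)"
      using bA[OF i x] bH[OF i x] by (intro mult_mono le_imp_inverse_le) auto
    ultimately show "1/100 \<le> Y1 i x \<and> Y1 i x \<le> 100" by (simp add: Y1_def)
    have "\<bar>x\<bar> * (1/4) \<le> \<bar>x\<bar> * H i x" "\<bar>x\<bar> * H i x \<le> \<bar>x\<bar> * 4"
      using bH[OF i x] by (intro mult_left_mono, auto)+
    then show "\<bar>x\<bar> \<le> 4 * \<bar>Y i x\<bar>" "\<bar>Y i x\<bar> \<le> 4 * \<bar>x\<bar>" using H0 by (auto simp: Y_def abs_mult)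
  next
    fix i assume i: "i \<in> I"
    have "A i 0 = phi2 i 0" by (simp add: A_def ray_average_def)
    moreover have "A i 0 = 2 * Q i 0" using AQ[OF i S(2)] by simp
    moreover have "A i 0 > 0" using bA[OF i S(2)] by simp
    ultimately show "Y1 i 0 = sqrt (phi2 i 0)"
      by (simp add: Y1_def H_def divide_inverse[symmetric] real_div_sqrt)
  qed (use uY1 in \<open>auto simp: Y_def\<close>)
qed

section \<open>Extension of the Morse coordinate to the whole line\<close>

definition clamp1 :: "real \<Rightarrow> real"
  where "clamp1 x = max (-1) (min 1 x)"

lemma clamp1_simps: "clamp1 x \<in> B1" "x \<in> B1 \<Longrightarrow> clamp1 x = x"
  by (auto simp: clamp1_def)

text \<open>Beyond \<open>B1\<close> the slope is frozen at its end value, making \<open>F\<close> a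
  bijection of the line that extends \<open>Y\<close>, with inverse \<open>X\<close>. One-sided
  derivatives at the end points thereby disappear. The extension is otherwise harmless, since
  everything transported along \<open>X\<close> vanishes outside \<open>B1\<close>.\<close>

definition line_coordinate :: "(real \<Rightarrow> real) \<Rightarrow> (real \<Rightarrow> real) \<Rightarrow> (real \<Rightarrow> real) \<Rightarrow> bool"
  where "line_coordinate Y1 F X \<longleftrightarrow>
    (\<forall>x. (F has_real_derivative Y1 (clamp1 x)) (at x)) \<and> F 0 = 0 \<and> (\<forall>y. F (X y) = y) \<and> (\<forall>x. X (F x) = x) \<and>
    (\<forall>y. (X has_real_derivative inverse (Y1 (clamp1 (X y)))) (at y)) \<and> (\<forall>y. \<bar>X y\<bar> \<le> 100 * \<bar>y\<bar>)"

lemma antiderivative_UNIV: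
  fixes f :: "real \<Rightarrow> 'a::euclidean_space"
  assumes "continuous_on UNIV f"
  obtains F where "\<And>x. (F has_vector_derivative f x) (at x)"
proof -
  have "\<exists>F. \<forall>x :: real. (-\<infinity>::ereal) < x \<longrightarrow> x < (\<infinity>::ereal) \<longrightarrow> (F has_vector_derivative f x) (at x)"
    by (rule einterval_antiderivative) (use assms in \<open>auto simp: continuous_on_eq_continuous_at\<close>)
  then show ?thesis using that by auto
qed

text \<open>A slope of at least \<open>1/100\<close> means that \<open>F\<close> expands distances
  at least by that factor. Injectivity, the Lipschitz bound \<open>100\<close> for the inverse, and
  surjectivity by the intermediate value theorem on \<open>[-100 |y|, 100 |y|]\<close> all
  follow.\<close>

lemma line_coordinate_exists:
  assumes Y1: "continuous_on B1 Y1" and b: "\<And>x. x \<in> B1 \<Longrightarrow> 1/100 \<le> Y1 x"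
  shows "\<exists>F X. line_coordinate Y1 F X"
proof -
  let ?c = "\<lambda>x. Y1 (clamp1 x)"
  have "continuous_on UNIV clamp1" unfolding clamp1_def by (intro continuous_intros)
  then have "continuous_on UNIV ?c"
    by (rule continuous_on_compose2[OF Y1]) (auto simp: clamp1_def)
  from antiderivative_UNIV[OF this] obtain F0 where F0: "\<And>x. (F0 has_vector_derivative ?c x) (at x)" by blast
  define F where "F x = F0 x - F0 0" for x
  have F: "(F has_real_derivative ?c x) (at x)" for x
    unfolding F_def has_real_derivative_iff_has_vector_derivative
    using has_vector_derivative_diff[OF F0[of x] has_vector_derivative_const] by fastforce
  have Fz: "F 0 = 0" by (simp add: F_def)
  have c: "1/100 \<le> ?c x" for x using b clamp1_simps(1) by blast
  have grow: "(z - x) / 100 \<le> F z - F x" if "x \<le> z" for x z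
  proof -
    have "F x - x / 100 \<le> F z - z / 100"
    proof (rule DERIV_nonneg_imp_nondecreasing[OF that])
      fix w
      have "((\<lambda>x. F x - x / 100) has_real_derivative ?c w - 1/100) (at w)"
        by (auto intro!: derivative_eq_intros F)
      then show "\<exists>y. ((\<lambda>x. F x - x / 100) has_real_derivative y) (at w) \<and> 0 \<le> y"
        using c[of w] by (intro exI[of _ "?c w - 1/100"]) auto
    qed
    then show ?thesis by (simp add: diff_divide_distrib)
  qed
  have grow': "\<bar>z - x\<bar> \<le> 100 * \<bar>F z - F x\<bar>" for x z
    using grow[of x z] grow[of z x] by (cases "x \<le> z") (auto simp: field_simps abs_if split: if_splits)
  have contF: "continuous_on S F" for S
    using F by (auto intro!: continuous_at_imp_continuous_on DERIV_isCont)
  have surj: "\<exists>x. F x = y" for y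
  proof -
    let ?a = "100 * \<bar>y\<bar>"
    have "\<exists>x\<ge>-?a. x \<le> ?a \<and> F x = y"
    proof (rule IVT')
      show "F (- ?a) \<le> y" using grow[of "-?a" 0] Fz by (simp add: abs_if split: if_splits)
      show "y \<le> F ?a" using grow[of 0 ?a] Fz by (simp add: abs_if split: if_splits)
    qed (use contF in auto)
    then show ?thesis by blast
  qed
  define X where "X y = (SOME x. F x = y)" for y
  have FX: "F (X y) = y" for y unfolding X_def by (rule someI_ex[OF surj])
  have XF: "X (F x) = x" for x using grow'[of "X (F x)" x] by (simp add: FX)
  have lip: "\<bar>X y - X z\<bar> \<le> 100 * \<bar>y - z\<bar>" for y z using grow'[of "X y" "X z"] by (simp add: FX)
  have X0: "X 0 = 0" using XF[of 0] Fz by simp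
  have "isCont X y" for y
  proof -
    have "((\<lambda>z. X z - X y) \<longlongrightarrow> 0) (at y)"
    proof (rule Lim_null_comparison)
      show "eventually (\<lambda>z. norm (X z - X y) \<le> 100 * \<bar>z - y\<bar>) (at y)" using lip by simp
      have "((\<lambda>z. 100 * \<bar>z - y\<bar>) \<longlongrightarrow> 100 * \<bar>y - y\<bar>) (at y)" by (intro tendsto_intros)
      then show "((\<lambda>z. 100 * \<bar>z - y\<bar>) \<longlongrightarrow> 0) (at y)" by simp
    qed
    then show ?thesis by (simp add: isCont_def LIM_zero_iff)
  qed
  then have "(X has_real_derivative inverse (?c (X y))) (at y)" for y
    using c[of "X y"] by (intro DERIV_inverse_function[where f = F and a = "y - 1" and b = "y + 1"] F) (auto simp: FX)
  moreover have "\<bar>X y\<bar> \<le> 100 * \<bar>y\<bar>" for y using lip[of y 0] X0 by simp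
  ultimately show ?thesis unfolding line_coordinate_def using F Fz FX XF by blast
qed

section \<open>Extension by zero and transport to the line\<close>

definition zero_extension :: "(real \<Rightarrow> 'a::zero) \<Rightarrow> real \<Rightarrow> 'a"
  where "zero_extension p x = (if x \<in> B1 then p x else 0)"

lemma closure_minus_B1: "B1 \<inter> closure (- B1) = {-1, 1}"
proof -
  have "- B1 = {..<-1} \<union> {1::real<..}" by auto
  then have "closure (- B1) = {..-1} \<union> {1..}"
    by (simp only: closure_Un closure_lessThan closure_greaterThan)
  then show ?thesis by (simp only:) force
qed

text \<open>The closures of \<open>B1\<close> and of its complement meet only in \<open>-1\<close>
  and \<open>1\<close>, where the values and derivatives of \<open>p\<close> match those of the zero
  function.\<close>

lemma zero_extension_derivative:
  fixes p :: "real \<Rightarrow> 'a::real_normed_vector"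
  assumes p: "\<And>x. x \<in> B1 \<Longrightarrow> (p has_vector_derivative p' x) (at x within B1)"
    and z: "p (-1) = 0" "p 1 = 0" "p' (-1) = 0" "p' 1 = 0"
  shows "(zero_extension p has_vector_derivative zero_extension p' x) (at x)"
proof -
  have e: "closure B1 \<inter> closure (- B1) = {-1, 1}" "B1 \<union> {-1, 1} = B1" 
    using closure_minus_B1 by auto
  have "((\<lambda>x. if x \<in> B1 then p x else 0) has_vector_derivative (if x \<in> B1 then p' x else 0)) (at x within UNIV)"
  proof (rule has_vector_derivative_If_within_closures[where S = B1 and T = "- B1" and f' = p' and g' = "\<lambda>_. 0", unfolded e])
    assume "x \<in> closure B1" "x \<in> closure (- B1)"
    then have "x \<in> {-1, 1}" unfolding e(1)[symmetric] by blast
    then show "p x = 0" "p' x = 0" using z by auto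
  qed (use p in auto)
  then show ?thesis by (simp add: zero_extension_def[abs_def] zero_extension_def)
qed

lemma zero_extension_continuous:
  fixes p :: "real \<Rightarrow> 'a::real_normed_vector"
  assumes p: "continuous_on B1 p" and z: "p (-1) = 0" "p 1 = 0"
  shows "continuous_on UNIV (zero_extension p)"
proof -
  have "continuous_on (B1 \<union> closure (- B1)) (\<lambda>x. if x \<in> B1 then p x else 0)"
  proof (rule continuous_on_If)
    fix x assume "x \<in> closure (- B1)" and x: "x \<in> B1"
    then have "x \<in> {-1, 1}" using closure_minus_B1 by blast
    then show "p x = 0" using z by auto
  qed (use p in auto)
  moreover have "B1 \<union> closure (- B1) = UNIV" using closure_subset by blast
  ultimately show ?thesis by (simp add: zero_extension_def[abs_def])
qed

lemma line_pullback_derivative: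
  fixes p :: "real \<Rightarrow> 'a::real_normed_vector"
  assumes lc: "line_coordinate Y1 F X"
    and p: "\<And>x. x \<in> B1 \<Longrightarrow> (p has_vector_derivative p' x) (at x within B1)"
    and z: "p (-1) = 0" "p 1 = 0" "p' (-1) = 0" "p' 1 = 0"
  shows "((\<lambda>y. zero_extension p (X y)) has_vector_derivative
    zero_extension (\<lambda>x. inverse (Y1 x) *\<^sub>R p' x) (X y)) (at y)"
proof -
  have "((zero_extension p \<circ> X) has_vector_derivative
      inverse (Y1 (clamp1 (X y))) *\<^sub>R zero_extension p' (X y)) (at y)"
    using lc zero_extension_derivative[OF p z, of "X y"]
    by (intro vector_diff_chain_at)
      (auto simp: line_coordinate_def has_real_derivative_iff_has_vector_derivative)
  moreover have "inverse (Y1 (clamp1 (X y))) *\<^sub>R zero_extension p' (X y) =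
      zero_extension (\<lambda>x. inverse (Y1 x) *\<^sub>R p' x) (X y)"
    using clamp1_simps(2)[of "X y"] by (auto simp: zero_extension_def)
  ultimately show ?thesis by (simp add: o_def)
qed

text \<open>This is where the zero set \<open>{-1, 1}\<close> in \<open>ucd\<close> pays off:
  \<open>p' / Y1\<close> again vanishes there with its derivatives, so the extension by zero remains
  smooth at every order of the induction.\<close>

lemma ucd_line_pullback:
  fixes p :: "'i \<Rightarrow> real \<Rightarrow> 'a::real_normed_vector"
  assumes lc: "\<And>i. i \<in> I \<Longrightarrow> line_coordinate (Y1 i) (F i) (X i)"
    and Y1: "ucd B1 {} I m Y1" and b: "\<And>i x. i \<in> I \<Longrightarrow> x \<in> B1 \<Longrightarrow> 1/100 \<le> Y1 i x"
    and p: "ucd B1 {-1, 1} I m p"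
  shows "ucd UNIV {} I m (\<lambda>i y. zero_extension (p i) (X i y))"
proof -
  have bd: "\<exists>M. \<forall>i\<in>I. \<forall>y. norm (zero_extension (p i) (X i y)) \<le> M" if u: "ucd B1 {-1, 1} I k p" for k p
  proof -
    obtain M where "M \<ge> 0" "\<forall>i\<in>I. \<forall>x\<in>B1. norm (p i x) \<le> M" by (rule ucd_bound[OF u])
    then show ?thesis by (intro exI[of _ M]) (auto simp: zero_extension_def)
  qed
  have X': "(X i has_real_derivative inverse (Y1 i (clamp1 (X i y)))) (at y)" if "i \<in> I" for i y
    using lc[OF that] by (auto simp: line_coordinate_def)
  have contX: "continuous_on UNIV (X i)" if "i \<in> I" for i
    using X'[OF that] by (auto intro!: continuous_at_imp_continuous_on DERIV_isCont)
  show ?thesis using p Y1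
  proof (induction m arbitrary: p)
    case 0
    have "continuous_on UNIV (\<lambda>y. zero_extension (p i) (X i y))" if i: "i \<in> I" for i
      by (rule continuous_on_compose2[OF zero_extension_continuous contX[OF i]])
        (use ucd_continuous[OF 0(1) i] ucd_zero[OF 0(1) i] in auto)
    with bd[OF 0(1)] show ?case by simp
  next
    case (Suc m)
    obtain M where M: "\<forall>i\<in>I. \<forall>y. norm (zero_extension (p i) (X i y)) \<le> M" using bd[OF Suc.prems(1)] by blast
    obtain p' where p': "\<forall>i\<in>I. \<forall>x\<in>B1. (p i has_vector_derivative p' i x) (at x within B1)"
      "ucd B1 {-1, 1} I m p'" using Suc.prems(1) by (auto simp: ucd.simps(2))
    have Y1m: "ucd B1 {} I m Y1" by (rule ucd_Suc_imp[OF Suc.prems(2)])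
    have "ucd B1 {} I m (\<lambda>i x. inverse (Y1 i x))"
      by (rule ucd_inverse[of "1/100"]) (use b Y1m in auto)
    then have q: "ucd B1 {-1, 1} I m (\<lambda>i x. inverse (Y1 i x) *\<^sub>R p' i x)"
      using ucd_scaleR[OF _ p'(2), where Z = "{}"] by simp
    have D: "((\<lambda>y. zero_extension (p i) (X i y)) has_vector_derivative
        zero_extension (\<lambda>x. inverse (Y1 i x) *\<^sub>R p' i x) (X i y)) (at y)" if i: "i \<in> I" for i y
      by (rule line_pullback_derivative[OF lc[OF i]])
        (use p' i ucd_zero[OF Suc.prems(1) i] ucd_zero[OF p'(2) i] in auto)
    show ?case
      by (rule ucd_SucI[where f' = "\<lambda>i y. zero_extension (\<lambda>x. inverse (Y1 i x) *\<^sub>R p' i x) (X i y)" and M = M])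
        (use M D Suc.IH[OF q Y1m] in auto)
  qed
qed

lemma line_coordinate_eq:
  assumes lc: "line_coordinate Y1 F X"
    and Y: "\<And>x. x \<in> B1 \<Longrightarrow> (Y has_vector_derivative Y1 x) (at x within B1)" "Y 0 = 0" and x: "x \<in> B1"
  shows "F x = Y x"
proof -
  have "((\<lambda>x. F x - Y x) has_vector_derivative 0) (at x within B1)" if "x \<in> B1" for x
  proof -
    have "(F has_vector_derivative Y1 (clamp1 x)) (at x)"
      using lc by (auto simp: line_coordinate_def has_real_derivative_iff_has_vector_derivative)
    then have "(F has_vector_derivative Y1 x) (at x within B1)"
      unfolding clamp1_simps(2)[OF that] by (rule has_vector_derivative_at_within)
    from has_vector_derivative_diff[OF this Y(1)[OF that]] show ?thesis by simp
  qed
  then obtain c where c: "\<And>x. x \<in> B1 \<Longrightarrow> F x - Y x = c"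
    using has_vector_derivative_zero_constant[of B1 "\<lambda>x. F x - Y x"] by auto
  have "c = 0" using c[of 0] Y(2) lc by (simp add: line_coordinate_def)
  then show ?thesis using c[OF x] by simp
qed

text \<open>The substitution \<open>y = Y x\<close> is carried out on primitives: if
  \<open>P\<close> is a primitive of the integrand on the line, then \<open>P o Y\<close> is one for
  \<open>cis (lam * phi) * psi\<close> on \<open>B1\<close>. As the integrand vanishes outside
  \<open>[F (-1), F 1]\<close>, the integrals are constant for large \<open>L\<close>.\<close>

lemma osc_integral_line:
  assumes lc: "line_coordinate Y1 F X"
    and Y: "\<And>x. x \<in> B1 \<Longrightarrow> (Y has_vector_derivative Y1 x) (at x within B1)" "Y 0 = 0"
    and b: "\<And>x. x \<in> B1 \<Longrightarrow> 1/100 \<le> Y1 x"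
    and sq: "\<And>x. x \<in> B1 \<Longrightarrow> (Y x)\<^sup>2 = 2 * phi x"
    and G: "continuous_on UNIV (\<lambda>y. zero_extension (\<lambda>x. inverse (Y1 x) *\<^sub>R psi x) (X y))"
  shows "((\<lambda>L. integral {-L..L} (\<lambda>y. osc lam y * zero_extension (\<lambda>x. inverse (Y1 x) *\<^sub>R psi x) (X y)))
    \<longlongrightarrow> integral B1 (\<lambda>x. cis (lam * phi x) * psi x)) at_top"
proof -
  let ?G = "\<lambda>y. zero_extension (\<lambda>x. inverse (Y1 x) *\<^sub>R psi x) (X y)"
  have FY: "F x = Y x" if "x \<in> B1" for x by (rule line_coordinate_eq[OF lc Y that])
  have XF: "X (F x) = x" and FX: "F (X y) = y" for x y using lc by (auto simp: line_coordinate_def)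
  have mono: "F x \<le> F z" if "x \<le> z" for x z
  proof (rule DERIV_nonneg_imp_nondecreasing[OF that])
    fix w
    show "\<exists>y. (F has_real_derivative y) (at w) \<and> 0 \<le> y"
      using lc order_trans[OF _ b[OF clamp1_simps(1)[of w]], of 0]
      by (intro exI[of _ "Y1 (clamp1 w)"]) (auto simp: line_coordinate_def)
  qed
  have ab: "F (-1) \<le> 0" "0 \<le> F 1" using mono[of "-1" 0] mono[of 0 1] lc by (auto simp: line_coordinate_def)
  have out: "?G y = 0" if "y \<notin> {F (-1)..F 1}" for y
  proof -
    have "X y \<notin> B1"
      using mono[of "-1" "X y"] mono[of "X y" 1] FX[of y] that by auto
    then show ?thesis unfolding zero_extension_def by (rule if_not_P)
  qed
  have "continuous_on UNIV (\<lambda>y. osc lam y * ?G y)" by (intro continuous_intros G)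
  then obtain P where P: "\<And>y. (P has_vector_derivative osc lam y * ?G y) (at y)"
    using antiderivative_UNIV by blast
  have 1: "((\<lambda>y. osc lam y * ?G y) has_integral (P (F 1) - P (F (-1)))) {F (-1)..F 1}"
    by (rule fundamental_theorem_of_calculus) (use ab P in \<open>auto intro: has_vector_derivative_at_within\<close>)
  have 2: "((\<lambda>x. cis (lam * phi x) * psi x) has_integral (P (Y 1) - P (Y (-1)))) B1"
  proof -
    have "((\<lambda>x. cis (lam * phi x) * psi x) has_integral ((P \<circ> Y) 1 - (P \<circ> Y) (-1))) {-1..1}"
    proof (rule fundamental_theorem_of_calculus)
      fix x :: real assume x: "x \<in> {-1..1}"
      have "((P \<circ> Y) has_vector_derivative Y1 x *\<^sub>R (osc lam (Y x) * ?G (Y x))) (at x within B1)"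
        by (rule vector_diff_chain_within[OF Y(1)[OF x]]) (use P in \<open>auto intro: has_vector_derivative_at_within\<close>)
      moreover have "?G (Y x) = inverse (Y1 x) *\<^sub>R psi x"
        using XF[of x] FY[OF x] x by (simp add: zero_extension_def)
      moreover have "osc lam (Y x) = cis (lam * phi x)" using sq[OF x] by (simp add: osc_def)
      moreover have "Y1 x \<noteq> 0" using b[OF x] by auto
      ultimately show "((P \<circ> Y) has_vector_derivative cis (lam * phi x) * psi x) (at x within {-1..1})"
        by simp
    qed simp
    then show ?thesis by simp
  qed
  have eq: "integral {-L..L} (\<lambda>y. osc lam y * ?G y) = integral B1 (\<lambda>x. cis (lam * phi x) * psi x)"
    if "L \<ge> max (- F (-1)) (F 1)" for L
  proof -
    have "((\<lambda>y. osc lam y * ?G y) has_integral (P (F 1) - P (F (-1)))) {-L..L}"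
      by (rule has_integral_on_superset[OF 1]) (use out that in auto)
    then show ?thesis using 2 FY[of 1] FY[of "-1"] by (simp add: integral_unique)
  qed
  show ?thesis
    by (rule tendsto_eventually)
      (use eventually_ge_at_top[of "max (- F (-1)) (F 1)"] in eventually_elim, rule eq)
qed

section \<open>Norms and the second derivative of the coordinate\<close>

text \<open>For continuous \<open>f\<close> the essential supremum bounds every value: if one value
  exceeded it, so would the values on a relatively open part of \<open>B1\<close>, which is not a
  null set.\<close>

lemma norm_le_Linf_norm:
  fixes f :: "real \<Rightarrow> 'a::euclidean_space"
  assumes f: "continuous_on B1 f" and x: "x \<in> B1"
  shows "norm (f x) \<le> Linf_norm f"
proof -
  let ?M = "lebesgue_on B1"
  let ?u = "\<lambda>x. ereal (norm (f x))"
  define e where "e = esssup ?M ?u"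
  have meas: "?u \<in> borel_measurable ?M"
  proof -
    have "f \<in> borel_measurable ?M" by (rule continuous_imp_measurable_on_sets_lebesgue[OF f]) auto
    then show ?thesis by measurable
  qed
  have pt: "?u y \<le> e" if y: "y \<in> B1" for y
  proof (rule ccontr)
    assume "\<not> ?u y \<le> e"
    then have "e < ?u y" by simp
    then obtain c where c: "e < ereal c" "ereal c < ?u y" using ereal_dense2 by blast
    have "AE z in ?M. ?u z \<le> e" unfolding e_def by (rule esssup_AE)
    then have "AE z in ?M. norm (f z) \<le> c"
      using c(1) by (auto elim!: eventually_mono dest: order_trans[of _ e "ereal c"])
    then have "AE z in lebesgue. z \<in> B1 \<longrightarrow> norm (f z) \<le> c"
      by (subst (asm) AE_restrict_space_iff) auto
    then have neg: "negligible {z. \<not> (z \<in> B1 \<longrightarrow> norm (f z) \<le> c)}"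
      unfolding eventually_ae_filter_negligible using negligible_subset by blast
    have "openin (top_of_set B1) (B1 \<inter> (\<lambda>z. norm (f z)) -` {c<..})"
      using f by (intro continuous_openin_preimage_gen) (auto intro!: continuous_intros)
    then obtain U where U: "open U" "B1 \<inter> (\<lambda>z. norm (f z)) -` {c<..} = B1 \<inter> U"
      by (auto simp: openin_open)
    have "y \<in> B1 \<inter> (\<lambda>z. norm (f z)) -` {c<..}" using c(2) y by simp
    then have "y \<in> U" unfolding U(2) by blast
    \<comment> \<open>The point \<open>y\<close> may be an end point, so the open set is moved into
      the open interval by density.\<close>
    moreover have "y \<in> closure {-1<..<1}" using y by simp
    ultimately have ne: "U \<inter> {-1<..<1} \<noteq> {}"
      using U(1) open_Int_closure_eq_empty[of U "{-1<..<1}"] by blast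
    have "open (U \<inter> {-1<..<1})" using U(1) by auto
    with ne have "\<not> negligible (U \<inter> {-1<..<1})" using open_not_negligible by blast
    moreover have "U \<inter> {-1<..<1} \<subseteq> {z. \<not> (z \<in> B1 \<longrightarrow> norm (f z) \<le> c)}"
    proof
      fix z assume "z \<in> U \<inter> {-1<..<1}"
      then have "z \<in> B1 \<inter> U" by auto
      then show "z \<in> {z. \<not> (z \<in> B1 \<longrightarrow> norm (f z) \<le> c)}" unfolding U(2)[symmetric] by auto
    qed
    ultimately show False using neg negligible_subset by blast
  qed
  \<comment> \<open>Since \<open>real_of_ereal\<close> sends both infinities to \<open>0\<close>,
    the essential supremum must be shown finite before passing to reals.\<close>
  have "compact (f ` B1)" by (intro compact_continuous_image f) auto
  then have "bounded (f ` B1)" by (rule compact_imp_bounded)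
  then obtain B where "\<forall>v\<in>f ` B1. norm v \<le> B" unfolding bounded_iff ..
  then have B: "norm (f z) \<le> B" if "z \<in> B1" for z using that by blast
  have "e \<le> ereal B" unfolding e_def
    by (rule esssup_I[OF meas]) (use B in \<open>auto intro!: AE_I2\<close>)
  moreover have "ereal 0 \<le> e"
    by (rule order_trans[OF _ pt[OF x]]) simp
  ultimately obtain q where "e = ereal q" by (cases e) auto
  then show ?thesis using pt[OF x] by (simp add: Linf_norm_def e_def[symmetric])
qed

text \<open>Hoelder's inequality on an interval of length \<open>2 * s\<close>, with constant
  \<open>3\<close> in place of \<open>2 powr (1 - 1/p)\<close>; this form needs only an elementary
  pointwise inequality.\<close>

lemma Lp_norm_interval_bound:
  fixes f :: "real \<Rightarrow> real"
  assumes f: "continuous_on B1 f" and p: "p \<ge> 1" and s: "0 < s" "s \<le> 1"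
  shows "integral {-s..s} (\<lambda>x. \<bar>f x\<bar>) \<le> 3 * s powr (1 - 1/p) * Lp_norm p f"
proof -
  define Ip where "Ip = integral B1 (\<lambda>x. \<bar>f x\<bar> powr p)"
  have contp: "continuous_on B1 (\<lambda>x. \<bar>f x\<bar> powr p)"
    using p by (intro continuous_on_powr' continuous_intros f) auto
  have Lp: "Lp_norm p f = Ip powr (1/p)"
    unfolding Lp_norm_def Ip_def
    using lebesgue_integral_eq_integral[OF continuous_imp_integrable_real[OF contp]] by simp
  have Ip0: "Ip \<ge> 0" unfolding Ip_def by (intro integral_nonneg integrable_continuous_real contp) auto
  have sub: "{-s..s} \<subseteq> B1" using s by auto
  have bound: "integral {-s..s} (\<lambda>x. \<bar>f x\<bar>) \<le> 3 * s powr (1 - 1/p) * A" if A: "A > Lp_norm p f" for A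
  proof -
    have A0: "A > 0" using A unfolding Lp by (meson le_less_trans powr_ge_zero)
    have IpA: "Ip \<le> A powr p"
    proof -
      have "Ip = (Ip powr (1/p)) powr p" using Ip0 p by (simp add: powr_powr)
      also have "\<dots> \<le> A powr p" using A p unfolding Lp by (intro powr_mono2) auto
      finally show ?thesis .
    qed
    \<comment> \<open>This is \<open>t \<le> 1 + t powr p\<close>, scaled so that the two terms
      balance at \<open>|f x| = A * s powr (-1/p)\<close>. Integration yields \<open>2 * s\<close>
      from the first term and at most \<open>s\<close> from the second, hence the
      \<open>3\<close>.\<close>
    have pt: "\<bar>f x\<bar> \<le> A * s powr (-1/p) + (A * s powr (-1/p)) * (s / A powr p) * \<bar>f x\<bar> powr p" for x
    proof -
      define t where "t = \<bar>f x\<bar> * s powr (1/p) / A"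
      have t0: "t \<ge> 0" using A0 by (simp add: t_def)
      have "t \<le> 1 + t powr p"
      proof (cases "t \<le> 1")
        case False
        then have "t powr 1 \<le> t powr p" using p by (intro powr_mono) auto
        then show ?thesis using False by simp
      qed (simp add: add_increasing2)
      then have "(A * s powr (-1/p)) * t \<le> (A * s powr (-1/p)) * (1 + t powr p)"
        using A0 by (intro mult_left_mono) auto
      moreover have "(A * s powr (-1/p)) * t = \<bar>f x\<bar>"
      proof -
        have "s powr (-1/p) * s powr (1/p) = 1" using s by (simp add: powr_add[symmetric])
        then have "\<bar>f x\<bar> * (s powr (-1/p) * s powr (1/p)) = \<bar>f x\<bar>" by simp
        then show ?thesis using A0 unfolding t_def by (simp add: field_simps)
      qed
      moreover have "t powr p = s / A powr p * \<bar>f x\<bar> powr p"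
        unfolding t_def using A0 s p by (simp add: powr_divide powr_mult powr_powr)
      ultimately show ?thesis by (simp only: distrib_left mult_1_right mult.assoc)
    qed
    have "integral {-s..s} (\<lambda>x. \<bar>f x\<bar>) \<le>
        integral {-s..s} (\<lambda>x. A * s powr (-1/p) + (A * s powr (-1/p)) * (s / A powr p) * \<bar>f x\<bar> powr p)"
      by (intro integral_le integrable_continuous_real continuous_intros
          continuous_on_subset[OF f sub] continuous_on_subset[OF contp sub] pt)
    also have "\<dots> = A * s powr (-1/p) * (2 * s) + (A * s powr (-1/p)) * (s / A powr p) * integral {-s..s} (\<lambda>x. \<bar>f x\<bar> powr p)"
      by (subst Henstock_Kurzweil_Integration.integral_add)
        (use s A0 in \<open>auto intro!: integrable_continuous_real continuous_intros continuous_on_subset[OF contp sub]\<close>)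
    also have "\<dots> \<le> A * s powr (-1/p) * (2 * s) + (A * s powr (-1/p)) * (s / A powr p) * A powr p"
    proof -
      have "integral {-s..s} (\<lambda>x. \<bar>f x\<bar> powr p) \<le> Ip" unfolding Ip_def
        by (intro integral_subset_le sub integrable_continuous_real contp continuous_on_subset[OF contp sub]) auto
      then show ?thesis using IpA A0 s by (intro add_left_mono mult_left_mono) auto
    qed
    also have "\<dots> = 3 * (s powr (-1/p) * s) * A" using A0 by simp
    also have "s powr (-1/p) * s = s powr (1 - 1/p)"
      using powr_add[of s "-1/p" 1] s by (simp add: add.commute)
    finally show ?thesis .
  qed
  \<comment> \<open>\<open>A\<close> decreases to the norm. It was kept strictly above it so that
    division by \<open>A\<close> is possible even when the norm is zero.\<close>
  show ?thesis
  proof (rule dense_ge_bounded)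
    show "3 * s powr (1 - 1/p) * Lp_norm p f < 3 * s powr (1 - 1/p) * (Lp_norm p f + 1)"
      using s by (intro mult_strict_left_mono) auto
    fix w assume w: "3 * s powr (1 - 1/p) * Lp_norm p f < w"
    have pos: "3 * s powr (1 - 1/p) > 0" using s by simp
    then have "Lp_norm p f < w / (3 * s powr (1 - 1/p))"
      using w by (simp add: pos_less_divide_eq mult.commute)
    from bound[OF this] show "integral {-s..s} (\<lambda>x. \<bar>f x\<bar>) \<le> w" using pos by simp
  qed
qed

text \<open>
  \<open>Y\<^sup>3 Y'' = N := 2 \<phi> \<phi>'' - \<phi>'\<^sup>2\<close> and \<open>N' = 2 \<phi> \<phi>'''\<close>, so \<open>|Y'' x|\<close> is at most a constant times
  \<open>x\<^sup>-\<^sup>3 \<integral>\<^sub>0\<^sup>x t\<^sup>2 |\<phi>''' t| dt\<close>, which is the derivative of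
  \<open>\<integral>\<^sub>0\<^sup>x |\<phi>'''| / 2 - (\<integral>\<^sub>0\<^sup>x t\<^sup>2 |\<phi>''' t| dt) / (2 x\<^sup>2)\<close>.
\<close>
lemma coordinate_second_derivative_half:
  fixes phi phi1 phi2 phi3 Y Y1 Y2 :: "real \<Rightarrow> real"
  assumes d1: "\<And>x. x \<in> {0..1} \<Longrightarrow> (phi has_real_derivative phi1 x) (at x within {0..1})"
    and d2: "\<And>x. x \<in> {0..1} \<Longrightarrow> (phi1 has_real_derivative phi2 x) (at x within {0..1})"
    and d3: "\<And>x. x \<in> {0..1} \<Longrightarrow> (phi2 has_real_derivative phi3 x) (at x within {0..1})"
    and c3: "continuous_on {0..1} phi3"
    and e1: "\<And>x. x \<in> {0..1} \<Longrightarrow> (Y has_real_derivative Y1 x) (at x within {0..1})"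
    and e2: "\<And>x. x \<in> {0..1} \<Longrightarrow> (Y1 has_real_derivative Y2 x) (at x within {0..1})"
    and c2: "continuous_on {0..1} Y2"
    and sq: "\<And>x. x \<in> {0..1} \<Longrightarrow> (Y x)\<^sup>2 = 2 * phi x"
    and lo: "\<And>x. x \<in> {0..1} \<Longrightarrow> \<bar>x\<bar> \<le> 4 * \<bar>Y x\<bar>"
    and hi: "\<And>x. x \<in> {0..1} \<Longrightarrow> \<bar>Y x\<bar> \<le> 4 * \<bar>x\<bar>"
    and z: "phi 0 = 0" "phi1 0 = 0" and x: "x \<in> {0..1}"
  shows "integral {0..x} (\<lambda>t. \<bar>Y2 t\<bar>) \<le> 512 * integral {0..x} (\<lambda>t. \<bar>phi3 t\<bar>)"
proof -
  define P where "P x = integral {0..x} (\<lambda>t. t\<^sup>2 * \<bar>phi3 t\<bar>)" for x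
  define T where "T x = integral {0..x} (\<lambda>t. \<bar>phi3 t\<bar>)" for x
  define R where "R x = integral {0..x} (\<lambda>t. \<bar>Y2 t\<bar>)" for x
  define N where "N x = 2 * phi x * phi2 x - (phi1 x)\<^sup>2" for x
  have at: "(f has_real_derivative D) (at x within {0..1}) \<Longrightarrow> (f has_real_derivative D) (at x)"
    if "0 < x" "x < 1" for f :: "real \<Rightarrow> real" and D x
    using that by (simp add: at_within_Icc_at)
  have dP: "(P has_real_derivative x\<^sup>2 * \<bar>phi3 x\<bar>) (at x within {0..1})" if "x \<in> {0..1}" for x
    unfolding P_def has_real_derivative_iff_has_vector_derivative
    by (rule integral_has_vector_derivative[OF _ that]) (intro continuous_intros c3)
  have dT: "(T has_real_derivative \<bar>phi3 x\<bar>) (at x within {0..1})" if "x \<in> {0..1}" for x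
    unfolding T_def has_real_derivative_iff_has_vector_derivative
    by (rule integral_has_vector_derivative[OF _ that]) (intro continuous_intros c3)
  have dR: "(R has_real_derivative \<bar>Y2 x\<bar>) (at x within {0..1})" if "x \<in> {0..1}" for x
    unfolding R_def has_real_derivative_iff_has_vector_derivative
    by (rule integral_has_vector_derivative[OF _ that]) (intro continuous_intros c2)
  have dN: "(N has_real_derivative 2 * phi x * phi3 x) (at x within {0..1})" if "x \<in> {0..1}" for x
    unfolding N_def using d1[OF that] d2[OF that] d3[OF that]
    by (auto intro!: derivative_eq_intros)
  have cont: "continuous_on {0..y} f"
    if "\<And>x. x \<in> {0..1} \<Longrightarrow> (f has_real_derivative f' x) (at x within {0..1})" "y \<in> {0..1}" for f f' :: "real \<Rightarrow> real" and y
    using that(1) DERIV_continuous_on[of "{0..1}" f f'] that(2)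
    by (auto intro: continuous_on_subset)
  \<comment> \<open>\<open>|N'| = Y^2 * |phi3|\<close> and \<open>|Y x| \<le> 4 * x\<close> give the
    factor \<open>16\<close>.\<close>
  have NP: "\<bar>N y\<bar> \<le> 16 * P y" if y: "y \<in> {0..1}" for y
  proof (cases "y = 0")
    case True
    then show ?thesis by (simp add: N_def P_def z)
  next
    case False
    then have y0: "0 < y" using y by auto
    have "norm (N y - N 0) \<le> 16 * P y - 16 * P 0"
    proof (rule differentiable_bound_general[OF y0, where f' = "\<lambda>x. 2 * phi x * phi3 x" and \<phi>' = "\<lambda>x. 16 * (x\<^sup>2 * \<bar>phi3 x\<bar>)"])
      show "continuous_on {0..y} N" by (rule cont[OF dN y])
      show "continuous_on {0..y} (\<lambda>x. 16 * P x)" by (intro continuous_intros cont[OF dP y])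
      fix x assume "0 < x" "x < y"
      then have x: "0 < x" "x < 1" "x \<in> {0..1}" using y by auto
      show "(N has_vector_derivative 2 * phi x * phi3 x) (at x)"
        using at[OF x(1,2) dN[OF x(3)]] by (simp add: has_real_derivative_iff_has_vector_derivative)
      show "((\<lambda>x. 16 * P x) has_vector_derivative 16 * (x\<^sup>2 * \<bar>phi3 x\<bar>)) (at x)"
        using DERIV_cmult[OF at[OF x(1,2) dP[OF x(3)]], of 16] by (simp add: has_real_derivative_iff_has_vector_derivative)
      have "(Y x)\<^sup>2 \<le> (4 * x)\<^sup>2" using hi[OF x(3)] x(1) by (intro power2_le_iff_abs_le[THEN iffD2]) auto
      then have "\<bar>2 * phi x\<bar> * \<bar>phi3 x\<bar> \<le> (4 * x)\<^sup>2 * \<bar>phi3 x\<bar>"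
        using sq[OF x(3)] zero_le_power2[of "Y x"] by (intro mult_right_mono) auto
      then show "norm (2 * phi x * phi3 x) \<le> 16 * (x\<^sup>2 * \<bar>phi3 x\<bar>)"
        by (simp add: abs_mult power_mult_distrib)
    qed
    then show ?thesis by (simp add: N_def P_def z)
  qed
  \<comment> \<open>Differentiating \<open>Y^2 = 2 * phi\<close> twice gives
    \<open>Y * Y1 = phi1\<close> and \<open>Y * Y2 + Y1^2 = phi2\<close>; multiplying the latter by
    \<open>Y^2\<close> and inserting the former produces \<open>N\<close>.\<close>
  have YN: "(Y x) ^ 3 * Y2 x = N x" if x: "0 < x" "x < 1" for x
  proof -
    have x': "x \<in> {0..1}" using x by auto
    have YY1: "Y w * Y1 w = phi1 w" if w: "0 < w" "w < 1" for w
    proof -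
      have w': "w \<in> {0..1}" using w by auto
      have "((\<lambda>x. (Y x)\<^sup>2) has_real_derivative 2 * (Y w * Y1 w)) (at w within {0..1})"
        using e1[OF w'] by (auto intro!: derivative_eq_intros)
      then have "((\<lambda>x. 2 * phi x) has_real_derivative 2 * (Y w * Y1 w)) (at w within {0..1})"
        by (rule has_field_derivative_transform_within[OF _ zero_less_one w']) (use sq in auto)
      moreover have "((\<lambda>x. 2 * phi x) has_real_derivative 2 * phi1 w) (at w within {0..1})"
        by (rule DERIV_cmult[OF d1[OF w']])
      ultimately show ?thesis using DERIV_unique[OF at[OF w] at[OF w]] by fastforce
    qed
    have "((\<lambda>x. Y x * Y1 x) has_real_derivative Y x * Y2 x + Y1 x * Y1 x) (at x)"
      using at[OF x e1[OF x']] at[OF x e2[OF x']] by (auto intro!: derivative_eq_intros)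
    then have "(phi1 has_real_derivative Y x * Y2 x + Y1 x * Y1 x) (at x)"
      by (rule has_field_derivative_transform_within_open[where S = "{0<..<1}"]) (use x YY1 in auto)
    then have "Y x * Y2 x + Y1 x * Y1 x = phi2 x"
      using DERIV_unique at[OF x d2[OF x']] by blast
    then have "(Y x)\<^sup>2 * (Y x * Y2 x + Y1 x * Y1 x) = (Y x)\<^sup>2 * phi2 x" by simp
    moreover have "(Y x)\<^sup>2 * (Y1 x * Y1 x) = (phi1 x)\<^sup>2"
      using YY1[OF x] by (simp add: power2_eq_square algebra_simps flip: YY1[OF x])
    ultimately show ?thesis unfolding N_def sq[OF x', symmetric]
      by (simp add: power2_eq_square power3_eq_cube algebra_simps)
  qed
  \<comment> \<open>\<open>x \<le> 4 * |Y x|\<close> replaces \<open>|Y|^3\<close> by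
    \<open>x^3 / 64\<close>, and \<open>64 * 16 = 1024\<close>.\<close>
  have Y2P: "\<bar>Y2 x\<bar> \<le> 1024 * (P x / x ^ 3)" if x: "0 < x" "x < 1" for x
  proof -
    have x': "x \<in> {0..1}" using x by auto
    have "(x / 4) ^ 3 \<le> \<bar>Y x\<bar> ^ 3" using lo[OF x'] x by (intro power_mono) auto
    then have "(x / 4) ^ 3 * \<bar>Y2 x\<bar> \<le> \<bar>Y x\<bar> ^ 3 * \<bar>Y2 x\<bar>" by (intro mult_right_mono) auto
    also have "\<dots> = \<bar>N x\<bar>" using YN[OF x] by (simp add: abs_mult power_abs flip: YN[OF x])
    also have "\<dots> \<le> 16 * P x" by (rule NP[OF x'])
    finally show ?thesis using x by (simp add: field_simps power_divide)
  qed
  have PT: "P y \<le> y\<^sup>2 * T y" "0 \<le> P y" if y: "y \<in> {0..1}" for y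
  proof -
    have int: "(\<lambda>t. t\<^sup>2 * \<bar>phi3 t\<bar>) integrable_on {0..y}" "(\<lambda>t. y\<^sup>2 * \<bar>phi3 t\<bar>) integrable_on {0..y}"
      using c3 y by (auto intro!: integrable_continuous_real continuous_intros intro: continuous_on_subset)
    have "P y \<le> integral {0..y} (\<lambda>t. y\<^sup>2 * \<bar>phi3 t\<bar>)"
      unfolding P_def by (intro integral_le int) (auto intro!: mult_right_mono power_mono)
    then show "P y \<le> y\<^sup>2 * T y" by (simp add: T_def)
    show "0 \<le> P y" unfolding P_def by (intro integral_nonneg int) auto
  qed
  \<comment> \<open>The primitive \<open>?Q\<close> contains \<open>P / x^2\<close>, so the
    comparison starts at \<open>e > 0\<close>. The contribution of \<open>e\<close> has the right
    sign because \<open>P e / e^2 \<le> T e\<close>.\<close>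
  have main: "R x - R e \<le> 512 * T x" if e: "0 < e" "e < x" for e
  proof -
    let ?Q = "\<lambda>x. 512 * T x - 512 * (P x / x\<^sup>2)"
    have ex: "e \<in> {0..1}" using e x by auto
    have sub: "{e..x} \<subseteq> {0..x}" using e by auto
    have "norm (R x - R e) \<le> ?Q x - ?Q e"
    proof (rule differentiable_bound_general[OF e(2), where f' = "\<lambda>x. \<bar>Y2 x\<bar>" and \<phi>' = "\<lambda>x. 1024 * (P x / x ^ 3)"])
      show "continuous_on {e..x} R" by (rule continuous_on_subset[OF cont[OF dR x] sub])
      show "continuous_on {e..x} ?Q"
        using e by (intro continuous_intros continuous_on_subset[OF cont[OF dT x] sub] continuous_on_subset[OF cont[OF dP x] sub]) auto
      fix w assume "e < w" "w < x"
      then have w: "0 < w" "w < 1" "w \<in> {0..1}" using x e by auto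
      show "(R has_vector_derivative \<bar>Y2 w\<bar>) (at w)"
        using at[OF w(1,2) dR[OF w(3)]] by (simp add: has_real_derivative_iff_has_vector_derivative)
      have "(?Q has_real_derivative 512 * \<bar>phi3 w\<bar> - 512 * ((w\<^sup>2 * \<bar>phi3 w\<bar> * w\<^sup>2 - P w * (2 * w)) / (w\<^sup>2 * w\<^sup>2))) (at w)"
        using at[OF w(1,2) dT[OF w(3)]] at[OF w(1,2) dP[OF w(3)]] w
        by (auto intro!: derivative_eq_intros)
      moreover have "512 * \<bar>phi3 w\<bar> - 512 * ((w\<^sup>2 * \<bar>phi3 w\<bar> * w\<^sup>2 - P w * (2 * w)) / (w\<^sup>2 * w\<^sup>2)) = 1024 * (P w / w ^ 3)"
        using w by (simp add: field_simps power2_eq_square power3_eq_cube)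
      ultimately show "(?Q has_vector_derivative 1024 * (P w / w ^ 3)) (at w)"
        by (simp add: has_real_derivative_iff_has_vector_derivative)
      show "norm \<bar>Y2 w\<bar> \<le> 1024 * (P w / w ^ 3)" using Y2P[OF w(1,2)] by simp
    qed
    moreover have "P e / e\<^sup>2 \<le> T e" using PT(1)[OF ex] e by (simp add: field_simps)
    moreover have "0 \<le> P x / x\<^sup>2" using PT(2)[OF x] by simp
    ultimately show ?thesis by simp
  qed
  show ?thesis
  proof (cases "x = 0")
    case False
    have "continuous_on {0..x} R" by (rule cont[OF dR x])
    then have "(R \<longlongrightarrow> R 0) (at 0 within {0..x})"
      using x unfolding continuous_on_def by (metis atLeastAtMost_iff order_refl)
    then have "(R \<longlongrightarrow> R 0) (at_right 0)"
      using x False by (simp add: at_within_Icc_at_right)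
    then have "((\<lambda>e. R x - R e) \<longlongrightarrow> R x - R 0) (at_right 0)"
      by (intro tendsto_intros)
    moreover have "eventually (\<lambda>e. R x - R e \<le> 512 * T x) (at_right 0)"
      using eventually_at_right_real[of 0 x] x False
      by (auto elim!: eventually_mono intro!: main)
    ultimately have "R x - R 0 \<le> 512 * T x"
      by (intro tendsto_upperbound) auto
    then show ?thesis by (simp add: R_def T_def)
  qed simp
qed

lemma has_real_derivative_reflect:
  assumes "(f has_vector_derivative f' (- x)) (at (- x) within B1)" "x \<in> {0..1}"
  shows "((\<lambda>x. f (- x)) has_real_derivative - f' (- x)) (at x within {0..1})"
proof -
  have "(f has_vector_derivative f' (- x)) (at (- x) within uminus ` {0..1})"
    by (rule has_vector_derivative_within_subset[OF assms(1)]) auto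
  then have "((f \<circ> uminus) has_vector_derivative (- 1) *\<^sub>R f' (- x)) (at x within {0..1})"
    by (intro vector_diff_chain_within) (auto intro!: derivative_eq_intros)
  then show ?thesis by (simp add: o_def has_real_derivative_iff_has_vector_derivative)
qed

text \<open>The left half follows by reflection: odd-order derivatives of \<open>phi\<close> change
  sign under \<open>x\<close> to \<open>-x\<close>, and for the coordinate \<open>Y (- x)\<close> is
  used, whose negative slope does no harm because only \<open>Y^2\<close> and \<open>|Y|\<close>
  enter the hypotheses.\<close>

lemma coordinate_second_derivative:
  fixes phi phi1 phi2 phi3 Y Y1 Y2 :: "real \<Rightarrow> real"
  assumes d1: "\<And>x. x \<in> B1 \<Longrightarrow> (phi has_vector_derivative phi1 x) (at x within B1)"
    and d2: "\<And>x. x \<in> B1 \<Longrightarrow> (phi1 has_vector_derivative phi2 x) (at x within B1)"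
    and d3: "\<And>x. x \<in> B1 \<Longrightarrow> (phi2 has_vector_derivative phi3 x) (at x within B1)"
    and c3: "continuous_on B1 phi3"
    and e1: "\<And>x. x \<in> B1 \<Longrightarrow> (Y has_vector_derivative Y1 x) (at x within B1)"
    and e2: "\<And>x. x \<in> B1 \<Longrightarrow> (Y1 has_vector_derivative Y2 x) (at x within B1)"
    and c2: "continuous_on B1 Y2"
    and sq: "\<And>x. x \<in> B1 \<Longrightarrow> (Y x)\<^sup>2 = 2 * phi x"
    and lo: "\<And>x. x \<in> B1 \<Longrightarrow> \<bar>x\<bar> \<le> 4 * \<bar>Y x\<bar>"
    and hi: "\<And>x. x \<in> B1 \<Longrightarrow> \<bar>Y x\<bar> \<le> 4 * \<bar>x\<bar>"
    and z: "phi 0 = 0" "phi1 0 = 0" and s: "0 \<le> s" "s \<le> 1"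
  shows "integral {-s..s} (\<lambda>t. \<bar>Y2 t\<bar>) \<le> 512 * integral {-s..s} (\<lambda>t. \<bar>phi3 t\<bar>)"
proof -
  have sub: "{0..1} \<subseteq> B1" "{-s..s} \<subseteq> B1" using s by auto
  have mem: "x \<in> {0..1} \<Longrightarrow> - x \<in> B1" for x :: real by auto
  have R: "(f has_real_derivative f' x) (at x within {0..1})"
    if "\<And>x. x \<in> B1 \<Longrightarrow> (f has_vector_derivative f' x) (at x within B1)" "x \<in> {0..1}" for f f' and x :: real
    unfolding has_real_derivative_iff_has_vector_derivative
    by (rule has_vector_derivative_within_subset[OF that(1) sub(1)]) (use that(2) in auto)
  have r: "((\<lambda>x. f (- x)) has_real_derivative - f' (- x)) (at x within {0..1})"
    if "\<And>x. x \<in> B1 \<Longrightarrow> (f has_vector_derivative f' x) (at x within B1)" "x \<in> {0..1}" for f f' and x :: real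
    by (rule has_real_derivative_reflect[of f f' x, OF that(1)[OF mem[OF that(2)]] that(2)])
  have r': "((\<lambda>x. - f (- x)) has_real_derivative f' (- x)) (at x within {0..1})"
    if "\<And>x. x \<in> B1 \<Longrightarrow> (f has_vector_derivative f' x) (at x within B1)" "x \<in> {0..1}" for f f' and x :: real
    using DERIV_minus[OF r[OF that]] by simp
  have c: "continuous_on {0..1} (\<lambda>x. f (- x))" if "continuous_on B1 f" for f :: "real \<Rightarrow> real"
    by (rule continuous_on_compose2[OF that]) (auto intro!: continuous_intros)
  have "integral {0..s} (\<lambda>t. \<bar>Y2 t\<bar>) \<le> 512 * integral {0..s} (\<lambda>t. \<bar>phi3 t\<bar>)"
    by (rule coordinate_second_derivative_half[OF R[OF d1] R[OF d2] R[OF d3] _ R[OF e1] R[OF e2] _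
          sq[OF subsetD[OF sub(1)]] lo[OF subsetD[OF sub(1)]] hi[OF subsetD[OF sub(1)]] z])
      (use c3 c2 s in \<open>auto intro: continuous_on_subset\<close>)
  moreover have "integral {0..s} (\<lambda>t. \<bar>Y2 (- t)\<bar>) \<le> 512 * integral {0..s} (\<lambda>t. \<bar>- phi3 (- t)\<bar>)"
  proof (rule coordinate_second_derivative_half[OF r[OF d1] r'[OF d2] r[OF d3] _ r[OF e1] r'[OF e2] c[OF c2] sq[OF mem]])
    show "continuous_on {0..1} (\<lambda>x. - phi3 (- x))" by (intro continuous_intros c c3)
    show "\<bar>x\<bar> \<le> 4 * \<bar>Y (- x)\<bar>" "\<bar>Y (- x)\<bar> \<le> 4 * \<bar>x\<bar>" if "x \<in> {0..1}" for x
      using lo[OF mem[OF that]] hi[OF mem[OF that]] by auto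
  qed (use z s in auto)
  moreover have "integral {-s..s} (\<lambda>t. \<bar>Y2 t\<bar>) = integral {0..s} (\<lambda>t. \<bar>Y2 t\<bar>) + integral {0..s} (\<lambda>t. \<bar>Y2 (- t)\<bar>)"
    by (rule integral_even_odd) (use s sub c2 in \<open>auto intro!: continuous_intros intro: continuous_on_subset\<close>)
  moreover have "integral {-s..s} (\<lambda>t. \<bar>phi3 t\<bar>) = integral {0..s} (\<lambda>t. \<bar>phi3 t\<bar>) + integral {0..s} (\<lambda>t. \<bar>phi3 (- t)\<bar>)"
    by (rule integral_even_odd) (use s sub c3 in \<open>auto intro!: continuous_intros intro: continuous_on_subset\<close>)
  ultimately show ?thesis by simp
qed

text \<open>The factor \<open>1 / Y1\<close> is the Jacobian of \<open>X\<close>, so composing a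
  primitive of \<open>norm p'\<close> with \<open>X\<close> gives a primitive of the integrand. The
  range of integration becomes \<open>[X (-r), X r]\<close>, inside \<open>[-100 r, 100 r]\<close>;
  beyond \<open>B1\<close> nothing is left, whence the minimum with \<open>1\<close>.\<close>

lemma line_pullback_L1_bound:
  fixes p' :: "real \<Rightarrow> 'a::euclidean_space"
  assumes lc: "line_coordinate Y1 F X" and b: "\<And>x. x \<in> B1 \<Longrightarrow> 1/100 \<le> Y1 x"
    and p': "continuous_on B1 p'" "p' (-1) = 0" "p' 1 = 0" and r: "0 < r"
  shows "integral {-r..r} (\<lambda>y. norm (zero_extension (\<lambda>x. inverse (Y1 x) *\<^sub>R p' x) (X y)))
    \<le> integral {- min 1 (100 * r)..min 1 (100 * r)} (\<lambda>x. norm (p' x))"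
proof -
  let ?q = "\<lambda>x. norm (zero_extension p' x)"
  let ?s = "min 1 (100 * r)"
  have contq: "continuous_on UNIV ?q" by (intro continuous_intros zero_extension_continuous p')
  obtain V where V: "\<And>x. (V has_vector_derivative ?q x) (at x)" using antiderivative_UNIV[OF contq] by blast
  have Vint: "(?q has_integral (V d - V c)) {c..d}" if "c \<le> d" for c d
    by (rule fundamental_theorem_of_calculus[OF that]) (use V in \<open>auto intro: has_vector_derivative_at_within\<close>)
  have mono: "V c \<le> V d" if "c \<le> d" for c d
    using has_integral_nonneg[OF Vint[OF that]] by simp
  have Y1pos: "Y1 (clamp1 w) > 0" for w using b[OF clamp1_simps(1)[of w]] by linarith
  have D: "((V \<circ> X) has_vector_derivative norm (zero_extension (\<lambda>x. inverse (Y1 x) *\<^sub>R p' x) (X y))) (at y)" for y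
  proof -
    have "((V \<circ> X) has_vector_derivative inverse (Y1 (clamp1 (X y))) *\<^sub>R ?q (X y)) (at y)"
      using lc V[of "X y"]
      by (intro vector_diff_chain_at) (auto simp: line_coordinate_def has_real_derivative_iff_has_vector_derivative)
    moreover have "inverse (Y1 (clamp1 (X y))) *\<^sub>R ?q (X y) = norm (zero_extension (\<lambda>x. inverse (Y1 x) *\<^sub>R p' x) (X y))"
      using clamp1_simps(2)[of "X y"] Y1pos[of "X y"] by (auto simp: zero_extension_def)
    ultimately show ?thesis by simp
  qed
  have "((\<lambda>y. norm (zero_extension (\<lambda>x. inverse (Y1 x) *\<^sub>R p' x) (X y))) has_integral ((V \<circ> X) r - (V \<circ> X) (- r))) {-r..r}"
    by (rule fundamental_theorem_of_calculus[OF _ has_vector_derivative_at_within[OF D]]) (use r in simp)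
  then have "integral {-r..r} (\<lambda>y. norm (zero_extension (\<lambda>x. inverse (Y1 x) *\<^sub>R p' x) (X y))) = V (X r) - V (X (- r))"
    by (simp add: integral_unique)
  also have "\<dots> \<le> V (100 * r) - V (- (100 * r))"
  proof -
    have "\<bar>X r\<bar> \<le> 100 * \<bar>r\<bar>" "\<bar>X (- r)\<bar> \<le> 100 * \<bar>- r\<bar>" using lc unfolding line_coordinate_def by blast+
    then have "X r \<le> 100 * r" "- (100 * r) \<le> X (- r)" using r by auto
    then show ?thesis using mono by (meson diff_mono)
  qed
  also have "\<dots> = integral {- (100 * r)..100 * r} ?q"
    using Vint[of "- (100 * r)" "100 * r"] r by (simp add: integral_unique)
  also have "\<dots> = integral {- ?s..?s} ?q"
  proof (cases "100 * r \<le> 1")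
    case False
    have "?q integrable_on {-1..1}"
      by (intro integrable_continuous_real continuous_on_subset[OF contq]) auto
    then have "(?q has_integral (integral {-1..1} ?q)) {- (100 * r)..100 * r}"
      by (intro has_integral_on_superset[OF integrable_integral])
        (use False in \<open>auto simp: zero_extension_def\<close>)
    then show ?thesis using False by (simp add: integral_unique)
  qed simp
  also have "\<dots> = integral {- ?s..?s} (\<lambda>x. norm (p' x))"
    by (rule integral_cong) (auto simp: zero_extension_def)
  finally show ?thesis .
qed

section \<open>Estimates of the remainder\<close>

lemma ucd_reindex:
  assumes "ucd S Z I m f" "\<And>j. j \<in> J \<Longrightarrow> h j \<in> I"
  shows "ucd S Z J m (\<lambda>j. f (h j))"
  using assms(1)
proof (induction m arbitrary: f)
  case 0
  then show ?case using assms(2) by (auto, blast)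
next
  case (Suc m)
  obtain M where M: "M \<ge> 0" "\<forall>i\<in>I. \<forall>x\<in>S. norm (f i x) \<le> M" by (rule ucd_bound[OF Suc.prems])
  obtain f' where f': "\<forall>i\<in>I. \<forall>x\<in>S. (f i has_vector_derivative f' i x) (at x within S)" "ucd S Z I m f'"
    using Suc.prems unfolding ucd.simps(2) by blast
  show ?case
    by (rule ucd_SucI[where f' = "\<lambda>j. f' (h j)" and M = M])
      (use assms(2) M f' ucd_zero[OF Suc.prems] Suc.IH[OF f'(2)] in auto)
qed

lemma ucd_sequence:
  assumes "\<And>i l x. i \<in> I \<Longrightarrow> l < m \<Longrightarrow> x \<in> S \<Longrightarrow> (D l i has_vector_derivative D (Suc l) i x) (at x within S)"
    and "\<And>i. i \<in> I \<Longrightarrow> continuous_on S (D m i)"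
    and "\<And>i l x. i \<in> I \<Longrightarrow> l \<le> m \<Longrightarrow> x \<in> Z \<Longrightarrow> D l i x = 0"
    and "\<And>l. l \<le> m \<Longrightarrow> \<exists>M. \<forall>i\<in>I. \<forall>x\<in>S. norm (D l i x) \<le> M"
  shows "ucd S Z I m (D 0)"
  using assms
proof (induction m arbitrary: D)
  case 0
  then show ?case by auto
next
  case (Suc m)
  have "ucd S Z I m (\<lambda>i. D (Suc 0) i)"
    by (rule Suc.IH[of "\<lambda>l. D (Suc l)"]) (use Suc.prems in auto)
  moreover obtain M where "\<forall>i\<in>I. \<forall>x\<in>S. norm (D 0 i x) \<le> M" using Suc.prems(4)[of 0] by blast
  ultimately show ?case
    by (intro ucd_SucI[where f' = "\<lambda>i. D (Suc 0) i" and M = M]) (use Suc.prems in auto)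
qed

section \<open>Iterated derivatives of phases and amplitudes\<close>

lemma nth_deriv_on_0 [simp]: "nth_deriv_on S 0 f = f"
  by (simp add: nth_deriv_on_def)

lemma nth_deriv_on_Suc:
  "nth_deriv_on S (Suc k) f x = vector_derivative (nth_deriv_on S k f) (at x within S)"
  by (simp add: nth_deriv_on_def)

lemma Ck_on_derivative:
  assumes "Ck_on S n f" "j < n" "x \<in> S"
  shows "(nth_deriv_on S j f has_vector_derivative nth_deriv_on S (Suc j) f x) (at x within S)"
  unfolding nth_deriv_on_Suc using assms by (simp add: Ck_on_def vector_derivative_works[symmetric])

lemma Ck_on_continuous:
  assumes "Ck_on S n f" "j \<le> n"
  shows "continuous_on S (nth_deriv_on S j f)"
proof (cases "j = n")
  case True
  then show ?thesis using assms by (simp add: Ck_on_def)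
next
  case False
  then show ?thesis
    using assms by (intro continuous_on_vector_derivative[OF Ck_on_derivative]) auto
qed

lemma amplitude_derivative:
  assumes "amplitude psi"
  shows "(nth_deriv_on UNIV k psi has_vector_derivative nth_deriv_on UNIV (Suc k) psi x) (at x)"
proof -
  have "Ck_on UNIV (Suc k) psi" using assms by (simp add: amplitude_def Cinf_on_def)
  from Ck_on_derivative[OF this, of k x] show ?thesis by simp
qed

lemma amplitude_continuous: "amplitude psi \<Longrightarrow> continuous_on S (nth_deriv_on UNIV k psi)"
  by (rule continuous_on_vector_derivative[OF has_vector_derivative_at_within[OF amplitude_derivative]])

lemma amplitude_outside:
  assumes "amplitude psi" "x \<notin> B1"
  shows "nth_deriv_on UNIV k psi x = 0"
  using assms(2)
proof (induction k arbitrary: x)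
  case 0
  then show ?case using assms(1) closure_subset[of "{x. psi x \<noteq> 0}"] unfolding amplitude_def nth_deriv_on_0 by blast
next
  case (Suc k)
  have "((\<lambda>_. 0) has_vector_derivative 0) (at x)" by simp
  then have "(nth_deriv_on UNIV k psi has_vector_derivative 0) (at x)"
    by (rule has_vector_derivative_transform_within_open[where S = "- B1"]) (use Suc in auto)
  with amplitude_derivative[OF assms(1)] show ?case by (rule vector_derivative_unique_at)
qed

text \<open>All derivatives vanish on the complement of \<open>B1\<close>, and the end points are
  limits of it. This supplies the zero set \<open>{-1, 1}\<close> required for extension by
  zero.\<close>

lemma amplitude_endpoint:
  assumes "amplitude psi" "x \<in> {-1, 1}"
  shows "nth_deriv_on UNIV k psi x = 0"
proof (rule continuous_constant_on_closure[of "- B1" "nth_deriv_on UNIV k psi"])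
  show "continuous_on (closure (- B1)) (nth_deriv_on UNIV k psi)" by (rule amplitude_continuous[OF assms(1)])
  show "x \<in> closure (- B1)" using assms(2) unfolding closure_minus_B1[symmetric] by blast
qed (use amplitude_outside[OF assms(1)] in auto)

text \<open>\<open>sup_deriv\<close> differentiates relative to \<open>B1\<close>, while the
  regularity of an amplitude is stated on the line; this reconciles the two.\<close>

lemma amplitude_nth_deriv_B1:
  assumes "amplitude psi" "x \<in> B1"
  shows "nth_deriv_on B1 k psi x = nth_deriv_on UNIV k psi x"
  using assms(2)
proof (induction k arbitrary: x)
  case (Suc k)
  have "(nth_deriv_on UNIV k psi has_vector_derivative nth_deriv_on UNIV (Suc k) psi x) (at x within B1)"
    by (rule has_vector_derivative_at_within[OF amplitude_derivative[OF assms(1)]])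
  then have "(nth_deriv_on B1 k psi has_vector_derivative nth_deriv_on UNIV (Suc k) psi x) (at x within cbox (-1) 1)"
    unfolding interval_cbox[symmetric]
    by (rule has_vector_derivative_transform[rotated 2]) (use Suc in auto)
  then have "vector_derivative (nth_deriv_on B1 k psi) (at x within cbox (-1) 1) = nth_deriv_on UNIV (Suc k) psi x"
    by (rule vector_derivative_within_cbox[rotated 2]) (use Suc.prems in auto)
  then show ?case by (simp add: nth_deriv_on_Suc[of B1])
qed simp

lemma osc_integral_eq:
  assumes psi: "amplitude psi" and phi: "continuous_on B1 phi"
  shows "osc_integral phi psi lam = integral B1 (\<lambda>x. cis (lam * phi x) * psi x)"
proof -
  let ?h = "\<lambda>x. cis (lam * phi x) * psi x"
  have "continuous_on B1 psi" using amplitude_continuous[OF psi, of _ 0] by simp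
  then have "continuous_on B1 ?h" by (intro continuous_intros phi)
  then have int: "set_integrable lborel B1 ?h" by (rule borel_integrable_atLeastAtMost')
  have "exp (\<i> * of_real (lam * phi x)) * psi x = indicator B1 x *\<^sub>R ?h x" for x
    using amplitude_outside[OF psi, of x 0] by (auto simp: cis_conv_exp indicator_def)
  then have "osc_integral phi psi lam = (LINT x : B1 | lborel. ?h x)"
    by (simp add: osc_integral_def set_lebesgue_integral_def)
  then show ?thesis using set_borel_integral_eq_integral(2)[OF int] by simp
qed

text \<open>The interface between the phase on \<open>B1\<close> and the quadratic phase on the
  line. A single \<open>G\<close> serves every order: its regularity is an implication for each
  \<open>k\<close>, so each estimate can choose the order that its phase permits. The bound on the
  third derivatives may be any number; it only makes the Morse coordinate available and does not
  enter the \<open>L^1\<close> estimate.\<close>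

lemma phase_reduction:
  fixes I :: "((real \<Rightarrow> real) \<times> (real \<Rightarrow> complex)) set"
  assumes amp: "\<And>phi psi. (phi, psi) \<in> I \<Longrightarrow> amplitude psi"
    and C3: "\<And>phi psi. (phi, psi) \<in> I \<Longrightarrow> Ck_on B1 3 phi"
    and ph: "\<And>phi psi. (phi, psi) \<in> I \<Longrightarrow> phase phi"
    and bd3: "\<exists>M. \<forall>i\<in>I. \<forall>x\<in>B1. \<bar>nth_deriv_on B1 3 (fst i) x\<bar> \<le> M"
  obtains G where
    "\<And>phi psi. (phi, psi) \<in> I \<Longrightarrow> G (phi, psi) 0 = psi 0 / of_real (sqrt (nth_deriv_on B1 2 phi 0))"
    and "\<And>phi psi lam. (phi, psi) \<in> I \<Longrightarrow>
      ((\<lambda>L. integral {-L..L} (\<lambda>y. osc lam y * G (phi, psi) y)) \<longlongrightarrow> osc_integral phi psi lam) at_top"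
    and "\<And>phi psi r. (phi, psi) \<in> I \<Longrightarrow> 0 < r \<Longrightarrow>
      integral {-r..r} (\<lambda>y. norm (vderiv (G (phi, psi)) y)) \<le>
        200 * Linf_norm (nth_deriv_on UNIV 1 psi) * min 1 (100 * r) +
        5120000 * Linf_norm psi * integral {- min 1 (100 * r)..min 1 (100 * r)} (\<lambda>x. \<bar>nth_deriv_on B1 3 phi x\<bar>)"
    and "\<And>k. \<lbrakk>\<And>i. i \<in> I \<Longrightarrow> Ck_on B1 (k + 2) (fst i);
      \<And>l. l \<le> k \<Longrightarrow> \<exists>M. \<forall>i\<in>I. \<forall>x\<in>B1. \<bar>nth_deriv_on B1 (l + 2) (fst i) x\<bar> \<le> M;
      \<And>l. l \<le> k \<Longrightarrow> \<exists>M. \<forall>i\<in>I. \<forall>x\<in>B1. norm (nth_deriv_on UNIV l (snd i) x) \<le> M\<rbrakk> \<Longrightarrow> ucd UNIV {} I k G"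
proof -
  let ?phi = "\<lambda>l i. nth_deriv_on B1 l (fst i)" and ?psi = "\<lambda>l i. nth_deriv_on UNIV l (snd i)"
  have amp': "amplitude (snd i)" and C3': "Ck_on B1 3 (fst i)" and ph': "phase (fst i)" if "i \<in> I" for i
    using amp C3 ph that by (metis prod.collapse)+
  have uphi: "ucd B1 {} I k (?phi 2)"
    if "\<And>i. i \<in> I \<Longrightarrow> Ck_on B1 (k + 2) (fst i)"
      "\<And>l. l \<le> k \<Longrightarrow> \<exists>M. \<forall>i\<in>I. \<forall>x\<in>B1. \<bar>?phi (l + 2) i x\<bar> \<le> M" for k
    using ucd_sequence[of I k B1 "\<lambda>l. ?phi (l + 2)" "{}"]
      Ck_on_derivative[OF that(1)] Ck_on_continuous[OF that(1)] that(2)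
    by (simp del: One_nat_def add_2_eq_Suc' add: numeral_2_eq_2)
  have upsi: "ucd B1 {-1, 1} I k (?psi 0)"
    if "\<And>l. l \<le> k \<Longrightarrow> \<exists>M. \<forall>i\<in>I. \<forall>x\<in>B1. norm (?psi l i x) \<le> M" for k
    by (rule ucd_sequence)
      (use that amp' amplitude_endpoint amplitude_continuous has_vector_derivative_at_within[OF amplitude_derivative] in blast)+
  have b2: "1/10 \<le> ?phi 2 i x \<and> ?phi 2 i x \<le> 10" if "i \<in> I" "x \<in> B1" for i x
    using ph'[OF that(1)] that(2) by (simp add: phase_def)
  \<comment> \<open>Order one for \<open>phi''\<close>: the phase condition bounds
    \<open>phi''\<close> itself, and \<open>bd3\<close> bounds its derivative.\<close>
  have u1: "ucd B1 {} I 1 (?phi 2)"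
  proof (rule uphi)
    show "Ck_on B1 (1 + 2) (fst i)" if "i \<in> I" for i using C3'[OF that] by (simp add: numeral_3_eq_3)
    fix l :: nat assume "l \<le> 1"
    then consider "l = 0" | "l = 1" by linarith
    then show "\<exists>M. \<forall>i\<in>I. \<forall>x\<in>B1. \<bar>?phi (l + 2) i x\<bar> \<le> M"
    proof cases
      case 1
      have "\<bar>?phi (l + 2) i x\<bar> \<le> 10" if "i \<in> I" "x \<in> B1" for i x
      proof -
        have "l + 2 = 2" using 1 by simp
        then show ?thesis using b2[OF that] by (simp only: abs_le_iff) auto
      qed
      then show ?thesis by blast
    next
      case 2
      then show ?thesis using bd3 by (simp add: numeral_3_eq_3)
    qed
  qed
  have dphi: "(?phi l i has_vector_derivative ?phi (Suc l) i x) (at x within B1)" if "i \<in> I" "x \<in> B1" "l < 3" for l i x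
    by (rule Ck_on_derivative[OF C3'[OF that(1)] that(3,2)])
  obtain Y Y1 where uY1: "\<And>k. ucd B1 {} I k (?phi 2) \<Longrightarrow> ucd B1 {} I k Y1"
    and Y: "\<And>i x. i \<in> I \<Longrightarrow> x \<in> B1 \<Longrightarrow> (Y i has_vector_derivative Y1 i x) (at x within B1)"
    and sq: "\<And>i x. i \<in> I \<Longrightarrow> x \<in> B1 \<Longrightarrow> (Y i x)\<^sup>2 = 2 * fst i x"
    and Y1b: "\<And>i x. i \<in> I \<Longrightarrow> x \<in> B1 \<Longrightarrow> 1/100 \<le> Y1 i x \<and> Y1 i x \<le> 100"
    and Y0: "\<And>i. i \<in> I \<Longrightarrow> Y i 0 = 0"
    and Y10: "\<And>i. i \<in> I \<Longrightarrow> Y1 i 0 = sqrt (?phi 2 i 0)"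
    and lo: "\<And>i x. i \<in> I \<Longrightarrow> x \<in> B1 \<Longrightarrow> \<bar>x\<bar> \<le> 4 * \<bar>Y i x\<bar>"
    and hi: "\<And>i x. i \<in> I \<Longrightarrow> x \<in> B1 \<Longrightarrow> \<bar>Y i x\<bar> \<le> 4 * \<bar>x\<bar>"
  proof (rule phase_coordinate[where phi = "\<lambda>i. fst i" and ?phi1.0 = "?phi 1" and ?phi2.0 = "?phi 2" and I = I and m = 1])
    show "(fst i has_vector_derivative ?phi 1 i x) (at x within B1)" if "i \<in> I" "x \<in> B1" for i x
      using dphi[OF that, of 0] by simp
    show "(?phi 1 i has_vector_derivative ?phi 2 i x) (at x within B1)" if "i \<in> I" "x \<in> B1" for i x
      using dphi[OF that, of 1] by (simp add: numeral_2_eq_2)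
    show "fst i 0 = 0" "?phi 1 i 0 = 0" if "i \<in> I" for i using ph'[OF that] by (auto simp: phase_def)
  qed (use u1 b2 in blast)+
  have Y1c: "continuous_on B1 (Y1 i)" if "i \<in> I" for i
    by (rule ucd_continuous[OF uY1[OF u1] that])
  have "\<forall>i\<in>I. \<exists>FX. line_coordinate (Y1 i) (fst FX) (snd FX)"
    using line_coordinate_exists[OF Y1c] Y1b by (metis fst_conv snd_conv)
  then obtain FX where FX: "\<And>i. i \<in> I \<Longrightarrow> line_coordinate (Y1 i) (fst (FX i)) (snd (FX i))"
    by metis
  define X where "X i = snd (FX i)" for i
  have lc: "line_coordinate (Y1 i) (fst (FX i)) (X i)" if "i \<in> I" for i using FX[OF that] by (simp add: X_def)
  define p where "p i x = inverse (Y1 i x) *\<^sub>R snd i x" for i and x :: real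
  define G where "G i y = zero_extension (p i) (X i y)" for i y
  have uG: "ucd UNIV {} I k G"
    if "\<And>i. i \<in> I \<Longrightarrow> Ck_on B1 (k + 2) (fst i)"
      "\<And>l. l \<le> k \<Longrightarrow> \<exists>M. \<forall>i\<in>I. \<forall>x\<in>B1. \<bar>?phi (l + 2) i x\<bar> \<le> M"
      "\<And>l. l \<le> k \<Longrightarrow> \<exists>M. \<forall>i\<in>I. \<forall>x\<in>B1. norm (?psi l i x) \<le> M" for k
  proof -
    have Y1k: "ucd B1 {} I k Y1" by (rule uY1[OF uphi[OF that(1,2)]])
    have "ucd B1 {} I k (\<lambda>i x. inverse (Y1 i x))"
      by (rule ucd_inverse[of "1/100"]) (use Y1b Y1k in auto)
    from ucd_scaleR[OF this upsi[OF that(3)]] have "ucd B1 {-1, 1} I k p"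
      by (simp add: p_def[abs_def])
    then show ?thesis unfolding G_def[abs_def]
      by (intro ucd_line_pullback[OF lc Y1k]) (use Y1b in auto)
  qed
  obtain Y2 where Y2: "\<forall>i\<in>I. \<forall>x\<in>B1. (Y1 i has_vector_derivative Y2 i x) (at x within B1)" "ucd B1 {} I 0 Y2"
    using uY1[OF u1] unfolding One_nat_def ucd.simps(2) by blast
  \<comment> \<open>The derivative of \<open>psi / Y1\<close>; the only second-order quantity in it
    is \<open>Y2\<close>, whose integral is controlled by that of the third derivative of the
    phase.\<close>
  define p' where "p' i x = inverse (Y1 i x) *\<^sub>R ?psi 1 i x + (- Y2 i x / (Y1 i x)\<^sup>2) *\<^sub>R snd i x" for i and x :: real
  have dp: "(p i has_vector_derivative p' i x) (at x within B1)" if "i \<in> I" "x \<in> B1" for i x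
  proof -
    have "Y1 i x \<noteq> 0" using Y1b[OF that] by auto
    moreover have "(Y1 i has_real_derivative Y2 i x) (at x within B1)"
      using Y2(1) that by (simp add: has_real_derivative_iff_has_vector_derivative)
    moreover have "(snd i has_vector_derivative ?psi 1 i x) (at x within B1)"
      using has_vector_derivative_at_within[OF amplitude_derivative[OF amp'[OF that(1)], of 0 x]] by simp
    ultimately show ?thesis unfolding p_def p'_def
      by (intro has_vector_derivative_scaleR) (auto intro!: derivative_eq_intros simp: power2_eq_square field_simps)
  qed
  have pz: "p i x = 0" "p' i x = 0" if "i \<in> I" "x \<in> {-1, 1}" for i x
    using amplitude_endpoint[OF amp'[OF that(1)] that(2), of 0] amplitude_endpoint[OF amp'[OF that(1)] that(2), of 1]
    by (simp_all add: p_def p'_def)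
  have p'c: "continuous_on B1 (p' i)" if i: "i \<in> I" for i
  proof -
    have "continuous_on B1 (snd i)" using amplitude_continuous[OF amp'[OF i], of _ 0] by simp
    moreover have "\<forall>x\<in>B1. Y1 i x \<noteq> 0" using Y1b[OF i] by force
    ultimately show ?thesis unfolding p'_def[abs_def]
      using Y1c[OF i] ucd_continuous[OF Y2(2) i] amplitude_continuous[OF amp'[OF i], of _ 1]
      by (intro continuous_intros) auto
  qed
  have dG: "(G i has_vector_derivative zero_extension (\<lambda>x. inverse (Y1 i x) *\<^sub>R p' i x) (X i y)) (at y)" if "i \<in> I" for i y
    unfolding G_def[abs_def]
    by (rule line_pullback_derivative[OF lc[OF that] dp[OF that]]) (use pz[OF that] in auto)
  have cG: "continuous_on UNIV (G i)" if "i \<in> I" for i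
    by (rule continuous_on_vector_derivative[OF has_vector_derivative_at_within[OF dG[OF that]]])
  show ?thesis
  proof (rule that[of G])
    fix phi psi assume i: "(phi, psi) \<in> I"
    let ?i = "(phi, psi)"
    have "X ?i 0 = 0" using lc[OF i] unfolding line_coordinate_def by (metis abs_le_zero_iff abs_zero mult_zero_right)
    then show "G ?i 0 = psi 0 / of_real (sqrt (nth_deriv_on B1 2 phi 0))"
      using Y10[OF i] by (simp add: G_def p_def zero_extension_def scaleR_conv_of_real divide_inverse mult.commute)
    show "((\<lambda>L. integral {-L..L} (\<lambda>y. osc lam y * G ?i y)) \<longlongrightarrow> osc_integral phi psi lam) at_top" for lam
    proof -
      have "continuous_on B1 phi" using Ck_on_continuous[OF C3[OF i], of 0] by simp
      from osc_integral_eq[OF amp[OF i] this] show ?thesis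
        unfolding G_def p_def[abs_def] snd_conv
        using osc_integral_line[OF lc[OF i] Y[OF i] Y0[OF i], of phi psi lam] Y1b[OF i] sq[OF i] cG[OF i]
        by (simp add: G_def p_def[abs_def])
    qed
    fix r :: real assume r: "0 < r"
    let ?s = "min 1 (100 * r)"
    have s: "0 \<le> ?s" "?s \<le> 1" "{- ?s..?s} \<subseteq> B1" using r by auto
    have cpsi: "continuous_on B1 psi" using amplitude_continuous[OF amp[OF i], of _ 0] by simp
    have c1: "continuous_on B1 (nth_deriv_on UNIV 1 psi)" by (rule amplitude_continuous[OF amp[OF i]])
    have L0: "0 \<le> Linf_norm psi" by (rule order_trans[OF norm_ge_zero norm_le_Linf_norm[OF cpsi, of 0]]) simp
    have cY2: "continuous_on B1 (Y2 ?i)" by (rule ucd_continuous[OF Y2(2) i])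
    have "integral {-r..r} (\<lambda>y. norm (vderiv (G ?i) y)) =
        integral {-r..r} (\<lambda>y. norm (zero_extension (\<lambda>x. inverse (Y1 ?i x) *\<^sub>R p' ?i x) (X ?i y)))"
      using vector_derivative_at[OF dG[OF i]] by (simp add: vderiv_def)
    also have "\<dots> \<le> integral {- ?s..?s} (\<lambda>x. norm (p' ?i x))"
      by (rule line_pullback_L1_bound[OF lc[OF i] _ p'c[OF i] _ _ r]) (use Y1b[OF i] pz[OF i] in auto)
    \<comment> \<open>\<open>1 / Y1 \<le> 100\<close>, and its square is at most
      \<open>10000\<close>. Integrating a constant over length \<open>2 * s\<close> then makes
      \<open>200\<close>, and the factor \<open>512\<close> for \<open>Y2\<close> makes
      \<open>5120000\<close>.\<close>
    also have "\<dots> \<le> integral {- ?s..?s} (\<lambda>x. 100 * Linf_norm (nth_deriv_on UNIV 1 psi) + 10000 * Linf_norm psi * \<bar>Y2 ?i x\<bar>)"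
    proof (intro integral_le integrable_continuous_real continuous_intros continuous_on_subset[OF p'c[OF i] s(3)] continuous_on_subset[OF cY2 s(3)])
      fix x assume "x \<in> {- ?s..?s}"
      then have x: "x \<in> B1" using s by blast
      have inv: "0 \<le> inverse (Y1 ?i x)" "inverse (Y1 ?i x) \<le> 100"
        using Y1b[OF i x] le_imp_inverse_le[of "1/100" "Y1 ?i x"] by auto
      have "norm (p' ?i x) \<le> inverse (Y1 ?i x) * norm (nth_deriv_on UNIV 1 psi x) +
          (inverse (Y1 ?i x) * inverse (Y1 ?i x)) * norm (psi x) * \<bar>Y2 ?i x\<bar>"
        unfolding p'_def using inv(1)
        by (intro order_trans[OF norm_triangle_ineq]) (simp add: power2_eq_square divide_inverse abs_mult ac_simps)
      also have "\<dots> \<le> 100 * Linf_norm (nth_deriv_on UNIV 1 psi) + (100 * 100) * Linf_norm psi * \<bar>Y2 ?i x\<bar>"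
        using inv norm_le_Linf_norm[OF cpsi x] norm_le_Linf_norm[OF c1 x] L0 by (intro add_mono mult_mono) auto
      finally show "norm (p' ?i x) \<le> 100 * Linf_norm (nth_deriv_on UNIV 1 psi) + 10000 * Linf_norm psi * \<bar>Y2 ?i x\<bar>" by simp
    qed
    also have "\<dots> = 200 * Linf_norm (nth_deriv_on UNIV 1 psi) * ?s + 10000 * Linf_norm psi * integral {- ?s..?s} (\<lambda>x. \<bar>Y2 ?i x\<bar>)"
    proof -
      have "integral {- ?s..?s} (\<lambda>x. 100 * Linf_norm (nth_deriv_on UNIV 1 psi) + 10000 * Linf_norm psi * \<bar>Y2 ?i x\<bar>) =
          integral {- ?s..?s} (\<lambda>x. 100 * Linf_norm (nth_deriv_on UNIV 1 psi)) + integral {- ?s..?s} (\<lambda>x. 10000 * Linf_norm psi * \<bar>Y2 ?i x\<bar>)"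
        by (intro Henstock_Kurzweil_Integration.integral_add integrable_continuous_real continuous_intros continuous_on_subset[OF cY2 s(3)])
      also have "integral {- ?s..?s} (\<lambda>x. 100 * Linf_norm (nth_deriv_on UNIV 1 psi)) = 200 * Linf_norm (nth_deriv_on UNIV 1 psi) * ?s"
        using s(1) by simp
      finally show ?thesis by (simp only: integral_mult_right)
    qed
    also have "integral {- ?s..?s} (\<lambda>x. \<bar>Y2 ?i x\<bar>) \<le> 512 * integral {- ?s..?s} (\<lambda>x. \<bar>nth_deriv_on B1 3 phi x\<bar>)"
    proof (rule coordinate_second_derivative[of phi "?phi 1 ?i" "?phi 2 ?i" "nth_deriv_on B1 3 phi" "Y ?i" "Y1 ?i" "Y2 ?i"])
      show "(phi has_vector_derivative ?phi 1 ?i x) (at x within B1)" if "x \<in> B1" for x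
        using dphi[OF i that, of 0] by simp
      show "(?phi 1 ?i has_vector_derivative ?phi 2 ?i x) (at x within B1)" if "x \<in> B1" for x
        using dphi[OF i that, of 1] by (simp add: numeral_2_eq_2)
      show "(?phi 2 ?i has_vector_derivative nth_deriv_on B1 3 phi x) (at x within B1)" if "x \<in> B1" for x
        using dphi[OF i that, of 2] by (simp add: numeral_3_eq_3 numeral_2_eq_2)
      show "continuous_on B1 (nth_deriv_on B1 3 phi)" by (rule Ck_on_continuous[OF C3[OF i]]) simp
      show "phi 0 = 0" "?phi 1 ?i 0 = 0" using ph[OF i] by (auto simp: phase_def)
      show "(Y ?i x)\<^sup>2 = 2 * phi x" if "x \<in> B1" for x using sq[OF i that] by simp
    qed (use Y[OF i] Y2(1) i cY2 lo[OF i] hi[OF i] s in blast)+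
    finally show "integral {-r..r} (\<lambda>y. norm (vderiv (G ?i) y)) \<le>
        200 * Linf_norm (nth_deriv_on UNIV 1 psi) * ?s +
        5120000 * Linf_norm psi * integral {- ?s..?s} (\<lambda>x. \<bar>nth_deriv_on B1 3 phi x\<bar>)"
      using L0 by (simp add: mult_left_mono)
  qed (use uG in blast)
qed

section \<open>The three remainder estimates\<close>

lemma norm_le_sup_derivs:
  assumes f: "Ck_on B1 j f" and l: "k \<le> l" "l \<le> j" and x: "x \<in> B1"
  shows "norm (nth_deriv_on B1 l f x) \<le> sup_derivs k j f"
proof -
  have bd: "bdd_above ((\<lambda>x. norm (nth_deriv_on B1 n f x)) ` B1)" if "n \<le> j" for n
    by (intro bounded_imp_bdd_above compact_imp_bounded compact_continuous_image continuous_intros Ck_on_continuous[OF f that]) auto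
  have le: "norm (nth_deriv_on B1 n f y) \<le> sup_deriv n f" if "n \<le> j" "y \<in> B1" for n y
    unfolding sup_deriv_def by (rule cSUP_upper[OF that(2) bd[OF that(1)]])
  have nn: "0 \<le> sup_deriv n f" if "n \<le> j" for n
    by (rule order_trans[OF norm_ge_zero le[OF that, of 0]]) simp
  have "norm (nth_deriv_on B1 l f x) \<le> sup_deriv l f" by (rule le[OF l(2) x])
  also have "\<dots> \<le> sup_derivs k j f"
    unfolding sup_derivs_def by (rule member_le_sum) (use l nn in auto)
  finally show ?thesis .
qed

lemma remainder_eq:
  "remainder phi psi lam = osc_integral phi psi lam -
    gauss_const lam * (psi 0 / of_real (sqrt (nth_deriv_on B1 2 phi 0)))"
  by (simp add: remainder_def gauss_const_def)

lemma continuous_on_B1_bounded: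
  fixes f :: "real \<Rightarrow> 'a::real_normed_vector"
  assumes "continuous_on B1 f"
  shows "\<exists>M. \<forall>x\<in>B1. norm (f x) \<le> M"
proof -
  have "bounded (f ` B1)" by (intro compact_imp_bounded compact_continuous_image assms) auto
  then show ?thesis by (auto simp: bounded_iff)
qed

text \<open>The family consists of the given pair alone, so the bounds needed for regularity may
  depend on it; the constant comes solely from the explicit \<open>L^1\<close> estimate. Here
  \<open>1536000000 = 3 * 5120000 * 100\<close>, with \<open>3\<close> from the interval bound and
  \<open>100\<close> from rescaling \<open>r\<close>.\<close>

lemma remainder_Lp_bound:
  assumes p: "p \<ge> 1" and psi: "amplitude psi" and C3: "Ck_on B1 3 phi" and ph: "phase phi" and lam: "lam > 0"
  shows "norm (remainder phi psi lam) \<le>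
    (2 * (4 + 2 * p) * 1536000000) * lam powr (-1 + 1 / (2 * p)) *
      (Lp_norm p (nth_deriv_on B1 3 phi) * Linf_norm psi + Linf_norm (nth_deriv_on UNIV 1 psi))"
proof -
  let ?I = "{(phi, psi)}"
  let ?N = "Lp_norm p (nth_deriv_on B1 3 phi) * Linf_norm psi + Linf_norm (nth_deriv_on UNIV 1 psi)"
  have c3: "continuous_on B1 (nth_deriv_on B1 3 phi)" by (rule Ck_on_continuous[OF C3]) simp
  have bd3: "\<exists>M. \<forall>i\<in>?I. \<forall>x\<in>B1. \<bar>nth_deriv_on B1 3 (fst i) x\<bar> \<le> M"
    using continuous_on_B1_bounded[OF c3] by auto
  obtain G where G0: "G (phi, psi) 0 = psi 0 / of_real (sqrt (nth_deriv_on B1 2 phi 0))"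
    and lim: "\<And>lam. ((\<lambda>L. integral {-L..L} (\<lambda>y. osc lam y * G (phi, psi) y)) \<longlongrightarrow> osc_integral phi psi lam) at_top"
    and L1: "\<And>r. 0 < r \<Longrightarrow>
      integral {-r..r} (\<lambda>y. norm (vderiv (G (phi, psi)) y)) \<le>
        200 * Linf_norm (nth_deriv_on UNIV 1 psi) * min 1 (100 * r) +
        5120000 * Linf_norm psi * integral {- min 1 (100 * r)..min 1 (100 * r)} (\<lambda>x. \<bar>nth_deriv_on B1 3 phi x\<bar>)"
    and uG: "\<And>k. \<lbrakk>\<And>i. i \<in> ?I \<Longrightarrow> Ck_on B1 (k + 2) (fst i);
      \<And>l. l \<le> k \<Longrightarrow> \<exists>M. \<forall>i\<in>?I. \<forall>x\<in>B1. \<bar>nth_deriv_on B1 (l + 2) (fst i) x\<bar> \<le> M;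
      \<And>l. l \<le> k \<Longrightarrow> \<exists>M. \<forall>i\<in>?I. \<forall>x\<in>B1. norm (nth_deriv_on UNIV l (snd i) x) \<le> M\<rbrakk> \<Longrightarrow> ucd UNIV {} ?I k G"
    by (rule phase_reduction[of ?I]) (use psi C3 ph bd3 in auto)
  have "ucd UNIV {} ?I (Suc 0) G"
  proof (rule uG)
    show "Ck_on B1 (Suc 0 + 2) (fst i)" if "i \<in> ?I" for i using that C3 by (simp add: numeral_3_eq_3)
    fix l :: nat assume "l \<le> Suc 0"
    then have "l + 2 \<le> 3" by simp
    from continuous_on_B1_bounded[OF Ck_on_continuous[OF C3 this]]
    show "\<exists>M. \<forall>i\<in>?I. \<forall>x\<in>B1. \<bar>nth_deriv_on B1 (l + 2) (fst i) x\<bar> \<le> M" by auto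
    from continuous_on_B1_bounded[OF amplitude_continuous[OF psi]]
    show "\<exists>M. \<forall>i\<in>?I. \<forall>x\<in>B1. norm (nth_deriv_on UNIV l (snd i) x) \<le> M" by auto
  qed
  then have uG1: "ucd UNIV {} {()} (Suc 0) (\<lambda>_. G (phi, psi))"
    by (rule ucd_reindex) simp
  have cpsi: "continuous_on B1 psi" using amplitude_continuous[OF psi, of _ 0] by simp
  have L0: "0 \<le> Linf_norm psi" by (rule order_trans[OF norm_ge_zero norm_le_Linf_norm[OF cpsi, of 0]]) simp
  have L10: "0 \<le> Linf_norm (nth_deriv_on UNIV 1 psi)"
    by (rule order_trans[OF norm_ge_zero norm_le_Linf_norm[OF amplitude_continuous[OF psi], of 0]]) simp
  have N0: "0 \<le> ?N" using L0 L10 by (simp add: Lp_norm_def)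
  have bound: "integral {-r..r} (\<lambda>y. norm (vderiv (G (phi, psi)) y)) \<le> (1536000000 * ?N) * r powr (1 - 1/p)"
    if r: "0 < r" for r
  proof -
    let ?s = "min 1 (100 * r)"
    have s: "0 < ?s" "?s \<le> 1" using r by auto
    have e: "0 \<le> 1 - 1/p" "1 - 1/p \<le> 1" using p by auto
    \<comment> \<open>As \<open>s \<le> 1\<close>, the linear term from \<open>psi'\<close> is
      absorbed into the same power \<open>s powr (1 - 1/p)\<close> that the third derivative
      produces.\<close>
    have 1: "?s \<le> ?s powr (1 - 1/p)"
      using powr_mono'[OF e(2), of ?s] s by simp
    have 2: "?s powr (1 - 1/p) \<le> 100 * r powr (1 - 1/p)"
    proof -
      have "?s powr (1 - 1/p) \<le> (100 * r) powr (1 - 1/p)" using s e by (intro powr_mono2) auto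
      also have "\<dots> = 100 powr (1 - 1/p) * r powr (1 - 1/p)" using r by (simp add: powr_mult)
      also have "\<dots> \<le> 100 powr 1 * r powr (1 - 1/p)" using e by (intro mult_right_mono powr_mono) auto
      finally show ?thesis by simp
    qed
    have "integral {-r..r} (\<lambda>y. norm (vderiv (G (phi, psi)) y)) \<le>
        200 * Linf_norm (nth_deriv_on UNIV 1 psi) * ?s + 5120000 * Linf_norm psi * integral {- ?s..?s} (\<lambda>x. \<bar>nth_deriv_on B1 3 phi x\<bar>)"
      by (rule L1[OF r])
    also have "\<dots> \<le> 15360000 * Linf_norm (nth_deriv_on UNIV 1 psi) * ?s powr (1 - 1/p) +
        5120000 * Linf_norm psi * (3 * ?s powr (1 - 1/p) * Lp_norm p (nth_deriv_on B1 3 phi))"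
      using L0 L10 1 s Lp_norm_interval_bound[OF c3 p s] by (intro add_mono mult_mono mult_left_mono) auto
    also have "\<dots> = 15360000 * ?N * ?s powr (1 - 1/p)" by (simp add: algebra_simps)
    also have "\<dots> \<le> 15360000 * ?N * (100 * r powr (1 - 1/p))" using N0 2 by (intro mult_left_mono) auto
    also have "\<dots> = (1536000000 * ?N) * r powr (1 - 1/p)" by (simp only: mult_ac)
    finally show ?thesis .
  qed
  have "norm (osc_integral phi psi lam - gauss_const lam * G (phi, psi) 0) \<le>
      2 * (4 + 2 * p) * (1536000000 * ?N) * lam powr (-1 + 1 / (2 * p))"
    by (rule first_order_Lp_bound[OF lam p uG1 _ bound lim]) (use N0 in auto)
  then show ?thesis unfolding remainder_eq G0 by (simp only: ac_simps)
qed

text \<open>For fixed \<open>s\<close> and \<open>t\<close>, all pairs with these two derivative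
  sums form one uniformly bounded family, so a single \<open>C\<close> exists for them; it is never
  computed. This is the case \<open>K = 0\<close> of the expansion, which requires \<open>G\<close>
  in \<open>C^2\<close>.\<close>

lemma remainder_second_order:
  "\<exists>C\<ge>0. \<forall>phi psi lam. amplitude psi \<longrightarrow> Ck_on B1 4 phi \<longrightarrow> phase phi \<longrightarrow> lam > 0 \<longrightarrow>
    sup_derivs 2 4 phi = s \<longrightarrow> sup_derivs 0 2 psi = t \<longrightarrow>
    norm (remainder phi psi lam) \<le> lam powr (-3/2) * C"
proof -
  let ?I = "{(phi, psi). amplitude psi \<and> Ck_on B1 4 phi \<and> phase phi \<and> sup_derivs 2 4 phi = s \<and> sup_derivs 0 2 psi = t}"
  have C3: "Ck_on B1 3 phi" if "Ck_on B1 4 phi" for phi :: "real \<Rightarrow> real"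
    using that Ck_on_continuous[OF that, of 3] by (auto simp: Ck_on_def)
  have bphi: "\<bar>nth_deriv_on B1 (l + 2) (fst i) x\<bar> \<le> s" if "i \<in> ?I" "l \<le> 2" "x \<in> B1" for l i x
    using norm_le_sup_derivs[of 4 "fst i" 2 "l + 2" x] that by auto
  have bpsi: "norm (nth_deriv_on UNIV l (snd i) x) \<le> t" if "i \<in> ?I" "l \<le> 2" "x \<in> B1" for l i x
  proof -
    have amp: "amplitude (snd i)" using that by auto
    have "Ck_on B1 2 (snd i)"
      unfolding Ck_on_def
    proof (intro conjI allI impI ballI)
      have eq: "nth_deriv_on B1 j (snd i) y = nth_deriv_on UNIV j (snd i) y" if "y \<in> B1" for j y
        by (rule amplitude_nth_deriv_B1[OF amp that])
      show "continuous_on B1 (nth_deriv_on B1 2 (snd i))"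
        by (subst continuous_on_cong[OF refl eq]) (auto intro: amplitude_continuous amp)
      fix j y assume y: "y \<in> B1"
      have "(nth_deriv_on B1 j (snd i) has_vector_derivative nth_deriv_on UNIV (Suc j) (snd i) y) (at y within B1)"
        by (rule has_vector_derivative_transform[OF y eq has_vector_derivative_at_within[OF amplitude_derivative[OF amp]]])
      then show "nth_deriv_on B1 j (snd i) differentiable (at y within B1)"
        by (rule differentiableI_vector)
    qed
    from norm_le_sup_derivs[OF this, of 0 l x] show ?thesis
      using that amplitude_nth_deriv_B1[OF amp that(3)] by auto
  qed
  obtain G where G0: "\<And>phi psi. (phi, psi) \<in> ?I \<Longrightarrow> G (phi, psi) 0 = psi 0 / of_real (sqrt (nth_deriv_on B1 2 phi 0))"
    and lim: "\<And>phi psi lam. (phi, psi) \<in> ?I \<Longrightarrow>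
      ((\<lambda>L. integral {-L..L} (\<lambda>y. osc lam y * G (phi, psi) y)) \<longlongrightarrow> osc_integral phi psi lam) at_top"
    and uG: "\<And>k. \<lbrakk>\<And>i. i \<in> ?I \<Longrightarrow> Ck_on B1 (k + 2) (fst i);
      \<And>l. l \<le> k \<Longrightarrow> \<exists>M. \<forall>i\<in>?I. \<forall>x\<in>B1. \<bar>nth_deriv_on B1 (l + 2) (fst i) x\<bar> \<le> M;
      \<And>l. l \<le> k \<Longrightarrow> \<exists>M. \<forall>i\<in>?I. \<forall>x\<in>B1. norm (nth_deriv_on UNIV l (snd i) x) \<le> M\<rbrakk> \<Longrightarrow> ucd UNIV {} ?I k G"
  proof (rule phase_reduction[of ?I])
    show "\<exists>M. \<forall>i\<in>?I. \<forall>x\<in>B1. \<bar>nth_deriv_on B1 3 (fst i) x\<bar> \<le> M"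
      using bphi[of _ 1] by (intro exI[of _ s]) (simp add: numeral_3_eq_3)
  qed (use C3 in auto)
  have "ucd UNIV {} ?I (2 * 0 + 2) G"
  proof (rule uG)
    show "Ck_on B1 (2 * 0 + 2 + 2) (fst i)" if "i \<in> ?I" for i using that by (auto simp: numeral_eq_Suc)
  next
    fix l :: nat assume "l \<le> 2 * 0 + 2"
    then have "l \<le> 2" by simp
    then show "\<exists>M. \<forall>i\<in>?I. \<forall>x\<in>B1. \<bar>nth_deriv_on B1 (l + 2) (fst i) x\<bar> \<le> M"
      "\<exists>M. \<forall>i\<in>?I. \<forall>x\<in>B1. norm (nth_deriv_on UNIV l (snd i) x) \<le> M"
      using bphi bpsi by blast+
  qed
  from stationary_phase_expansion[OF this] obtain C where C: "C \<ge> 0"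
    "\<forall>i\<in>?I. \<forall>lam>0. \<forall>J. ((\<lambda>L. integral {-L..L} (\<lambda>y. osc lam y * G i y)) \<longlongrightarrow> J) at_top \<longrightarrow>
    norm (J - gauss_const lam * (\<Sum>k\<le>0. (\<i> / of_real lam) ^ k * (phase_step ^^ k) (G i) 0))
      \<le> C * lam powr (- real 0 - 3/2)" by blast
  show ?thesis
  proof (intro exI[of _ C] conjI C(1) allI impI)
    fix phi psi lam
    assume "amplitude psi" "Ck_on B1 4 phi" "phase phi" and lam: "lam > (0::real)" and "sup_derivs 2 4 phi = s" "sup_derivs 0 2 psi = t"
    then have i: "(phi, psi) \<in> ?I" by simp
    have "norm (osc_integral phi psi lam - gauss_const lam * (\<Sum>k\<le>0. (\<i> / of_real lam) ^ k * (phase_step ^^ k) (G (phi, psi)) 0))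
      \<le> C * lam powr (- real 0 - 3/2)"
      using C(2) i lam lim[OF i] by blast
    then show "norm (remainder phi psi lam) \<le> lam powr (-3/2) * C"
      by (simp add: remainder_eq G0[OF i] mult.commute)
  qed
qed

lemma remainder_expansion:
  fixes Cb :: "nat \<Rightarrow> real"
  shows "\<exists>(C::nat \<Rightarrow> real) (C'::nat \<Rightarrow> real).
       \<forall>(phi::real \<Rightarrow> real) (psi::real \<Rightarrow> complex).
          amplitude psi \<longrightarrow> Cinf_on B1 phi \<longrightarrow> phase phi \<longrightarrow>
          (\<forall>k x. \<bar>x\<bar> < 1 \<longrightarrow> norm (nth_deriv_on UNIV k psi x) \<le> Cb k) \<longrightarrow>
          (\<forall>k x. \<bar>x\<bar> < 1 \<longrightarrow> \<bar>nth_deriv_on B1 k phi x\<bar> \<le> Cb k) \<longrightarrow>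
          (\<exists>a::nat \<Rightarrow> complex. \<forall>K::nat.
             (\<forall>k\<in>{1..K}. norm (a k) \<le> C K ^ k) \<and>
             (\<exists>Rt::real \<Rightarrow> complex. \<forall>lam>0.
                remainder phi psi lam =
                  of_real (sqrt (2 * pi) * lam powr (-1/2)) * exp (\<i> * of_real pi / 4) *
                    (\<Sum>k=1..K. a k * of_real (lam powr (- real k)) / fact k) + Rt lam \<and>
                norm (Rt lam) \<le> C' K * lam powr (- real K - 3/2)))"
proof -
  let ?I = "{(phi, psi). amplitude psi \<and> Cinf_on B1 phi \<and> phase phi \<and>
      (\<forall>k x. \<bar>x\<bar> < 1 \<longrightarrow> norm (nth_deriv_on UNIV k psi x) \<le> Cb k) \<and>
      (\<forall>k x. \<bar>x\<bar> < 1 \<longrightarrow> \<bar>nth_deriv_on B1 k phi x\<bar> \<le> Cb k)}"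
  \<comment> \<open>The assumed bounds hold on the open interval; continuity carries them to the
    closed one.\<close>
  have ext: "norm (f x) \<le> M" if "continuous_on B1 f" "\<And>x. \<bar>x\<bar> < 1 \<Longrightarrow> norm (f x) \<le> M" "x \<in> B1"
    for f :: "real \<Rightarrow> 'b::real_normed_vector" and M x
  proof (rule continuous_on_closure_norm_le[where s = "{-1<..<1}"])
    show "continuous_on (closure {-1<..<1}) f" "x \<in> closure {-1<..<1::real}" using that by auto
  qed (use that in auto)
  have bphi: "\<bar>nth_deriv_on B1 l (fst i) x\<bar> \<le> Cb l" if "i \<in> ?I" "x \<in> B1" for l i x
  proof -
    have "continuous_on B1 (nth_deriv_on B1 l (fst i))"
      by (rule Ck_on_continuous[of _ l]) (use that in \<open>auto simp: Cinf_on_def\<close>)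
    from ext[OF this, of "Cb l" x] show ?thesis using that by auto
  qed
  have bpsi: "norm (nth_deriv_on UNIV l (snd i) x) \<le> Cb l" if "i \<in> ?I" "x \<in> B1" for l i x
    by (rule ext[OF amplitude_continuous]) (use that in auto)
  obtain G where G0: "\<And>phi psi. (phi, psi) \<in> ?I \<Longrightarrow> G (phi, psi) 0 = psi 0 / of_real (sqrt (nth_deriv_on B1 2 phi 0))"
    and lim: "\<And>phi psi lam. (phi, psi) \<in> ?I \<Longrightarrow>
      ((\<lambda>L. integral {-L..L} (\<lambda>y. osc lam y * G (phi, psi) y)) \<longlongrightarrow> osc_integral phi psi lam) at_top"
    and uG0: "\<And>k. \<lbrakk>\<And>i. i \<in> ?I \<Longrightarrow> Ck_on B1 (k + 2) (fst i);
      \<And>l. l \<le> k \<Longrightarrow> \<exists>M. \<forall>i\<in>?I. \<forall>x\<in>B1. \<bar>nth_deriv_on B1 (l + 2) (fst i) x\<bar> \<le> M;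
      \<And>l. l \<le> k \<Longrightarrow> \<exists>M. \<forall>i\<in>?I. \<forall>x\<in>B1. norm (nth_deriv_on UNIV l (snd i) x) \<le> M\<rbrakk> \<Longrightarrow> ucd UNIV {} ?I k G"
  proof (rule phase_reduction[of ?I])
    show "\<exists>M. \<forall>i\<in>?I. \<forall>x\<in>B1. \<bar>nth_deriv_on B1 3 (fst i) x\<bar> \<le> M"
      using bphi by blast
  qed (auto simp: Cinf_on_def)
  have uG: "ucd UNIV {} ?I k G" for k
  proof (rule uG0)
    show "Ck_on B1 (k + 2) (fst i)" if "i \<in> ?I" for i using that by (auto simp: Cinf_on_def)
  qed (use bphi bpsi in blast)+
  have "\<forall>k. \<exists>M. 0 \<le> M \<and> (\<forall>i\<in>?I. norm ((phase_step ^^ k) (G i) 0) \<le> M)"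
  proof
    fix k
    obtain M where "M \<ge> 0" "\<forall>i\<in>?I. \<forall>x\<in>UNIV. norm ((phase_step ^^ k) (G i) x) \<le> M"
      by (rule ucd_bound[OF ucd_phase_step_iterate[of ?I k 0, OF uG]])
    then show "\<exists>M. 0 \<le> M \<and> (\<forall>i\<in>?I. norm ((phase_step ^^ k) (G i) 0) \<le> M)" by blast
  qed
  from choice[OF this] obtain M where M':
    "\<forall>k. 0 \<le> M k \<and> (\<forall>i\<in>?I. norm ((phase_step ^^ k) (G i) 0) \<le> M k)" ..
  have M: "0 \<le> M k" "i \<in> ?I \<Longrightarrow> norm ((phase_step ^^ k) (G i) 0) \<le> M k" for k i
    using M' by blast+
  have "\<forall>K. \<exists>C\<ge>0. \<forall>i\<in>?I. \<forall>lam>0. \<forall>J.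
      ((\<lambda>L. integral {-L..L} (\<lambda>y. osc lam y * G i y)) \<longlongrightarrow> J) at_top \<longrightarrow>
      norm (J - gauss_const lam * (\<Sum>k\<le>K. (\<i> / of_real lam) ^ k * (phase_step ^^ k) (G i) 0))
      \<le> C * lam powr (- real K - 3/2)"
    by (intro allI stationary_phase_expansion uG)
  from choice[OF this] obtain C' where C0: "\<forall>K. 0 \<le> C' K \<and> (\<forall>i\<in>?I. \<forall>lam>0. \<forall>J.
      ((\<lambda>L. integral {-L..L} (\<lambda>y. osc lam y * G i y)) \<longlongrightarrow> J) at_top \<longrightarrow>
      norm (J - gauss_const lam * (\<Sum>k\<le>K. (\<i> / of_real lam) ^ k * (phase_step ^^ k) (G i) 0))
      \<le> C' K * lam powr (- real K - 3/2))" ..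
  have C': "norm (J - gauss_const lam * (\<Sum>k\<le>K. (\<i> / of_real lam) ^ k * (phase_step ^^ k) (G i) 0))
      \<le> C' K * lam powr (- real K - 3/2)"
    if "i \<in> ?I" "lam > 0" "((\<lambda>L. integral {-L..L} (\<lambda>y. osc lam y * G i y)) \<longlongrightarrow> J) at_top" for K i lam J
    using C0 that by blast
  \<comment> \<open>Being at least \<open>1\<close>, \<open>C K\<close> satisfies
    \<open>C K \<le> C K ^ k\<close> for \<open>k \<ge> 1\<close>; so it suffices to dominate
    \<open>fact k * M k\<close> for the finitely many \<open>k \<le> K\<close>.\<close>
  define C where "C K = 1 + (\<Sum>k\<le>K. fact k * M k)" for K
  show ?thesis
  proof (rule exI[of _ C], rule exI[of _ C'], intro allI impI)
    fix phi psi
    assume "amplitude psi" "Cinf_on B1 phi" "phase phi"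
      "\<forall>k x. \<bar>x\<bar> < 1 \<longrightarrow> norm (nth_deriv_on UNIV k psi x) \<le> Cb k"
      "\<forall>k x. \<bar>x\<bar> < 1 \<longrightarrow> \<bar>nth_deriv_on B1 k phi x\<bar> \<le> Cb k"
    then have i: "(phi, psi) \<in> ?I" by simp
    define T where "T k = (phase_step ^^ k) (G (phi, psi)) 0" for k
    define a where "a k = fact k * \<i> ^ k * T k" for k
    have a: "norm (a k) \<le> C K ^ k" if "k \<in> {1..K}" for k K
    proof -
      have "norm (a k) = fact k * norm (T k)" by (simp add: a_def norm_mult norm_power)
      also have "\<dots> \<le> fact k * M k" using M(2)[OF i] by (simp add: T_def)
      also have "\<dots> \<le> (\<Sum>k\<le>K. fact k * M k)"
        by (rule member_le_sum) (use that M(1) in auto)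
      also have "\<dots> \<le> C K" by (simp add: C_def)
      also have "C K \<le> C K ^ k"
      proof (rule self_le_power)
        show "1 \<le> C K" unfolding C_def using M(1) by (simp add: sum_nonneg)
      qed (use that in auto)
      finally show ?thesis .
    qed
    have coeff: "a k * of_real (lam powr (- real k)) / fact k = (\<i> / of_real lam) ^ k * T k" if "lam > 0" for k lam
    proof -
      have "lam powr (- real k) = 1 / lam ^ k" using that by (simp add: powr_minus_divide powr_realpow)
      then show ?thesis by (simp add: a_def power_divide)
    qed
    have bd: "norm (remainder phi psi lam - gauss_const lam * (\<Sum>k=1..K. a k * of_real (lam powr (- real k)) / fact k))
        \<le> C' K * lam powr (- real K - 3/2)" if lam: "lam > 0" for lam K
    proof -
      \<comment> \<open>The term \<open>k = 0\<close> is \<open>G 0\<close>, the leading term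
        already subtracted in \<open>remainder\<close>.\<close>
      have "(\<Sum>k\<le>K. (\<i> / of_real lam) ^ k * T k) = T 0 + (\<Sum>k=1..K. (\<i> / of_real lam) ^ k * T k)"
        by (simp add: sum.atLeast1_atMost_eq atMost_atLeast0 sum.atLeast0_atMost_Suc_shift sum.atLeast_Suc_atMost)
      also have "(\<Sum>k=1..K. (\<i> / of_real lam) ^ k * T k) = (\<Sum>k=1..K. a k * of_real (lam powr (- real k)) / fact k)"
        by (simp only: coeff[OF lam])
      finally have "remainder phi psi lam - gauss_const lam * (\<Sum>k=1..K. a k * of_real (lam powr (- real k)) / fact k) =
          osc_integral phi psi lam - gauss_const lam * (\<Sum>k\<le>K. (\<i> / of_real lam) ^ k * T k)"
        using G0[OF i] by (simp add: remainder_eq T_def algebra_simps)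
      then show ?thesis using C'[OF i lam lim[OF i], of K] by (simp only: T_def)
    qed
    show "\<exists>a. \<forall>K. (\<forall>k\<in>{1..K}. norm (a k) \<le> C K ^ k) \<and>
             (\<exists>Rt::real \<Rightarrow> complex. \<forall>lam>0.
                remainder phi psi lam =
                  of_real (sqrt (2 * pi) * lam powr (-1/2)) * exp (\<i> * of_real pi / 4) *
                    (\<Sum>k=1..K. a k * of_real (lam powr (- real k)) / fact k) + Rt lam \<and>
                norm (Rt lam) \<le> C' K * lam powr (- real K - 3/2))"
    proof (intro exI[of _ a] allI conjI ballI a, assumption)
      fix K
      show "\<exists>Rt::real \<Rightarrow> complex. \<forall>lam>0.
                remainder phi psi lam =
                  of_real (sqrt (2 * pi) * lam powr (-1/2)) * exp (\<i> * of_real pi / 4) *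
                    (\<Sum>k=1..K. a k * of_real (lam powr (- real k)) / fact k) + Rt lam \<and>
                norm (Rt lam) \<le> C' K * lam powr (- real K - 3/2)"
        unfolding gauss_const_def[symmetric]
        by (intro exI[of _ "\<lambda>lam. remainder phi psi lam - gauss_const lam * (\<Sum>k=1..K. a k * of_real (lam powr (- real k)) / fact k)"]
            allI impI conjI bd) simp
    qed
  qed
qed

theorem theorem2p1:
  shows
    "(\<forall>p::real. p \<ge> 1 \<longrightarrow>
       (\<exists>C::real. \<forall>(\<phi>::real \<Rightarrow> real) (\<psi>::real \<Rightarrow> complex) (lam::real).
          amplitude \<psi> \<longrightarrow> Ck_on B1 3 \<phi> \<longrightarrow> phase \<phi> \<longrightarrow> lam > 0 \<longrightarrow>
          norm (remainder \<phi> \<psi> lam) \<le>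
            C * lam powr (-1 + 1 / (2 * p)) *
              (Lp_norm p (nth_deriv_on B1 3 \<phi>) * Linf_norm \<psi> + Linf_norm (nth_deriv_on UNIV 1 \<psi>))))
     \<and>
     (\<exists>C::real \<Rightarrow> real \<Rightarrow> real. (\<forall>s t. C s t \<ge> 0) \<and>
       (\<forall>(\<phi>::real \<Rightarrow> real) (\<psi>::real \<Rightarrow> complex) (lam::real).
          amplitude \<psi> \<longrightarrow> Ck_on B1 4 \<phi> \<longrightarrow> phase \<phi> \<longrightarrow> lam > 0 \<longrightarrow>
          norm (remainder \<phi> \<psi> lam) \<le>
            lam powr (-3/2) * C (sup_derivs 2 4 \<phi>) (sup_derivs 0 2 \<psi>)))
     \<and>
     (\<forall>Cb::nat \<Rightarrow> real. \<exists>(C::nat \<Rightarrow> real) (C'::nat \<Rightarrow> real).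
       \<forall>(\<phi>::real \<Rightarrow> real) (\<psi>::real \<Rightarrow> complex).
          amplitude \<psi> \<longrightarrow> Cinf_on B1 \<phi> \<longrightarrow> phase \<phi> \<longrightarrow>
          (\<forall>k x. \<bar>x\<bar> < 1 \<longrightarrow> norm (nth_deriv_on UNIV k \<psi> x) \<le> Cb k) \<longrightarrow>
          (\<forall>k x. \<bar>x\<bar> < 1 \<longrightarrow> \<bar>nth_deriv_on B1 k \<phi> x\<bar> \<le> Cb k) \<longrightarrow>
          (\<exists>a::nat \<Rightarrow> complex. \<forall>K::nat.
             (\<forall>k\<in>{1..K}. norm (a k) \<le> C K ^ k) \<and>
             (\<exists>Rt::real \<Rightarrow> complex. \<forall>lam>0.
                remainder \<phi> \<psi> lam =
                  of_real (sqrt (2 * pi) * lam powr (-1/2)) * exp (\<i> * of_real pi / 4) *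
                    (\<Sum>k=1..K. a k * of_real (lam powr (- real k)) / fact k) + Rt lam \<and>
                norm (Rt lam) \<le> C' K * lam powr (- real K - 3/2))))"
proof (intro conjI allI impI)
  fix p :: real assume p: "p \<ge> 1"
  show "\<exists>C. \<forall>\<phi> \<psi> lam. amplitude \<psi> \<longrightarrow> Ck_on B1 3 \<phi> \<longrightarrow> phase \<phi> \<longrightarrow> lam > 0 \<longrightarrow>
          norm (remainder \<phi> \<psi> lam) \<le>
            C * lam powr (-1 + 1 / (2 * p)) *
              (Lp_norm p (nth_deriv_on B1 3 \<phi>) * Linf_norm \<psi> + Linf_norm (nth_deriv_on UNIV 1 \<psi>))"
    using remainder_Lp_bound[OF p] by blast
next
  \<comment> \<open>One constant for each pair of values; choice turns them into a function of
    \<open>s\<close> and \<open>t\<close>.\<close>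
  have "\<forall>s t. \<exists>C\<ge>0. \<forall>\<phi> \<psi> lam. amplitude \<psi> \<longrightarrow> Ck_on B1 4 \<phi> \<longrightarrow> phase \<phi> \<longrightarrow> lam > 0 \<longrightarrow>
    sup_derivs 2 4 \<phi> = s \<longrightarrow> sup_derivs 0 2 \<psi> = t \<longrightarrow> norm (remainder \<phi> \<psi> lam) \<le> lam powr (-3/2) * C"
    by (intro allI remainder_second_order)
  then obtain C where "\<forall>s t. C s t \<ge> 0 \<and> (\<forall>\<phi> \<psi> lam. amplitude \<psi> \<longrightarrow> Ck_on B1 4 \<phi> \<longrightarrow> phase \<phi> \<longrightarrow> lam > 0 \<longrightarrow>
    sup_derivs 2 4 \<phi> = s \<longrightarrow> sup_derivs 0 2 \<psi> = t \<longrightarrow> norm (remainder \<phi> \<psi> lam) \<le> lam powr (-3/2) * C s t)"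
    unfolding choice_iff by blast
  then show "\<exists>C::real \<Rightarrow> real \<Rightarrow> real. (\<forall>s t. C s t \<ge> 0) \<and>
       (\<forall>\<phi> \<psi> lam. amplitude \<psi> \<longrightarrow> Ck_on B1 4 \<phi> \<longrightarrow> phase \<phi> \<longrightarrow> lam > 0 \<longrightarrow>
          norm (remainder \<phi> \<psi> lam) \<le> lam powr (-3/2) * C (sup_derivs 2 4 \<phi>) (sup_derivs 0 2 \<psi>))"
    by (intro exI[of _ C]) simp
qed (rule remainder_expansion)

end
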